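(* Let a unital separable $C^*$-algebra $A$ be isomorphic to a maximal full algebra $\Gamma(\mathcal A)$ of operator fields over a compact Hausdorff space $T$, where $\mathcal A=\{A_t\}_{t\in T}$ is a family of $C^*$-algebras. Then the bounded linear functionals on $A\cong\Gamma(\mathcal A)$ can be identified with the RBA AOFM associated with $\Gamma(\mathcal A)$ (defined on the algebra $\Sigma$ of subsets of $T$ generated by the closed subsets): the linear map $\mu\mapsto\mu(T)$ is a bijection from the space of RBA AOFM associated with $\Gamma(\mathcal A)$ onto $A^*$.
   Context: Operator fields. Let $T$ be a topological space with a $C^*$-algebra $A_t$ assigned to each $t\in T$. An operator field is a map sending each $t\in T$ to an element of $A_t$. A full algebra of operator fields is a family $A$ of operator fields such that: (1) $A$ is a $*$-algebra under pointwise operations; (2) for each $x\in A$ the function $t\mapsto\|x(t)\|$ is continuous on $T$ and vanishes at infinity (void for compact $T$); (3) for each $t$ the set $\{x(t): x\in A\}$ is dense in $A_t$; (4) $A$ is complete in the norm $\|x\|=\sup_t\|x(t)\|$. It is maximal if it is not properly contained in another full algebra of operator fields on the same $T$, $\{A_t\}$. $\Gamma(\mathcal A)$ denotes the realization of $A$ as an algebra of fields (sections), and $\widehat a$ the section corresponding to $a\in A$. Measures. Let $\Sigma$ be an algebra of subsets of $T$. A measure associated with the maximal full algebra $A=\Gamma(\mathcal A)$ (AOFM) is a set function $\mu:\Sigma\to A^*$, $S\mapsto\mu(S)$, such that $\mu(S)(a)=0$ whenever $\operatorname{supp}\widehat a\cap S=\emptyset$. It is additive if $\mu(\bigsqcup_i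 S_i)(a)=\sum_i\mu(S_i)(a)$ for all finite disjoint families $\{S_i\}$ in $\Sigma$ and all $a\in A$. It is bounded if $\|\mu\|:=\sup\sum_i\|\mu(S_i)\|$, the supremum over finite partitions $\{S_i\}$ of $T$ into members of $\Sigma$, is finite. A BA AOFM is a bounded additive AOFM. A BA AOFM is $*$-weakly regular (an RBA AOFM) if for any $E\in\Sigma$, $a\in A$ and $\varepsilon>0$ there exist $F\in\Sigma$ whose closure is contained in $E$ and $G\in\Sigma$ whose interior contains $E$ such that $|\mu(C)(a)|<\varepsilon$ for every $C\in\Sigma$ with $C\subset G\setminus F$. *)

theory Defs
  imports "HOL-Analysis.Analysis"
begin

section \<open>C*-algebras\<close>

text \<open>Structures are carrier based, because the fibres \<open>A\<^sub>t\<close> of a field of algebras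
  are different algebras that have to share one type.\<close>

record 'a star_struct =
  carrier :: "'a set"
  add :: "'a \<Rightarrow> 'a \<Rightarrow> 'a" (infixl \<open>\<oplus>\<index>\<close> 65)
  zero :: 'a (\<open>\<zero>\<index>\<close>)
  mult :: "'a \<Rightarrow> 'a \<Rightarrow> 'a" (infixl \<open>\<otimes>\<index>\<close> 70)
  scale :: "complex \<Rightarrow> 'a \<Rightarrow> 'a" (infixr \<open>\<odot>\<index>\<close> 75)
  adj :: "'a \<Rightarrow> 'a"
  nrm :: "'a \<Rightarrow> real"

locale star_algebra =
  fixes A :: "'a star_struct" (structure)
  assumes add_closed: "\<lbrakk>x \<in> carrier A; y \<in> carrier A\<rbrakk> \<Longrightarrow> x \<oplus> y \<in> carrier A"
    and zero_closed: "\<zero> \<in> carrier A"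
    and mult_closed: "\<lbrakk>x \<in> carrier A; y \<in> carrier A\<rbrakk> \<Longrightarrow> x \<otimes> y \<in> carrier A"
    and scale_closed: "x \<in> carrier A \<Longrightarrow> c \<odot> x \<in> carrier A"
    and adj_closed: "x \<in> carrier A \<Longrightarrow> adj A x \<in> carrier A"
    and add_assoc: "\<lbrakk>x \<in> carrier A; y \<in> carrier A; z \<in> carrier A\<rbrakk>
          \<Longrightarrow> (x \<oplus> y) \<oplus> z = x \<oplus> (y \<oplus> z)"
    and add_commute: "\<lbrakk>x \<in> carrier A; y \<in> carrier A\<rbrakk> \<Longrightarrow> x \<oplus> y = y \<oplus> x"
    and add_zero: "x \<in> carrier A \<Longrightarrow> x \<oplus> \<zero> = x"
    and add_inverse: "x \<in> carrier A \<Longrightarrow> \<exists>y\<in>carrier A. x \<oplus> y = \<zero>"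
    and scale_add_right: "\<lbrakk>x \<in> carrier A; y \<in> carrier A\<rbrakk> \<Longrightarrow> c \<odot> (x \<oplus> y) = c \<odot> x \<oplus> c \<odot> y"
    and scale_add_left: "x \<in> carrier A \<Longrightarrow> (c + d) \<odot> x = c \<odot> x \<oplus> d \<odot> x"
    and scale_scale: "x \<in> carrier A \<Longrightarrow> c \<odot> (d \<odot> x) = (c * d) \<odot> x"
    and scale_one: "x \<in> carrier A \<Longrightarrow> 1 \<odot> x = x"
    and mult_assoc: "\<lbrakk>x \<in> carrier A; y \<in> carrier A; z \<in> carrier A\<rbrakk>
          \<Longrightarrow> (x \<otimes> y) \<otimes> z = x \<otimes> (y \<otimes> z)"
    and mult_add_left: "\<lbrakk>x \<in> carrier A; y \<in> carrier A; z \<in> carrier A\<rbrakk>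
          \<Longrightarrow> (x \<oplus> y) \<otimes> z = x \<otimes> z \<oplus> y \<otimes> z"
    and mult_add_right: "\<lbrakk>x \<in> carrier A; y \<in> carrier A; z \<in> carrier A\<rbrakk>
          \<Longrightarrow> x \<otimes> (y \<oplus> z) = x \<otimes> y \<oplus> x \<otimes> z"
    and mult_scale_left: "\<lbrakk>x \<in> carrier A; y \<in> carrier A\<rbrakk> \<Longrightarrow> (c \<odot> x) \<otimes> y = c \<odot> (x \<otimes> y)"
    and mult_scale_right: "\<lbrakk>x \<in> carrier A; y \<in> carrier A\<rbrakk> \<Longrightarrow> x \<otimes> (c \<odot> y) = c \<odot> (x \<otimes> y)"
    and adj_adj: "x \<in> carrier A \<Longrightarrow> adj A (adj A x) = x"
    and adj_add: "\<lbrakk>x \<in> carrier A; y \<in> carrier A\<rbrakk> \<Longrightarrow> adj A (x \<oplus> y) = adj A x \<oplus> adj A y"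
    and adj_scale: "x \<in> carrier A \<Longrightarrow> adj A (c \<odot> x) = cnj c \<odot> adj A x"
    and adj_mult: "\<lbrakk>x \<in> carrier A; y \<in> carrier A\<rbrakk> \<Longrightarrow> adj A (x \<otimes> y) = adj A y \<otimes> adj A x"

text \<open>The locale \<open>Metric_space\<close> requires symmetry and nonnegativity also off the carrier,
  hence the value 0 there.\<close>

definition nrm_dist :: "'a star_struct \<Rightarrow> 'a \<Rightarrow> 'a \<Rightarrow> real" where
  "nrm_dist A x y =
     (if x \<in> carrier A \<and> y \<in> carrier A then nrm A (add A x (scale A (-1) y)) else 0)"

definition nrm_topology :: "'a star_struct \<Rightarrow> 'a topology" where
  "nrm_topology A = Metric_space.mtopology (carrier A) (nrm_dist A)"

locale cstar_algebra = star_algebra +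
  assumes nrm_eq_0: "x \<in> carrier A \<Longrightarrow> nrm A x = 0 \<longleftrightarrow> x = \<zero>"
    and nrm_triangle: "\<lbrakk>x \<in> carrier A; y \<in> carrier A\<rbrakk> \<Longrightarrow> nrm A (x \<oplus> y) \<le> nrm A x + nrm A y"
    and nrm_scale: "x \<in> carrier A \<Longrightarrow> nrm A (c \<odot> x) = cmod c * nrm A x"
    and nrm_mult: "\<lbrakk>x \<in> carrier A; y \<in> carrier A\<rbrakk> \<Longrightarrow> nrm A (x \<otimes> y) \<le> nrm A x * nrm A y"
    and cstar_identity: "x \<in> carrier A \<Longrightarrow> nrm A (adj A x \<otimes> x) = (nrm A x)\<^sup>2"
    and complete: "Metric_space.mcomplete (carrier A) (nrm_dist A)"

context cstar_algebra
begin

lemma scale_zero_left: assumes "x \<in> carrier A" shows "0 \<odot> x = \<zero>"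
proof -
  obtain y where y: "y \<in> carrier A" "0 \<odot> x \<oplus> y = \<zero>"
    using add_inverse scale_closed assms by blast
  have "0 \<odot> x \<oplus> 0 \<odot> x = 0 \<odot> x"
    using scale_add_left[OF assms, of 0 0] by simp
  then have "\<zero> = 0 \<odot> x \<oplus> (0 \<odot> x \<oplus> y)"
    using add_assoc[OF scale_closed[OF assms, of 0] scale_closed[OF assms, of 0] y(1)] y(2) by simp
  then show ?thesis
    using add_zero[OF scale_closed[OF assms, of 0]] y(2) by simp
qed

lemma add_minus: "x \<in> carrier A \<Longrightarrow> x \<oplus> (-1) \<odot> x = \<zero>"
  using scale_add_left[of x 1 "-1"] scale_one[of x] scale_zero_left[of x] by simp

lemma minus_minus: "x \<in> carrier A \<Longrightarrow> (-1) \<odot> ((-1) \<odot> x) = x"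
  by (simp add: scale_scale scale_one)

lemma nrm_minus: "x \<in> carrier A \<Longrightarrow> nrm A ((-1) \<odot> x) = nrm A x"
  by (simp add: nrm_scale)

lemma nrm_nonneg: assumes "x \<in> carrier A" shows "0 \<le> nrm A x"
proof -
  have "nrm A (x \<oplus> (-1) \<odot> x) = 0"
    using nrm_eq_0 zero_closed assms by (simp add: add_minus)
  then show ?thesis
    using nrm_triangle[OF assms scale_closed[OF assms, of "-1"]] nrm_minus[OF assms] by simp
qed

lemma Metric_space_nrm_dist: "Metric_space (carrier A) (nrm_dist A)"
proof
  fix x y
  show "0 \<le> nrm_dist A x y"
    by (simp add: nrm_dist_def nrm_nonneg add_closed scale_closed)
  show "nrm_dist A x y = nrm_dist A y x"
  proof (cases "x \<in> carrier A \<and> y \<in> carrier A")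
    case True
    then have "(-1) \<odot> (y \<oplus> (-1) \<odot> x) = x \<oplus> (-1) \<odot> y"
      using add_commute[of x "(-1) \<odot> y"] by (simp add: scale_add_right scale_closed minus_minus)
    then show ?thesis
      using True nrm_minus[of "y \<oplus> (-1) \<odot> x"] by (simp add: nrm_dist_def add_closed scale_closed)
  qed (auto simp: nrm_dist_def)
next
  fix x y assume xy: "x \<in> carrier A" "y \<in> carrier A"
  have "x = y" if "x \<oplus> (-1) \<odot> y = \<zero>"
  proof -
    have "x = x \<oplus> (y \<oplus> (-1) \<odot> y)"
      using xy by (simp add: add_minus add_zero)
    also have "\<dots> = x \<oplus> ((-1) \<odot> y \<oplus> y)"
      using add_commute[of y "(-1) \<odot> y"] xy by (simp add: scale_closed)
    also have "\<dots> = \<zero> \<oplus> y"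
      using add_assoc[of x "(-1) \<odot> y" y] xy that by (simp add: scale_closed)
    also have "\<dots> = y"
      using add_commute[of \<zero> y] add_zero[of y] zero_closed xy by simp
    finally show ?thesis .
  qed
  then show "(nrm_dist A x y = 0) = (x = y)"
    using xy nrm_eq_0[of "x \<oplus> (-1) \<odot> y"] by (auto simp: nrm_dist_def add_closed scale_closed add_minus)
next
  fix x y z assume xyz: "x \<in> carrier A" "y \<in> carrier A" "z \<in> carrier A"
  have "x \<oplus> (-1) \<odot> z = x \<oplus> (((-1) \<odot> y \<oplus> y) \<oplus> (-1) \<odot> z)"
    using add_commute[of "(-1) \<odot> y" y] add_commute[of \<zero> "(-1) \<odot> z"] add_zero[of "(-1) \<odot> z"]
      xyz by (simp add: add_minus scale_closed zero_closed)
  also have "\<dots> = (x \<oplus> (-1) \<odot> y) \<oplus> (y \<oplus> (-1) \<odot> z)"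
    using xyz by (simp add: add_assoc add_closed scale_closed)
  finally show "nrm_dist A x z \<le> nrm_dist A x y + nrm_dist A y z"
    using xyz nrm_triangle[of "x \<oplus> (-1) \<odot> y" "y \<oplus> (-1) \<odot> z"]
    by (simp add: nrm_dist_def add_closed scale_closed)
qed

end

definition unital :: "'a star_struct \<Rightarrow> bool" where
  "unital A \<longleftrightarrow> (\<exists>e\<in>carrier A. \<forall>x\<in>carrier A. mult A e x = x \<and> mult A x e = x)"

definition star_isomorphism :: "'a star_struct \<Rightarrow> 'b star_struct \<Rightarrow> ('a \<Rightarrow> 'b) \<Rightarrow> bool" where
  "star_isomorphism A B \<phi> \<longleftrightarrow>
     bij_betw \<phi> (carrier A) (carrier B) \<and>
     (\<forall>x\<in>carrier A. \<forall>y\<in>carrier A. \<phi> (add A x y) = add B (\<phi> x) (\<phi> y)) \<and>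
     (\<forall>x\<in>carrier A. \<forall>y\<in>carrier A. \<phi> (mult A x y) = mult B (\<phi> x) (\<phi> y)) \<and>
     (\<forall>c. \<forall>x\<in>carrier A. \<phi> (scale A c x) = scale B c (\<phi> x)) \<and>
     (\<forall>x\<in>carrier A. \<phi> (adj A x) = adj B (\<phi> x))"

text \<open>Functionals are set to 0 off the carrier, so that each bounded functional on \<open>A\<close> is
  represented by exactly one function and the vector space operations are pointwise.\<close>

definition dual_space :: "'a star_struct \<Rightarrow> ('a \<Rightarrow> complex) set" where
  "dual_space A = {f.
     (\<forall>x\<in>carrier A. \<forall>y\<in>carrier A. f (add A x y) = f x + f y) \<and>
     (\<forall>c. \<forall>x\<in>carrier A. f (scale A c x) = c * f x) \<and>
     (\<exists>K. \<forall>x\<in>carrier A. cmod (f x) \<le> K * nrm A x) \<and>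
     (\<forall>x. x \<notin> carrier A \<longrightarrow> f x = 0)}"

definition dual_norm :: "'a star_struct \<Rightarrow> ('a \<Rightarrow> complex) \<Rightarrow> real" where
  "dual_norm A f = (SUP x\<in>{x \<in> carrier A. nrm A x \<le> 1}. cmod (f x))"


section \<open>Full algebras of operator fields\<close>

definition operator_fields :: "('t \<Rightarrow> 'b star_struct) \<Rightarrow> ('t \<Rightarrow> 'b) set" where
  "operator_fields \<A> = {x. \<forall>t. x t \<in> carrier (\<A> t)}"

definition field_algebra :: "('t \<Rightarrow> 'b star_struct) \<Rightarrow> ('t \<Rightarrow> 'b) set \<Rightarrow> ('t \<Rightarrow> 'b) star_struct" where
  "field_algebra \<A> X =
     \<lparr>carrier = X,
      add = (\<lambda>x y t. add (\<A> t) (x t) (y t)),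
      zero = (\<lambda>t. zero (\<A> t)),
      mult = (\<lambda>x y t. mult (\<A> t) (x t) (y t)),
      scale = (\<lambda>c x t. scale (\<A> t) c (x t)),
      adj = (\<lambda>x t. adj (\<A> t) (x t)),
      nrm = (\<lambda>x. SUP t. nrm (\<A> t) (x t))\<rparr>"

text \<open>Vanishing at infinity of \<open>t \<mapsto> \<parallel>x(t)\<parallel>\<close> is the compactness of the sets
  \<open>{t. \<parallel>x(t)\<parallel> \<ge> \<epsilon>}\<close>; for compact \<open>T\<close> it follows from continuity.\<close>

definition full_algebra ::
  "('t::topological_space \<Rightarrow> 'b star_struct) \<Rightarrow> ('t \<Rightarrow> 'b) set \<Rightarrow> bool" where
  "full_algebra \<A> X \<longleftrightarrow>
     X \<subseteq> operator_fields \<A> \<and>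
     star_algebra (field_algebra \<A> X) \<and>
     (\<forall>x\<in>X. continuous_on UNIV (\<lambda>t. nrm (\<A> t) (x t)) \<and>
            (\<forall>\<epsilon>>0. compact {t. \<epsilon> \<le> nrm (\<A> t) (x t)})) \<and>
     (\<forall>t. nrm_topology (\<A> t) closure_of ((\<lambda>x. x t) ` X) = carrier (\<A> t)) \<and>
     Metric_space.mcomplete X (nrm_dist (field_algebra \<A> X))"

definition maximal_full_algebra ::
  "('t::topological_space \<Rightarrow> 'b star_struct) \<Rightarrow> ('t \<Rightarrow> 'b) set \<Rightarrow> bool" where
  "maximal_full_algebra \<A> X \<longleftrightarrow>
     full_algebra \<A> X \<and> (\<forall>Y. full_algebra \<A> Y \<longrightarrow> \<not> X \<subset> Y)"

definition supp :: "('t::topological_space \<Rightarrow> 'b star_struct) \<Rightarrow> ('t \<Rightarrow> 'b) \<Rightarrow> 't set" where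
  "supp \<A> x = closure {t. x t \<noteq> zero (\<A> t)}"


section \<open>Measures associated with a full algebra of operator fields\<close>

text \<open>In the following \<open>\<phi> : A \<rightarrow> \<Gamma>(\<A>)\<close> is the realization \<open>a \<mapsto> \<hat>a\<close> of \<open>A\<close> by
  sections. A set function on \<open>\<Sigma>\<close> is set to 0 off \<open>\<Sigma>\<close>, again for uniqueness of
  the representing function.\<close>

type_synonym ('t, 'a) setfun = "'t set \<Rightarrow> 'a \<Rightarrow> complex"

definition aofm ::
  "'a star_struct \<Rightarrow> ('t::topological_space \<Rightarrow> 'b star_struct) \<Rightarrow> ('a \<Rightarrow> 't \<Rightarrow> 'b) \<Rightarrow>
   't set set \<Rightarrow> ('t, 'a) setfun \<Rightarrow> bool" where
  "aofm A \<A> \<phi> \<Sigma> \<mu> \<longleftrightarrow>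
     (\<forall>S\<in>\<Sigma>. \<mu> S \<in> dual_space A) \<and>
     (\<forall>S\<in>\<Sigma>. \<forall>a\<in>carrier A. supp \<A> (\<phi> a) \<inter> S = {} \<longrightarrow> \<mu> S a = 0) \<and>
     (\<forall>S. S \<notin> \<Sigma> \<longrightarrow> \<mu> S = (\<lambda>a. 0))"

definition additive_aofm :: "'a star_struct \<Rightarrow> 't set set \<Rightarrow> ('t, 'a) setfun \<Rightarrow> bool" where
  "additive_aofm A \<Sigma> \<mu> \<longleftrightarrow>
     (\<forall>(n::nat) S. (\<forall>i<n. S i \<in> \<Sigma>) \<and> disjoint_family_on S {..<n} \<longrightarrow>
        (\<forall>a\<in>carrier A. \<mu> (\<Union>i<n. S i) a = (\<Sum>i<n. \<mu> (S i) a)))"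

definition bounded_aofm :: "'a star_struct \<Rightarrow> 't set set \<Rightarrow> ('t, 'a) setfun \<Rightarrow> bool" where
  "bounded_aofm A \<Sigma> \<mu> \<longleftrightarrow>
     bdd_above {\<Sum>S\<in>P. dual_norm A (\<mu> S) | P. finite P \<and> P \<subseteq> \<Sigma> \<and> partition_on UNIV P}"

definition weakly_regular_aofm ::
  "'a star_struct \<Rightarrow> 't::topological_space set set \<Rightarrow> ('t, 'a) setfun \<Rightarrow> bool" where
  "weakly_regular_aofm A \<Sigma> \<mu> \<longleftrightarrow>
     (\<forall>E\<in>\<Sigma>. \<forall>a\<in>carrier A. \<forall>\<epsilon>>0. \<exists>F\<in>\<Sigma>. \<exists>G\<in>\<Sigma>.
        closure F \<subseteq> E \<and> E \<subseteq> interior G \<and>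
        (\<forall>C\<in>\<Sigma>. C \<subseteq> G - F \<longrightarrow> cmod (\<mu> C a) < \<epsilon>))"

definition rba_aofm ::
  "'a star_struct \<Rightarrow> ('t::topological_space \<Rightarrow> 'b star_struct) \<Rightarrow> ('a \<Rightarrow> 't \<Rightarrow> 'b) \<Rightarrow>
   't set set \<Rightarrow> ('t, 'a) setfun set" where
  "rba_aofm A \<A> \<phi> \<Sigma> = {\<mu>. aofm A \<A> \<phi> \<Sigma> \<mu> \<and> additive_aofm A \<Sigma> \<mu> \<and>
     bounded_aofm A \<Sigma> \<mu> \<and> weakly_regular_aofm A \<Sigma> \<mu>}"

definition setfun_add :: "('t, 'a) setfun \<Rightarrow> ('t, 'a) setfun \<Rightarrow> ('t, 'a) setfun" where
  "setfun_add \<mu> \<nu> = (\<lambda>S a. \<mu> S a + \<nu> S a)"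

definition setfun_scale :: "complex \<Rightarrow> ('t, 'a) setfun \<Rightarrow> ('t, 'a) setfun" where
  "setfun_scale c \<mu> = (\<lambda>S a. c * \<mu> S a)"

definition total_mass :: "('t, 'a) setfun \<Rightarrow> 'a \<Rightarrow> complex" where
  "total_mass \<mu> = \<mu> UNIV"

definition closed_set_algebra :: "'t::topological_space set set" where
  "closed_set_algebra = (algebra UNIV) hull {S. closed S}"

end

(* Locally uniform approximability by sections defines a full algebra, so by maximality C(T) acts on
   A by multiplying sections, and the C*-identity alone gives |f a| <= sup|f| |a|.

   A functional psi on A gives for every a the functional f -> psi(f a) on C(T). Its representing
   finitely additive measure is built without the total variation: with |W| the supremum of |psi(g a)|
   over |g| <= 1 vanishing off the open set W, every E in the algebra generated by the closed sets
   lies between a closed F and an open G with |G - F| small, and mu(E)(a) is the limit of psi(f a)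
   over f equal to 1 on F and 0 off G. The variation of mu is bounded by testing psi on sums of
   elements f_S a_S with disjointly supported f_S, which stay in the unit ball of A.

   Conversely, the support condition makes a measure local, so that mu(S)(f a) is close to c mu(S)(a)
   if f is close to c on S. If mu(T) = 0, slicing along the levels of a Urysohn function between
   F and G gives mu(E) = 0. *)
theory Submission
  imports Defs
begin

section \<open>Finitely additive measures of bounded functionals on continuous functions\<close>

text \<open>The isomorphism \<open>\<phi>\<close> is purely algebraic, and the norm of A is never
  compared with the supremum norm of sections. Bounds for \<open>f a\<close> and for sums of
  elements with disjoint sections are therefore derived from the C*-identity inside A.

  Weak regularity shapes both directions, because its sets F and G depend on the element a. In the
  construction, the bound of the variation has to combine different elements and different pairs (F,
  G), one for each set of the partition, in a single element of the unit ball. For uniqueness,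
  smallness on subsets of G - F is known for a only and not for \<open>f a\<close>; slicing is what
  transfers it.

  The support condition speaks of closed supports, so it says nothing directly about a function that
  merely vanishes on S. Locality is obtained by truncating functions at a small height, and the
  bounded variation of the measure controls the error accumulated over all slices.\<close>

lemma algebra_closed_set_algebra:
  "algebra UNIV (closed_set_algebra :: 't::topological_space set set)"
  unfolding closed_set_algebra_def
  by (rule hull_in) (auto simp: algebra_iff_Un)

lemma closed_in_closed_set_algebra: "closed S \<Longrightarrow> S \<in> closed_set_algebra"
  unfolding closed_set_algebra_def by (rule hull_inc) simp

lemma UNIV_in_closed_set_algebra: "UNIV \<in> closed_set_algebra"
  by (rule closed_in_closed_set_algebra) simp

lemma empty_in_closed_set_algebra: "{} \<in> closed_set_algebra"
  by (rule closed_in_closed_set_algebra) simp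

lemma closed_set_algebra_Compl: "S \<in> closed_set_algebra \<Longrightarrow> - S \<in> closed_set_algebra"
  by (metis algebra_closed_set_algebra algebra_iff_Un Compl_eq_Diff_UNIV)

lemma open_in_closed_set_algebra: "open S \<Longrightarrow> S \<in> closed_set_algebra"
  using closed_set_algebra_Compl[OF closed_in_closed_set_algebra[of "- S"]] by auto

lemma closed_set_algebra_Un:
  "S \<in> closed_set_algebra \<Longrightarrow> S' \<in> closed_set_algebra \<Longrightarrow> S \<union> S' \<in> closed_set_algebra"
  by (metis algebra_closed_set_algebra algebra_iff_Un)

lemma closed_set_algebra_Int:
  "S \<in> closed_set_algebra \<Longrightarrow> S' \<in> closed_set_algebra \<Longrightarrow> S \<inter> S' \<in> closed_set_algebra"
  by (metis algebra_closed_set_algebra algebra_iff_Int)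

lemma closed_set_algebra_Diff:
  "S \<in> closed_set_algebra \<Longrightarrow> S' \<in> closed_set_algebra \<Longrightarrow> S - S' \<in> closed_set_algebra"
  by (metis Diff_eq closed_set_algebra_Compl closed_set_algebra_Int)

section \<open>Urysohn functions, cut-offs and bumps\<close>

lemma Urysohn_compact_t2:
  fixes S T :: "'t::t2_space set"
  assumes "compact (UNIV :: 't set)" "closed S" "closed T" "S \<inter> T = {}"
  obtains f :: "'t \<Rightarrow> real" where "continuous_on UNIV f" "\<And>t. 0 \<le> f t" "\<And>t. f t \<le> 1"
    "\<And>t. t \<in> S \<Longrightarrow> f t = 1" "\<And>t. t \<in> T \<Longrightarrow> f t = 0"
proof -
  have "Hausdorff_space (euclidean :: 't topology)"
    by (metis Hausdorff_space_def disjnt_def hausdorff open_openin)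
  then have "normal_space (euclidean :: 't topology)"
    using assms(1) by (intro compact_Hausdorff_or_regular_imp_normal_space) (auto simp: compact_space_def)
  then obtain f where "continuous_map (euclidean :: 't topology) (top_of_set {0..1::real}) f"
    "f ` T \<subseteq> {0}" "f ` S \<subseteq> {1}"
    by (rule Urysohn_lemma[of _ T S 0 1]) (use assms in \<open>auto simp: disjnt_def\<close>)
  then show ?thesis
    by (intro that[of f]) (auto simp: continuous_map_in_subtopology image_subset_iff)
qed

text \<open>Soft thresholding: the phase is kept and the modulus lowered by d. The result is
  continuous, vanishes off the closed set where \<open>cmod (g t)\<close> is at least d, and stays
  within d of g. The \<open>max\<close> in the denominator changes nothing where the result is
  nonzero and avoids dividing by 0.\<close>

definition cut :: "real \<Rightarrow> ('t \<Rightarrow> complex) \<Rightarrow> 't \<Rightarrow> complex" where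
  "cut d g t = g t * of_real (max (cmod (g t) - d) 0 / max (cmod (g t)) d)"

lemma continuous_on_cut:
  assumes "continuous_on UNIV g" "0 < d"
  shows "continuous_on UNIV (cut d g)"
proof -
  have "complex_of_real (max (cmod z) d) \<noteq> 0" for z
    using assms(2) by (metis less_max_iff_disj less_irrefl of_real_eq_0_iff)
  then show ?thesis
    unfolding cut_def[abs_def] of_real_divide using assms(1) by (intro continuous_intros ballI) auto
qed

lemma cut_eq_0: "cmod (g t) \<le> d \<Longrightarrow> cut d g t = 0"
  by (simp add: cut_def)

lemma norm_cut_le: "0 < d \<Longrightarrow> cmod (cut d g t) \<le> cmod (g t)"
  unfolding cut_def norm_mult norm_of_real by (intro mult_left_le) (auto simp: max_def divide_le_eq)

lemma norm_diff_cut_le: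
  assumes "0 < d" shows "cmod (g t - cut d g t) \<le> d"
proof (cases "cmod (g t) \<le> d")
  case False
  then have "g t - cut d g t = g t * of_real (1 - (cmod (g t) - d) / cmod (g t))"
    by (simp add: cut_def max_def algebra_simps)
  also have "1 - (cmod (g t) - d) / cmod (g t) = d / cmod (g t)"
    using False assms by (auto simp: diff_divide_distrib)
  finally have "g t - cut d g t = g t * of_real (d / cmod (g t))" .
  then show ?thesis using False assms by (simp add: norm_mult norm_divide)
qed (simp add: cut_eq_0)

text \<open>For open W this says that the total variation of L on W is at most e. The bound is a
  parameter, so no supremum has to be formed.\<close>

definition small_on :: "(('t::topological_space \<Rightarrow> complex) \<Rightarrow> complex) \<Rightarrow> 't set \<Rightarrow> real \<Rightarrow> bool" where
  "small_on L W e \<longleftrightarrow> (\<forall>g. continuous_on UNIV g \<and> (\<forall>t. cmod (g t) \<le> 1) \<and> (\<forall>t. t \<notin> W \<longrightarrow> g t = 0)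
     \<longrightarrow> cmod (L g) \<le> e)"

lemma small_onD:
  "small_on L W e \<Longrightarrow> continuous_on UNIV g \<Longrightarrow> (\<And>t. cmod (g t) \<le> 1) \<Longrightarrow> (\<And>t. t \<notin> W \<Longrightarrow> g t = 0)
    \<Longrightarrow> cmod (L g) \<le> e"
  unfolding small_on_def by blast

lemma small_on_mono: "small_on L W e \<Longrightarrow> V \<subseteq> W \<Longrightarrow> e \<le> e' \<Longrightarrow> small_on L V e'"
  unfolding small_on_def by (meson order_trans subsetD)

definition regular_set :: "(('t::topological_space \<Rightarrow> complex) \<Rightarrow> complex) \<Rightarrow> 't set \<Rightarrow> bool" where
  "regular_set L E \<longleftrightarrow> (\<forall>e>0. \<exists>F G. closed F \<and> open G \<and> F \<subseteq> E \<and> E \<subseteq> G \<and> small_on L (G - F) e)"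

lemma regular_setE:
  assumes "regular_set L E" "0 < e"
  obtains F G where "closed F" "open G" "F \<subseteq> E" "E \<subseteq> G" "small_on L (G - F) e"
  using assms that unfolding regular_set_def by metis

definition bump :: "'t::topological_space set \<Rightarrow> 't set \<Rightarrow> ('t \<Rightarrow> real) \<Rightarrow> bool" where
  "bump F G f \<longleftrightarrow> continuous_on UNIV f \<and> (\<forall>t. 0 \<le> f t \<and> f t \<le> 1) \<and>
     (\<forall>t\<in>F. f t = 1) \<and> (\<forall>t. t \<notin> G \<longrightarrow> f t = 0)"

lemma bump_exists:
  fixes F G :: "'t::t2_space set"
  assumes "compact (UNIV :: 't set)" "closed F" "open G" "F \<subseteq> G"
  obtains f where "bump F G f"
proof -
  obtain f :: "'t \<Rightarrow> real" where "continuous_on UNIV f" "\<And>t. 0 \<le> f t" "\<And>t. f t \<le> 1"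
    "\<And>t. t \<in> F \<Longrightarrow> f t = 1" "\<And>t. t \<in> - G \<Longrightarrow> f t = 0"
    by (rule Urysohn_compact_t2[of F "- G"]) (use assms in auto)
  then show ?thesis by (intro that) (auto simp: bump_def)
qed

text \<open>The number is pinned down by all its approximations at once, not as a limit along a
  chosen sequence. For a regular set the errors e become arbitrarily small, which makes it unique;
  existence is shown in \<open>content_approx\<close>.\<close>

definition riesz_content :: "(('t::topological_space \<Rightarrow> complex) \<Rightarrow> complex) \<Rightarrow> 't set \<Rightarrow> complex" where
  "riesz_content L E = (SOME c. \<forall>F G e f. closed F \<and> open G \<and> F \<subseteq> E \<and> E \<subseteq> G \<and> small_on L (G - F) e \<and>
     bump F G f \<longrightarrow> cmod (L (\<lambda>t. of_real (f t)) - c) \<le> e)"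

lemma unimodular_rotate:
  obtains u where "cmod u = 1" "u * z = of_real (cmod z)"
proof (cases "z = 0")
  case False
  then show ?thesis
    by (intro that[of "of_real (cmod z) / z"]) (auto simp: norm_divide)
qed (auto intro: that[of 1])

lemma norm_triangle4_le:
  fixes a b c d :: "'a::real_normed_vector"
  assumes "norm a \<le> p" "norm b \<le> q" "norm c \<le> r" "norm d \<le> s"
  shows "norm (a + b - c - d) \<le> p + q + r + s"
  by (intro norm_triangle_le_diff norm_triangle_le add_mono assms)

section \<open>The content defined by one bounded functional\<close>

locale bounded_functional =
  fixes L :: "('t::t2_space \<Rightarrow> complex) \<Rightarrow> complex" and K :: real
  assumes compact: "compact (UNIV :: 't set)"
    and add: "\<lbrakk>continuous_on UNIV f; continuous_on UNIV g\<rbrakk> \<Longrightarrow> L (\<lambda>t. f t + g t) = L f + L g"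
    and scale: "continuous_on UNIV f \<Longrightarrow> L (\<lambda>t. c * f t) = c * L f"
    and bound: "\<lbrakk>continuous_on UNIV f; \<And>t. cmod (f t) \<le> 1\<rbrakk> \<Longrightarrow> cmod (L f) \<le> K"
begin

lemma diff:
  assumes "continuous_on UNIV f" "continuous_on UNIV g"
  shows "L (\<lambda>t. f t - g t) = L f - L g"
  using add[of f "\<lambda>t. -1 * g t"] scale[of g "-1"] assms by (simp add: continuous_on_minus)

lemma bound_nonneg: "0 \<le> K"
  using order_trans[OF norm_ge_zero bound[of "\<lambda>t. 0"]] by simp

lemma zero: "L (\<lambda>t. 0) = 0"
  using scale[of "\<lambda>t. 0" 0] by simp

lemma bound_scaled:
  assumes "continuous_on UNIV f" "\<And>t. cmod (f t) \<le> d" "0 < d"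
  shows "cmod (L f) \<le> d * K"
proof -
  have "cmod (L (\<lambda>t. of_real (inverse d) * f t)) \<le> K"
    using assms by (intro bound continuous_intros) (auto simp: norm_mult norm_divide field_simps)
  then show ?thesis
    unfolding scale[OF assms(1)] using assms(3) by (simp add: norm_mult norm_inverse divide_inverse[symmetric] norm_divide divide_le_eq mult.commute)
qed

lemma cut_close:
  assumes "continuous_on UNIV g" "0 < d"
  shows "cmod (L g - L (cut d g)) \<le> d * K"
  using bound_scaled[of "\<lambda>t. g t - cut d g t" d] diff[of g "cut d g"] assms
  by (simp add: continuous_on_cut continuous_on_diff norm_diff_cut_le)

lemma closed_norm_ge: "continuous_on UNIV g \<Longrightarrow> closed {t. d \<le> cmod (g t)}"
  by (intro closed_Collect_le continuous_intros) auto

text \<open>Subadditivity of the variation: split g by a partition of unity on the two sets. As such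
  a partition need not extend continuously to T, g is first cut, which confines it to a closed set C
  inside the union. Then \<open>C - U\<close> and \<open>C - V\<close> are disjoint closed sets, and
  a Urysohn function w separates them.\<close>

lemma small_on_Un:
  assumes U: "open U" "small_on L U e" and V: "open V" "small_on L V e'"
  shows "small_on L (U \<union> V) (e + e')"
  unfolding small_on_def
proof (intro allI impI, elim conjE)
  fix g :: "'t \<Rightarrow> complex"
  assume g: "continuous_on UNIV g" "\<forall>t. cmod (g t) \<le> 1" "\<forall>t. t \<notin> U \<union> V \<longrightarrow> g t = 0"
  show "cmod (L g) \<le> e + e'"
  proof (rule field_le_epsilon)
    fix \<eta> :: real assume "0 < \<eta>"
    \<comment> \<open>The denominator \<open>K + 1\<close> is positive even for
      \<open>K = 0\<close>; the cut then costs at most \<eta>.\<close>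
    define d where "d = \<eta> / (K + 1)"
    have d: "0 < d" "d * K \<le> \<eta>"
      using \<open>0 < \<eta>\<close> bound_nonneg by (auto simp: d_def field_simps)
    define h where "h = cut d g"
    have h: "continuous_on UNIV h" "cmod (h t) \<le> 1" for t
      unfolding h_def using g d continuous_on_cut norm_cut_le[of d g t] by (auto intro: order_trans)
    define C where "C = {t. d \<le> cmod (g t)}"
    have C: "closed C" "C \<subseteq> U \<union> V" unfolding C_def using g d closed_norm_ge by fastforce+
    have hC: "h t = 0" if "t \<notin> C" for t
      using that cut_eq_0[of g t d] by (simp add: h_def C_def)
    obtain w :: "'t \<Rightarrow> real" where w: "continuous_on UNIV w" "\<And>t. 0 \<le> w t" "\<And>t. w t \<le> 1"
      "\<And>t. t \<in> C - U \<Longrightarrow> w t = 1" "\<And>t. t \<in> C - V \<Longrightarrow> w t = 0"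
      by (rule Urysohn_compact_t2[of "C - U" "C - V"]) (use compact C U V in \<open>auto intro: closed_Diff\<close>)
    have nw: "cmod (of_real (w t) * h t) \<le> 1" "cmod (of_real (1 - w t) * h t) \<le> 1" for t
      using h(2)[of t] w(2,3)[of t]
      by (auto simp: norm_mult abs_of_nonneg simp del: of_real_diff intro!: mult_le_one)
    have c: "continuous_on UNIV (\<lambda>t. complex_of_real (w t) * h t)"
      "continuous_on UNIV (\<lambda>t. complex_of_real (1 - w t) * h t)"
      using w(1) h(1) by (intro continuous_intros; simp)+
    have "cmod (L (\<lambda>t. of_real (w t) * h t)) \<le> e'"
    proof (rule small_onD[OF V(2) c(1) nw(1)])
      show "of_real (w t) * h t = 0" if "t \<notin> V" for t
        using that hC[of t] w(5)[of t] by (cases "t \<in> C") auto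
    qed
    moreover have "cmod (L (\<lambda>t. of_real (1 - w t) * h t)) \<le> e"
    proof (rule small_onD[OF U(2) c(2) nw(2)])
      show "of_real (1 - w t) * h t = 0" if "t \<notin> U" for t
        using that hC[of t] w(4)[of t] by (cases "t \<in> C") auto
    qed
    moreover have "L h = L (\<lambda>t. of_real (w t) * h t) + L (\<lambda>t. of_real (1 - w t) * h t)"
      by (subst add[OF c, symmetric]) (simp add: algebra_simps)
    moreover have "cmod (L g - L h) \<le> \<eta>"
      using cut_close[OF g(1) d(1)] d(2) by (simp add: h_def)
    ultimately show "cmod (L g) \<le> e + e' + \<eta>"
      by (smt (verit) norm_triangle_ineq norm_triangle_sub)
  qed
qed

text \<open>A function \<open>g\<close> vanishing on \<open>S\<close> that nearly maximizes \<open>\<bar>L g\<bar>\<close> exhausts the mass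
  of \<open>L\<close> outside \<open>S\<close>: after cutting it off, what \<open>L\<close> does near \<open>S\<close> can only be small.\<close>

lemma regular_set_closed:
  assumes S: "closed S"
  shows "regular_set L S"
  unfolding regular_set_def
proof (intro allI impI)
  fix e :: real assume e: "0 < e"
  define X where "X = {g. continuous_on UNIV g \<and> (\<forall>t. cmod (g t) \<le> 1) \<and> (\<forall>t\<in>S. g t = 0)}"
  define s where "s = (SUP g\<in>X. cmod (L g))"
  have bdd: "bdd_above ((\<lambda>g. cmod (L g)) ` X)"
    by (intro bdd_aboveI[of _ K]) (auto simp: X_def bound)
  have ne: "X \<noteq> {}" by (auto simp: X_def intro!: exI[of _ "\<lambda>t. 0"])
  obtain g where g: "g \<in> X" "s - e/2 < cmod (L g)"
    using less_cSUP_iff[OF ne bdd, of "s - e/2"] e by (auto simp: s_def)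
  define d where "d = (e/2) / (K + 1)"
  have d: "0 < d" "d * K \<le> e/2"
    using e bound_nonneg by (auto simp: d_def field_simps)
  define h where "h = cut d g"
  have gc: "continuous_on UNIV g" using g by (simp add: X_def)
  have h: "continuous_on UNIV h" "cmod (h t) \<le> 1" for t
    unfolding h_def using g d continuous_on_cut norm_cut_le[of d g t] by (auto simp: X_def intro: order_trans)
  have Lh: "s - e < cmod (L h)"
    using cut_close[OF gc d(1)] d(2) g(2) norm_triangle_sub[of "L g" "L h"] by (simp add: h_def)
  define G where "G = - {t. d \<le> cmod (g t)}"
  have G: "open G" "S \<subseteq> G" using closed_norm_ge[OF gc] g d by (auto simp: G_def X_def)
  have hG: "h t = 0" if "t \<in> G" for t using that cut_eq_0[of g t d] by (auto simp: h_def G_def)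
  have "small_on L (G - S) e"
    unfolding small_on_def
  proof (intro allI impI, elim conjE)
    fix k :: "'t \<Rightarrow> complex"
    assume k: "continuous_on UNIV k" "\<forall>t. cmod (k t) \<le> 1" "\<forall>t. t \<notin> G - S \<longrightarrow> k t = 0"
    \<comment> \<open>h vanishes on G and k vanishes off it, so the rotated functions add up without
      exceeding 1, and their values under L add up without cancellation. The supremum s then leaves
      at most e for \<open>cmod (L k)\<close>.\<close>
    obtain u where u: "cmod u = 1" "u * L h = of_real (cmod (L h))" by (rule unimodular_rotate)
    obtain v where v: "cmod v = 1" "v * L k = of_real (cmod (L k))" by (rule unimodular_rotate)
    have "cmod (u * h t + v * k t) \<le> 1" for t
      using h(2)[of t] k(2) hG[of t] k(3) u(1) v(1) by (cases "t \<in> G") (auto simp: norm_mult)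
    moreover have "u * h t + v * k t = 0" if "t \<in> S" for t
      using that G hG[of t] k(3) by auto
    ultimately have "(\<lambda>t. u * h t + v * k t) \<in> X"
      using h(1) k(1) by (auto simp: X_def intro!: continuous_intros)
    then have "cmod (L (\<lambda>t. u * h t + v * k t)) \<le> s"
      unfolding s_def using bdd by (intro cSUP_upper)
    moreover have "L (\<lambda>t. u * h t + v * k t) = of_real (cmod (L h) + cmod (L k))"
      using add[of "\<lambda>t. u * h t" "\<lambda>t. v * k t"] h(1) k(1)
      by (simp add: scale u v continuous_on_mult_left)
    ultimately show "cmod (L k) \<le> e"
      using Lh by (simp del: of_real_add)
  qed
  then show "\<exists>F G. closed F \<and> open G \<and> F \<subseteq> S \<and> S \<subseteq> G \<and> small_on L (G - F) e"
    using S G by (intro exI[of _ S] exI[of _ G]) simp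
qed

lemma regular_set_Compl:
  assumes "regular_set L E" shows "regular_set L (- E)"
  unfolding regular_set_def
proof (intro allI impI)
  fix e :: real assume e: "0 < e"
  obtain F G where "closed F" "open G" "F \<subseteq> E" "E \<subseteq> G" "small_on L (G - F) e"
    by (rule regular_setE[OF assms e])
  moreover have "- F - - G = G - F" by blast
  ultimately show "\<exists>F G. closed F \<and> open G \<and> F \<subseteq> - E \<and> - E \<subseteq> G \<and> small_on L (G - F) e"
    by (intro exI[of _ "- G"] exI[of _ "- F"]) auto
qed

lemma regular_set_Un:
  assumes "regular_set L E" "regular_set L E'" shows "regular_set L (E \<union> E')"
  unfolding regular_set_def
proof (intro allI impI)
  fix e :: real assume e: "0 < e"
  obtain F G where 1: "closed F" "open G" "F \<subseteq> E" "E \<subseteq> G" "small_on L (G - F) (e/2)"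
    by (rule regular_setE[OF assms(1) half_gt_zero[OF e]])
  obtain F' G' where 2: "closed F'" "open G'" "F' \<subseteq> E'" "E' \<subseteq> G'" "small_on L (G' - F') (e/2)"
    by (rule regular_setE[OF assms(2) half_gt_zero[OF e]])
  have "small_on L (G \<union> G' - (F \<union> F')) e"
    by (rule small_on_mono[OF small_on_Un[OF _ 1(5) _ 2(5)]]) (use 1 2 in \<open>auto intro: open_Diff\<close>)
  then show "\<exists>F G. closed F \<and> open G \<and> F \<subseteq> E \<union> E' \<and> E \<union> E' \<subseteq> G \<and> small_on L (G - F) e"
    using 1 2 by (intro exI[of _ "F \<union> F'"] exI[of _ "G \<union> G'"]) (auto intro: closed_Un)
qed

lemma regular_closed_set_algebra: "E \<in> closed_set_algebra \<Longrightarrow> regular_set L E"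
proof -
  have "algebra UNIV {E. regular_set L E}"
    using regular_set_closed[OF closed_empty] regular_set_Compl regular_set_Un
    by (auto simp: algebra_iff_Un Compl_eq_Diff_UNIV)
  then have "closed_set_algebra \<subseteq> {E. regular_set L E}"
    unfolding closed_set_algebra_def by (intro hull_minimal) (auto intro: regular_set_closed)
  then show "E \<in> closed_set_algebra \<Longrightarrow> regular_set L E" by blast
qed

text \<open>Outside both differences the bumps agree: a point of F lies in E, hence in
  \<open>G'\<close> and therefore in \<open>F'\<close>, so both values are 1; a point outside F lies
  outside G, hence outside E and \<open>F'\<close>, and therefore outside \<open>G'\<close>, so both
  are 0. The common set E between the members of both pairs makes this work.\<close>

lemma bump_diff_le:
  assumes "closed F" "open G" "small_on L (G - F) e" "bump F G f"
    and "closed F'" "open G'" "small_on L (G' - F') e'" "bump F' G' f'"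
    and "F \<subseteq> E" "E \<subseteq> G" "F' \<subseteq> E" "E \<subseteq> G'"
  shows "cmod (L (\<lambda>t. of_real (f t)) - L (\<lambda>t. of_real (f' t))) \<le> e + e'"
proof -
  have c: "continuous_on UNIV (\<lambda>t. complex_of_real (f t))" "continuous_on UNIV (\<lambda>t. complex_of_real (f' t))"
    using assms(4,8) by (auto simp: bump_def intro: continuous_intros)
  have "cmod (L (\<lambda>t. of_real (f t) - of_real (f' t))) \<le> e + e'"
  proof (rule small_onD[OF small_on_Un[OF _ assms(3) _ assms(7)]])
    show "cmod (of_real (f t) - of_real (f' t)) \<le> 1" for t
    proof -
      have "\<bar>f t - f' t\<bar> \<le> 1"
        using assms(4,8) unfolding bump_def by (smt (verit))
      then show ?thesis by (metis norm_of_real of_real_diff)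
    qed
    show "complex_of_real (f t) - of_real (f' t) = 0" if "t \<notin> G - F \<union> (G' - F')" for t
    proof -
      have "f t = f' t"
        using that assms(4,8-12) unfolding bump_def by (metis Diff_iff UnCI subsetD)
      then show ?thesis by simp
    qed
  qed (use assms c in \<open>auto intro: open_Diff continuous_on_diff\<close>)
  then show ?thesis by (simp add: diff[OF c])
qed

text \<open>Supplies the witness for the choice in \<open>riesz_content\<close>: bumps with errors
  \<open>1 / Suc n\<close> form a Cauchy sequence by \<open>bump_diff_le\<close>, and comparing an
  arbitrary bump with them leaves only its own error in the limit.\<close>

lemma content_approx:
  assumes E: "regular_set L E" and FG: "closed F" "open G" "F \<subseteq> E" "E \<subseteq> G" "small_on L (G - F) e" "bump F G f"
  shows "cmod (L (\<lambda>t. of_real (f t)) - riesz_content L E) \<le> e"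
proof -
  define P where "P = (\<lambda>F G e f. closed F \<and> open G \<and> F \<subseteq> E \<and> E \<subseteq> G \<and> small_on L (G - F) e \<and> bump F G f)"
  define I where "I = (\<lambda>f::'t \<Rightarrow> real. L (\<lambda>t. of_real (f t)))"
  have diff: "cmod (I f - I f') \<le> e + e'" if "P F G e f" "P F' G' e' f'" for F G e f F' G' e' f'
    using that bump_diff_le[of F G e f F' G' e' f' E] by (auto simp: P_def I_def)
  have "\<exists>F G f. P F G (1 / Suc n) f" for n
  proof -
    obtain F G where *: "closed F" "open G" "F \<subseteq> E" "E \<subseteq> G" "small_on L (G - F) (1 / Suc n)"
      by (rule regular_setE[OF E, of "1 / Suc n"]) simp_all
    moreover obtain f where "bump F G f"
      by (rule bump_exists[OF compact *(1,2)]) (use * in auto)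
    ultimately show ?thesis unfolding P_def by metis
  qed
  then obtain Fs Gs fs where s: "\<And>n. P (Fs n) (Gs n) (1 / Suc n) (fs n)" by metis
  have lim0: "(\<lambda>n. 1 / real (Suc n)) \<longlonglongrightarrow> 0"
    using LIMSEQ_inverse_real_of_nat by (simp add: inverse_eq_divide)
  have "Cauchy (\<lambda>n. I (fs n))"
  proof (rule metric_CauchyI)
    fix r :: real assume "0 < r"
    then obtain N where N: "1 / real (Suc N) < r / 2"
      by (meson half_gt_zero nat_approx_posE)
    have "dist (I (fs m)) (I (fs n)) < r" if "N \<le> m" "N \<le> n" for m n
    proof -
      have "1 / real (Suc m) \<le> 1 / real (Suc N)" "1 / real (Suc n) \<le> 1 / real (Suc N)"
        using that by (auto simp: frac_le)
      then show ?thesis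
        using diff[OF s[of m] s[of n]] N by (simp add: dist_norm)
    qed
    then show "\<exists>M. \<forall>m\<ge>M. \<forall>n\<ge>M. dist (I (fs m)) (I (fs n)) < r" by blast
  qed
  then obtain c where c: "(\<lambda>n. I (fs n)) \<longlonglongrightarrow> c"
    using Cauchy_convergent convergent_def by blast
  have "cmod (I f - c) \<le> e" if "P F G e f" for F G e f
  proof (rule tendsto_le)
    show "(\<lambda>n. cmod (I f - I (fs n))) \<longlonglongrightarrow> cmod (I f - c)" by (intro tendsto_intros c)
    show "(\<lambda>n. e + 1 / real (Suc n)) \<longlonglongrightarrow> e" using tendsto_add[OF tendsto_const lim0] by fastforce
    show "\<forall>\<^sub>F n in sequentially. cmod (I f - I (fs n)) \<le> e + 1 / real (Suc n)"
      using diff[OF that s] by simp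
  qed simp
  then have "\<forall>F G e f. closed F \<and> open G \<and> F \<subseteq> E \<and> E \<subseteq> G \<and> small_on L (G - F) e \<and> bump F G f \<longrightarrow>
      cmod (L (\<lambda>t. of_real (f t)) - c) \<le> e"
    by (auto simp: P_def I_def)
  then have "\<forall>F G e f. closed F \<and> open G \<and> F \<subseteq> E \<and> E \<subseteq> G \<and> small_on L (G - F) e \<and> bump F G f \<longrightarrow>
      cmod (L (\<lambda>t. of_real (f t)) - riesz_content L E) \<le> e"
    unfolding riesz_content_def by (rule someI)
  then show ?thesis using FG by metis
qed

text \<open>Every bump squeezed between F and G is good enough, so one bump can serve several
  functionals at once or be confined to a further open set.\<close>

lemma small_pair:
  assumes "regular_set L E" "0 < e"
  obtains F G where "closed F" "open G" "F \<subseteq> E" "E \<subseteq> G" "small_on L (G - F) e"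
    "\<And>F' G' f. \<lbrakk>closed F'; open G'; F \<subseteq> F'; F' \<subseteq> E; E \<subseteq> G'; G' \<subseteq> G; bump F' G' f\<rbrakk>
      \<Longrightarrow> cmod (L (\<lambda>t. of_real (f t)) - riesz_content L E) \<le> e"
proof -
  obtain F G where *: "closed F" "open G" "F \<subseteq> E" "E \<subseteq> G" "small_on L (G - F) e"
    by (rule regular_setE[OF assms])
  show ?thesis
  proof (rule that[OF *])
    fix F' G' f assume a: "closed F'" "open G'" "F \<subseteq> F'" "F' \<subseteq> E" "E \<subseteq> G'" "G' \<subseteq> G" "bump F' G' f"
    have "small_on L (G' - F') e" by (rule small_on_mono[OF *(5)]) (use a in auto)
    then show "cmod (L (\<lambda>t. of_real (f t)) - riesz_content L E) \<le> e"
      using content_approx[OF assms(1) a(1,2,4,5) _ a(7)] by blast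
  qed
qed

lemma small_on_empty: "small_on L {} 0"
  unfolding small_on_def
proof (intro allI impI, elim conjE)
  fix g :: "'t \<Rightarrow> complex" assume "\<forall>t. t \<notin> {} \<longrightarrow> g t = 0"
  then have "g = (\<lambda>t. 0)" by auto
  then show "cmod (L g) \<le> 0" using zero by simp
qed

lemma content_UNIV: "riesz_content L UNIV = L (\<lambda>t. 1)"
proof -
  have "cmod (L (\<lambda>t. of_real 1) - riesz_content L UNIV) \<le> 0"
    by (rule content_approx[OF regular_set_closed, of UNIV UNIV UNIV]) (auto simp: bump_def small_on_empty)
  then show ?thesis by simp
qed

text \<open>Intersecting the outer set with W gives a bump that vanishes off W, and to this bump the
  smallness on W applies directly.\<close>

lemma content_small:
  assumes E: "regular_set L E" and W: "open W" "small_on L W e" "E \<subseteq> W"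
  shows "cmod (riesz_content L E) \<le> e"
proof (rule field_le_epsilon)
  fix \<eta> :: real assume "0 < \<eta>"
  obtain F G where FG: "closed F" "open G" "F \<subseteq> E" "E \<subseteq> G"
    "\<And>F' G' f. \<lbrakk>closed F'; open G'; F \<subseteq> F'; F' \<subseteq> E; E \<subseteq> G'; G' \<subseteq> G; bump F' G' f\<rbrakk>
      \<Longrightarrow> cmod (L (\<lambda>t. of_real (f t)) - riesz_content L E) \<le> \<eta>"
    using small_pair[OF E \<open>0 < \<eta>\<close>] by metis
  obtain f where f: "bump F (G \<inter> W) f"
    by (rule bump_exists[OF compact, of F "G \<inter> W"]) (use FG W in auto)
  have "cmod (L (\<lambda>t. of_real (f t)) - riesz_content L E) \<le> \<eta>"
    by (rule FG(5)[of F "G \<inter> W"]) (use FG(1-4) W f in auto)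
  moreover have "cmod (L (\<lambda>t. of_real (f t))) \<le> e"
    by (rule small_onD[OF W(2)]) (use f in \<open>auto simp: bump_def intro!: continuous_intros\<close>)
  ultimately show "cmod (riesz_content L E) \<le> e + \<eta>"
    using norm_triangle_sub[of "riesz_content L E" "L (\<lambda>t. of_real (f t))"] by (simp add: norm_minus_commute)
qed

lemma content_bound: "regular_set L E \<Longrightarrow> cmod (riesz_content L E) \<le> K"
  by (rule content_small[of E UNIV]) (auto simp: small_on_def bound)

lemma content_empty: "riesz_content L {} = 0"
  using content_small[OF regular_set_closed, of "{}" "{}" 0] small_on_empty by simp

lemma content_regular:
  assumes "regular_set L E" "0 < e"
  obtains F G where "closed F" "open G" "F \<subseteq> E" "E \<subseteq> G"
    "\<And>C. regular_set L C \<Longrightarrow> C \<subseteq> G - F \<Longrightarrow> cmod (riesz_content L C) \<le> e"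
proof -
  obtain F G where "closed F" "open G" "F \<subseteq> E" "E \<subseteq> G" "small_on L (G - F) e"
    by (rule regular_setE[OF assms])
  then show ?thesis by (intro that[of F G]) (auto intro: content_small[of _ "G - F"] open_Diff)
qed

text \<open>Bumps around disjoint sets may overlap, so additivity is not visible on functions.
  Modularity is: \<open>max\<close> and \<open>min\<close> of two bumps are bumps for the union and
  the intersection, and they have the same sum as the two bumps.\<close>

lemma content_Un_Int:
  assumes E: "regular_set L E" and E': "regular_set L E'" and I: "regular_set L (E \<inter> E')"
  shows "riesz_content L (E \<union> E') + riesz_content L (E \<inter> E') = riesz_content L E + riesz_content L E'"
proof -
  have "cmod (riesz_content L (E \<union> E') + riesz_content L (E \<inter> E') - (riesz_content L E + riesz_content L E')) \<le> 0 + \<eta>"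
    if "0 < \<eta>" for \<eta>
  proof -
    \<comment> \<open>Six errors: one for each of E and \<open>E'\<close>, and two each for the
      union and the intersection, where both differences contribute.\<close>
    define e where "e = \<eta> / 6"
    have e: "0 < e" using that by (simp add: e_def)
    obtain F G where 1: "closed F" "open G" "F \<subseteq> E" "E \<subseteq> G" "small_on L (G - F) e"
      by (rule regular_setE[OF E e])
    obtain F' G' where 2: "closed F'" "open G'" "F' \<subseteq> E'" "E' \<subseteq> G'" "small_on L (G' - F') e"
      by (rule regular_setE[OF E' e])
    obtain f where f: "bump F G f" by (rule bump_exists[OF compact 1(1,2)]) (use 1 in auto)
    obtain f' where f': "bump F' G' f'" by (rule bump_exists[OF compact 2(1,2)]) (use 2 in auto)
    have s: "small_on L ((G - F) \<union> (G' - F')) (e + e)"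
      using small_on_Un[OF _ 1(5) _ 2(5)] 1 2 by (auto intro: open_Diff)
    have u: "bump (F \<union> F') (G \<union> G') (\<lambda>t. max (f t) (f' t))"
      using f f' unfolding bump_def
      by (intro conjI allI ballI impI continuous_on_max) (auto simp: max_def intro: antisym)
    have i: "bump (F \<inter> F') (G \<inter> G') (\<lambda>t. min (f t) (f' t))"
      using f f' unfolding bump_def
      by (intro conjI allI ballI impI continuous_on_min) (auto simp: min_def intro: antisym)
    have cu: "cmod (L (\<lambda>t. of_real (max (f t) (f' t))) - riesz_content L (E \<union> E')) \<le> e + e"
      by (rule content_approx[OF regular_set_Un[OF E E'] _ _ _ _ small_on_mono[OF s] u])
        (use 1 2 in auto)
    have ci: "cmod (L (\<lambda>t. of_real (min (f t) (f' t))) - riesz_content L (E \<inter> E')) \<le> e + e"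
      by (rule content_approx[OF I _ _ _ _ small_on_mono[OF s] i]) (use 1 2 in auto)
    have c: "cmod (L (\<lambda>t. of_real (f t)) - riesz_content L E) \<le> e"
      "cmod (L (\<lambda>t. of_real (f' t)) - riesz_content L E') \<le> e"
      using content_approx[OF E 1 f] content_approx[OF E' 2 f'] by auto
    have cont: "continuous_on UNIV (\<lambda>t. complex_of_real (f t))" "continuous_on UNIV (\<lambda>t. complex_of_real (f' t))"
      "continuous_on UNIV (\<lambda>t. complex_of_real (max (f t) (f' t)))"
      "continuous_on UNIV (\<lambda>t. complex_of_real (min (f t) (f' t)))"
      using f f' by (auto simp: bump_def intro!: continuous_intros)
    have "(\<lambda>t. complex_of_real (max (f t) (f' t)) + of_real (min (f t) (f' t))) =
        (\<lambda>t. complex_of_real (f t) + of_real (f' t))"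
      by (auto simp: max_def min_def)
    then have "L (\<lambda>t. of_real (max (f t) (f' t))) + L (\<lambda>t. of_real (min (f t) (f' t))) =
        L (\<lambda>t. of_real (f t)) + L (\<lambda>t. of_real (f' t))"
      using add[OF cont(3,4)] add[OF cont(1,2)] by simp
    then have eq: "riesz_content L (E \<union> E') + riesz_content L (E \<inter> E') - (riesz_content L E + riesz_content L E') =
      (L (\<lambda>t. of_real (f t)) - riesz_content L E) + (L (\<lambda>t. of_real (f' t)) - riesz_content L E')
      - (L (\<lambda>t. of_real (max (f t) (f' t))) - riesz_content L (E \<union> E'))
      - (L (\<lambda>t. of_real (min (f t) (f' t))) - riesz_content L (E \<inter> E'))"
      by (simp add: algebra_simps)
    have "cmod (riesz_content L (E \<union> E') + riesz_content L (E \<inter> E') - (riesz_content L E + riesz_content L E'))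
        \<le> e + e + (e + e) + (e + e)"
      unfolding eq by (rule norm_triangle4_le[OF c cu ci])
    then show ?thesis by (simp add: e_def)
  qed
  then have "cmod (riesz_content L (E \<union> E') + riesz_content L (E \<inter> E') - (riesz_content L E + riesz_content L E')) \<le> 0"
    by (rule field_le_epsilon)
  then show ?thesis by simp
qed

lemma content_disjoint_Un:
  assumes "regular_set L E" "regular_set L E'" "E \<inter> E' = {}"
  shows "riesz_content L (E \<union> E') = riesz_content L E + riesz_content L E'"
  using content_Un_Int[OF assms(1,2)] assms(3) regular_set_closed[OF closed_empty] by (simp add: content_empty)

end

text \<open>Needed for linearity in a, since a enters \<open>\<psi> (act f a)\<close> through the
  functional on continuous functions. Each functional has its own pair of sets; the union of the
  inner and the intersection of the outer ones fits into all three pairs, so a single bump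
  approximates the three contents.\<close>

lemma content_linear:
  assumes L: "bounded_functional L K" "regular_set L E"
    and L': "bounded_functional L' K'" "regular_set L' E"
    and L'': "bounded_functional L'' K''" "regular_set L'' E"
    and eq: "\<And>f. continuous_on UNIV f \<Longrightarrow> L'' f = c * L f + c' * L' f"
  shows "riesz_content L'' E = c * riesz_content L E + c' * riesz_content L' E"
proof -
  have "cmod (riesz_content L'' E - (c * riesz_content L E + c' * riesz_content L' E)) \<le> 0 + \<eta>" if "0 < \<eta>" for \<eta>
  proof -
    define e where "e = \<eta> / (1 + cmod c + cmod c')"
    have pos: "0 < 1 + cmod c + cmod c'" by (smt (verit) norm_ge_zero)
    have e: "0 < e" using that pos by (simp add: e_def)
    obtain F G where 1: "closed F" "open G" "F \<subseteq> E" "E \<subseteq> G"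
      "\<And>F' G' f. \<lbrakk>closed F'; open G'; F \<subseteq> F'; F' \<subseteq> E; E \<subseteq> G'; G' \<subseteq> G; bump F' G' f\<rbrakk>
        \<Longrightarrow> cmod (L (\<lambda>t. of_real (f t)) - riesz_content L E) \<le> e"
      using bounded_functional.small_pair[OF L e] by metis
    obtain F' G' where 2: "closed F'" "open G'" "F' \<subseteq> E" "E \<subseteq> G'"
      "\<And>F G f. \<lbrakk>closed F; open G; F' \<subseteq> F; F \<subseteq> E; E \<subseteq> G; G \<subseteq> G'; bump F G f\<rbrakk>
        \<Longrightarrow> cmod (L' (\<lambda>t. of_real (f t)) - riesz_content L' E) \<le> e"
      using bounded_functional.small_pair[OF L' e] by metis
    obtain F'' G'' where 3: "closed F''" "open G''" "F'' \<subseteq> E" "E \<subseteq> G''"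
      "\<And>F G f. \<lbrakk>closed F; open G; F'' \<subseteq> F; F \<subseteq> E; E \<subseteq> G; G \<subseteq> G''; bump F G f\<rbrakk>
        \<Longrightarrow> cmod (L'' (\<lambda>t. of_real (f t)) - riesz_content L'' E) \<le> e"
      using bounded_functional.small_pair[OF L'' e] by metis
    define A B where "A = F \<union> F' \<union> F''" and "B = G \<inter> G' \<inter> G''"
    have AB: "closed A" "open B" "A \<subseteq> E" "E \<subseteq> B" "F \<subseteq> A" "F' \<subseteq> A" "F'' \<subseteq> A" "B \<subseteq> G" "B \<subseteq> G'" "B \<subseteq> G''"
      using 1(1-4) 2(1-4) 3(1-4) by (auto simp: A_def B_def)
    obtain f where f: "bump A B f"
      by (rule bump_exists[OF bounded_functional.compact[OF L(1)] AB(1,2)]) (use AB in auto)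
    define z where "z = (\<lambda>t. complex_of_real (f t))"
    have "cmod (L z - riesz_content L E) \<le> e" "cmod (L' z - riesz_content L' E) \<le> e" "cmod (L'' z - riesz_content L'' E) \<le> e"
      unfolding z_def using 1(5)[OF AB(1,2) _ AB(3,4) _ f] 2(5)[OF AB(1,2) _ AB(3,4) _ f]
        3(5)[OF AB(1,2) _ AB(3,4) _ f] AB by auto
    then have "cmod (c * (L z - riesz_content L E)) \<le> cmod c * e" "cmod (c' * (L' z - riesz_content L' E)) \<le> cmod c' * e"
      "cmod (L'' z - riesz_content L'' E) \<le> e"
      by (auto simp: norm_mult mult_left_mono)
    moreover have "riesz_content L'' E - (c * riesz_content L E + c' * riesz_content L' E) =
      c * (L z - riesz_content L E) + c' * (L' z - riesz_content L' E) - (L'' z - riesz_content L'' E)"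
    proof -
      have "continuous_on UNIV z" using f by (auto simp: z_def bump_def intro!: continuous_intros)
      from eq[OF this] show ?thesis by (simp add: algebra_simps)
    qed
    ultimately have "cmod (riesz_content L'' E - (c * riesz_content L E + c' * riesz_content L' E)) \<le> cmod c * e + cmod c' * e + e"
      by (smt (verit, best) norm_triangle_ineq norm_triangle_ineq4)
    also have "\<dots> = e * (1 + cmod c + cmod c')" by (simp add: algebra_simps)
    also have "\<dots> = \<eta>" using pos by (simp add: e_def)
    finally show ?thesis by simp
  qed
  then have "cmod (riesz_content L'' E - (c * riesz_content L E + c' * riesz_content L' E)) \<le> 0"
    by (rule field_le_epsilon)
  then show ?thesis by simp
qed

section \<open>Multiplication of sections by continuous functions\<close>

context cstar_algebra
begin

lemma zero_add: "x \<in> carrier A \<Longrightarrow> \<zero> \<oplus> x = x"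
  using add_commute[of \<zero> x] add_zero zero_closed by simp

lemma scale_zero_right: "c \<odot> \<zero> = \<zero>"
  using scale_scale[OF zero_closed, of c 0] scale_zero_left[OF zero_closed] by simp

lemma nrm_dist_add_le:
  assumes "x \<in> carrier A" "y \<in> carrier A" "x' \<in> carrier A" "y' \<in> carrier A"
  shows "nrm_dist A (x \<oplus> x') (y \<oplus> y') \<le> nrm_dist A x y + nrm_dist A x' y'"
proof -
  have "(x \<oplus> x') \<oplus> (-1) \<odot> (y \<oplus> y') = (x \<oplus> (-1) \<odot> y) \<oplus> (x' \<oplus> (-1) \<odot> y')"
    using assms by (smt (verit) add_assoc add_closed add_commute scale_add_right scale_closed)
  then show ?thesis
    using assms nrm_triangle[of "x \<oplus> (-1) \<odot> y" "x' \<oplus> (-1) \<odot> y'"]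
    by (simp add: nrm_dist_def add_closed scale_closed)
qed

lemma nrm_dist_zero: "x \<in> carrier A \<Longrightarrow> nrm_dist A x \<zero> = nrm A x"
  by (simp add: nrm_dist_def zero_closed scale_zero_right add_zero)

lemma abs_nrm_diff_le:
  assumes "x \<in> carrier A" "y \<in> carrier A"
  shows "\<bar>nrm A x - nrm A y\<bar> \<le> nrm_dist A x y"
proof -
  interpret M: Metric_space "carrier A" "nrm_dist A" by (rule Metric_space_nrm_dist)
  show ?thesis
    using M.triangle[of x y \<zero>] M.triangle[of y x \<zero>] M.commute[of x y] assms
    by (auto simp: zero_closed nrm_dist_zero)
qed

lemma nrm_dist_scale:
  assumes "x \<in> carrier A" "y \<in> carrier A"
  shows "nrm_dist A (c \<odot> x) (c \<odot> y) = cmod c * nrm_dist A x y"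
proof -
  have "c \<odot> x \<oplus> (-1) \<odot> (c \<odot> y) = c \<odot> (x \<oplus> (-1) \<odot> y)"
    using assms by (simp add: scale_add_right scale_scale scale_closed)
  then show ?thesis
    using assms by (simp add: nrm_dist_def scale_closed add_closed nrm_scale)
qed

lemma nrm_dist_scale_left:
  assumes "x \<in> carrier A"
  shows "nrm_dist A (c \<odot> x) (d \<odot> x) = cmod (c - d) * nrm A x"
proof -
  have "c \<odot> x \<oplus> (-1) \<odot> (d \<odot> x) = (c - d) \<odot> x"
    using assms scale_add_left[of x c "- d"] by (simp add: scale_scale)
  then show ?thesis
    using assms by (simp add: nrm_dist_def scale_closed nrm_scale)
qed

lemma nrm_adj: assumes "x \<in> carrier A" shows "nrm A (adj A x) = nrm A x"
proof -
  have *: "nrm A x \<le> nrm A (adj A x)" if "x \<in> carrier A" for x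
  proof (cases "nrm A x = 0")
    case False
    then have "0 < nrm A x" using nrm_nonneg[OF that] by simp
    moreover have "nrm A x * nrm A x \<le> nrm A (adj A x) * nrm A x"
      using nrm_mult[of "adj A x" x] cstar_identity[OF that] that by (simp add: adj_closed power2_eq_square)
    ultimately show ?thesis by simp
  qed (simp add: nrm_nonneg adj_closed that)
  show ?thesis
    using *[OF assms] *[OF adj_closed[OF assms]] assms by (simp add: adj_adj)
qed

lemma nrm_dist_adj:
  assumes "x \<in> carrier A" "y \<in> carrier A"
  shows "nrm_dist A (adj A x) (adj A y) = nrm_dist A x y"
proof -
  have "adj A x \<oplus> (-1) \<odot> adj A y = adj A (x \<oplus> (-1) \<odot> y)"
    using assms by (simp add: adj_add adj_scale scale_closed)
  then show ?thesis
    using assms by (simp add: nrm_dist_def adj_closed scale_closed add_closed nrm_adj)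
qed

lemma nrm_dist_mult_le:
  assumes "x \<in> carrier A" "y \<in> carrier A" "x' \<in> carrier A" "y' \<in> carrier A"
  shows "nrm_dist A (x \<otimes> x') (y \<otimes> y') \<le> nrm A x * nrm_dist A x' y' + nrm_dist A x y * nrm A y'"
proof -
  interpret M: Metric_space "carrier A" "nrm_dist A" by (rule Metric_space_nrm_dist)
  have 1: "x \<otimes> x' \<oplus> (-1) \<odot> (x \<otimes> y') = x \<otimes> (x' \<oplus> (-1) \<odot> y')"
    using assms by (simp add: mult_add_right mult_scale_right scale_closed)
  have 2: "x \<otimes> y' \<oplus> (-1) \<odot> (y \<otimes> y') = (x \<oplus> (-1) \<odot> y) \<otimes> y'"
    using assms by (simp add: mult_add_left mult_scale_left scale_closed)
  have "nrm_dist A (x \<otimes> x') (x \<otimes> y') \<le> nrm A x * nrm_dist A x' y'"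
    using assms nrm_mult[of x "x' \<oplus> (-1) \<odot> y'"] 1 by (simp add: nrm_dist_def mult_closed scale_closed add_closed)
  moreover have "nrm_dist A (x \<otimes> y') (y \<otimes> y') \<le> nrm_dist A x y * nrm A y'"
    using assms nrm_mult[of "x \<oplus> (-1) \<odot> y" y'] 2 by (simp add: nrm_dist_def mult_closed scale_closed add_closed)
  ultimately show ?thesis
    using M.triangle[of "x \<otimes> x'" "x \<otimes> y'" "y \<otimes> y'"] assms by (simp add: mult_closed)
qed

end

section \<open>Fields locally approximable by sections\<close>

lemma continuous_on_UNIV_iff_tendsto_nhds: "continuous_on UNIV f \<longleftrightarrow> (\<forall>s. (f \<longlongrightarrow> f s) (nhds s))"
  by (simp add: continuous_on_def tendsto_at_iff_tendsto_nhds)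

text \<open>The filter \<open>nhds s\<close>, unlike \<open>at s\<close>, takes s itself into
  account, so the estimate also holds at s; comparing norms at t and at s relies on this. The
  approximating section may change with s and e.\<close>

definition locally_approximable ::
  "('t::topological_space \<Rightarrow> 'b star_struct) \<Rightarrow> ('t \<Rightarrow> 'b) set \<Rightarrow> ('t \<Rightarrow> 'b) set" where
  "locally_approximable \<A> X = {x \<in> operator_fields \<A>. \<forall>s. \<forall>e>0. \<exists>y\<in>X.
     \<forall>\<^sub>F t in nhds s. nrm_dist (\<A> t) (x t) (y t) < e}"

locale cstar_fibres =
  fixes \<A> :: "'t::topological_space \<Rightarrow> 'b star_struct"
  assumes fibre: "\<And>t. cstar_algebra (\<A> t)"
begin

sublocale F: cstar_algebra "\<A> t" for t by (rule fibre)

sublocale M: Metric_space "carrier (\<A> t)" "nrm_dist (\<A> t)" for t by (rule F.Metric_space_nrm_dist)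

lemma star_algebra_field_algebra:
  assumes "X \<subseteq> operator_fields \<A>" and zero: "(\<lambda>t. zero (\<A> t)) \<in> X"
    and "\<And>x y. x \<in> X \<Longrightarrow> y \<in> X \<Longrightarrow> (\<lambda>t. add (\<A> t) (x t) (y t)) \<in> X"
    and "\<And>x y. x \<in> X \<Longrightarrow> y \<in> X \<Longrightarrow> (\<lambda>t. mult (\<A> t) (x t) (y t)) \<in> X"
    and scale: "\<And>c x. x \<in> X \<Longrightarrow> (\<lambda>t. scale (\<A> t) c (x t)) \<in> X"
    and "\<And>x. x \<in> X \<Longrightarrow> (\<lambda>t. adj (\<A> t) (x t)) \<in> X"
  shows "star_algebra (field_algebra \<A> X)"
proof -
  have mem: "x t \<in> carrier (\<A> t)" if "x \<in> X" for x t
    using that assms(1) by (auto simp: operator_fields_def)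
  show ?thesis
  proof
    fix x assume "x \<in> carrier (field_algebra \<A> X)"
    then show "\<exists>y\<in>carrier (field_algebra \<A> X). x \<oplus>\<^bsub>field_algebra \<A> X\<^esub> y = \<zero>\<^bsub>field_algebra \<A> X\<^esub>"
      by (intro bexI[of _ "\<lambda>t. scale (\<A> t) (-1) (x t)"])
        (auto simp: field_algebra_def mem F.add_minus scale)
  qed (auto simp: field_algebra_def mem assms F.add_assoc F.add_zero F.scale_add_right
      F.scale_add_left F.scale_scale F.scale_one F.mult_assoc F.mult_add_left F.mult_add_right
      F.mult_scale_left F.mult_scale_right F.adj_adj F.adj_add F.adj_scale F.adj_mult intro!: ext F.add_commute)
qed

context
  fixes X :: "('t \<Rightarrow> 'b) set"
  assumes sub: "X \<subseteq> operator_fields \<A>"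
    and bdd: "\<And>x y. x \<in> X \<Longrightarrow> y \<in> X \<Longrightarrow> bdd_above (range (\<lambda>t. nrm_dist (\<A> t) (x t) (y t)))"
begin

lemma field_mem: "x \<in> X \<Longrightarrow> x t \<in> carrier (\<A> t)"
  using sub by (auto simp: operator_fields_def)

lemma nrm_dist_field_algebra:
  "x \<in> X \<Longrightarrow> y \<in> X \<Longrightarrow> nrm_dist (field_algebra \<A> X) x y = (SUP t. nrm_dist (\<A> t) (x t) (y t))"
  by (simp add: nrm_dist_def field_algebra_def field_mem)

text \<open>Here the boundedness assumption of the context enters: without it the supremum of the
  fibre distances would carry no information.\<close>

lemma nrm_dist_le_field_algebra:
  "x \<in> X \<Longrightarrow> y \<in> X \<Longrightarrow> nrm_dist (\<A> t) (x t) (y t) \<le> nrm_dist (field_algebra \<A> X) x y"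
  by (simp only: nrm_dist_field_algebra) (rule cSUP_upper[OF UNIV_I bdd])

lemma nrm_dist_field_algebra_le:
  "x \<in> X \<Longrightarrow> y \<in> X \<Longrightarrow> (\<And>t. nrm_dist (\<A> t) (x t) (y t) \<le> e) \<Longrightarrow> nrm_dist (field_algebra \<A> X) x y \<le> e"
  by (simp add: nrm_dist_field_algebra cSUP_least)

lemma Metric_space_field_algebra: "Metric_space X (nrm_dist (field_algebra \<A> X))"
proof
  fix x y
  show "0 \<le> nrm_dist (field_algebra \<A> X) x y"
  proof (cases "x \<in> X \<and> y \<in> X")
    case True
    then show ?thesis using nrm_dist_le_field_algebra[of x y undefined] M.nonneg order_trans by blast
  qed (auto simp: nrm_dist_def field_algebra_def)
  show "nrm_dist (field_algebra \<A> X) x y = nrm_dist (field_algebra \<A> X) y x"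
  proof (cases "x \<in> X \<and> y \<in> X")
    case True
    then show ?thesis by (simp add: nrm_dist_field_algebra M.commute)
  qed (auto simp: nrm_dist_def field_algebra_def)
next
  fix x y assume xy: "x \<in> X" "y \<in> X"
  show "nrm_dist (field_algebra \<A> X) x y = 0 \<longleftrightarrow> x = y"
  proof
    assume 0: "nrm_dist (field_algebra \<A> X) x y = 0"
    have "nrm_dist (\<A> t) (x t) (y t) = 0" for t
      using nrm_dist_le_field_algebra[OF xy, of t] M.nonneg[of t "x t" "y t"] 0 by simp
    then show "x = y" using xy field_mem by (intro ext) (metis M.zero)
  next
    assume "x = y"
    moreover have "nrm_dist (\<A> t) (x t) (x t) = 0" for t
      using xy by (simp add: field_mem)
    ultimately show "nrm_dist (field_algebra \<A> X) x y = 0"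
      using xy by (simp add: nrm_dist_field_algebra)
  qed
next
  fix x y z assume xyz: "x \<in> X" "y \<in> X" "z \<in> X"
  show "nrm_dist (field_algebra \<A> X) x z \<le> nrm_dist (field_algebra \<A> X) x y + nrm_dist (field_algebra \<A> X) y z"
  proof (rule nrm_dist_field_algebra_le[OF xyz(1,3)])
    show "nrm_dist (\<A> t) (x t) (z t) \<le> nrm_dist (field_algebra \<A> X) x y + nrm_dist (field_algebra \<A> X) y z" for t
      using M.triangle[of "x t" t "y t" "z t"] xyz nrm_dist_le_field_algebra[of x y t]
        nrm_dist_le_field_algebra[of y z t] by (simp add: field_mem)
  qed
qed

text \<open>Limits exist in each complete fibre, and the Cauchy condition in the supremum norm makes
  the convergence uniform. Only closedness of X under uniform approximation remains to be
  supplied.\<close>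

lemma mcomplete_field_algebra:
  assumes lim: "\<And>(\<sigma> :: nat \<Rightarrow> 't \<Rightarrow> 'b) x. \<lbrakk>range \<sigma> \<subseteq> X; x \<in> operator_fields \<A>;
      \<forall>e>0. \<exists>n. \<forall>t. nrm_dist (\<A> t) (\<sigma> n t) (x t) \<le> e\<rbrakk> \<Longrightarrow> x \<in> X"
  shows "Metric_space.mcomplete X (nrm_dist (field_algebra \<A> X))"
proof -
  interpret D: Metric_space X "nrm_dist (field_algebra \<A> X)" by (rule Metric_space_field_algebra)
  show ?thesis
    unfolding D.mcomplete_def
  proof (intro allI impI)
    fix \<sigma> assume C: "D.MCauchy \<sigma>"
    then have \<sigma>: "\<sigma> n \<in> X" for n by (auto simp: D.MCauchy_def)
    have le: "nrm_dist (\<A> t) (\<sigma> m t) (\<sigma> n t) \<le> nrm_dist (field_algebra \<A> X) (\<sigma> m) (\<sigma> n)" for m n t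
      using nrm_dist_le_field_algebra \<sigma> by blast
    have "\<exists>y. limitin (M.mtopology t) (\<lambda>n. \<sigma> n t) y sequentially" for t
    proof -
      have "M.MCauchy t (\<lambda>n. \<sigma> n t)"
        unfolding M.MCauchy_def
      proof (intro conjI allI impI)
        fix e :: real assume "0 < e"
        then obtain N where "\<And>n n'. N \<le> n \<Longrightarrow> N \<le> n' \<Longrightarrow> nrm_dist (field_algebra \<A> X) (\<sigma> n) (\<sigma> n') < e"
          using C unfolding D.MCauchy_def by blast
        then show "\<exists>N. \<forall>n n'. N \<le> n \<longrightarrow> N \<le> n' \<longrightarrow> nrm_dist (\<A> t) (\<sigma> n t) (\<sigma> n' t) < e"
          using le by (meson le_less_trans)
      qed (use \<sigma> field_mem in auto)
      then show ?thesis using F.complete[of t] unfolding M.mcomplete_def by blast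
    qed
    then obtain x where x: "\<And>t. limitin (M.mtopology t) (\<lambda>n. \<sigma> n t) (x t) sequentially" by metis
    have xF: "x t \<in> carrier (\<A> t)" for t using x[of t] by (simp add: M.limitin_metric)
    have unif: "\<exists>N. \<forall>n\<ge>N. \<forall>t. nrm_dist (\<A> t) (\<sigma> n t) (x t) \<le> e" if "0 < e" for e
    proof -
      obtain N where N: "\<And>n n'. N \<le> n \<Longrightarrow> N \<le> n' \<Longrightarrow> nrm_dist (field_algebra \<A> X) (\<sigma> n) (\<sigma> n') < e / 2"
        using C half_gt_zero[OF \<open>0 < e\<close>] unfolding D.MCauchy_def by blast
      have "nrm_dist (\<A> t) (\<sigma> n t) (x t) \<le> e" if "N \<le> n" for n t
      proof -
        obtain N' where N': "\<And>m. N' \<le> m \<Longrightarrow> nrm_dist (\<A> t) (\<sigma> m t) (x t) < e / 2"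
          using x[of t] half_gt_zero[OF \<open>0 < e\<close>] unfolding M.limit_metric_sequentially by blast
        \<comment> \<open>The auxiliary index m depends on t, the threshold N does not; hence the
          estimate is uniform.\<close>
        define m where "m = max N N'"
        have "nrm_dist (\<A> t) (\<sigma> n t) (\<sigma> m t) < e / 2"
          using N[OF that, of m] le[of t n m] by (simp add: m_def)
        then show ?thesis
          using N'[of m] M.triangle[of "\<sigma> n t" t "\<sigma> m t" "x t"] \<sigma> xF by (simp add: m_def field_mem)
      qed
      then show ?thesis by blast
    qed
    have xX: "x \<in> X"
    proof (rule lim[of \<sigma>])
      show "\<forall>e>0. \<exists>n. \<forall>t. nrm_dist (\<A> t) (\<sigma> n t) (x t) \<le> e" using unif by blast
    qed (use \<sigma> xF in \<open>auto simp: operator_fields_def\<close>)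
    have "limitin D.mtopology \<sigma> x sequentially"
      unfolding D.limit_metric_sequentially
    proof (intro conjI allI impI xX)
      fix e :: real assume "0 < e"
      then obtain N where N: "\<And>n t. N \<le> n \<Longrightarrow> nrm_dist (\<A> t) (\<sigma> n t) (x t) \<le> e / 2"
        using unif[of "e / 2"] by auto
      have "nrm_dist (field_algebra \<A> X) (\<sigma> n) x < e" if "N \<le> n" for n
        using nrm_dist_field_algebra_le[OF \<sigma>[of n] xX N[OF that]] \<open>0 < e\<close> by simp
      then show "\<exists>N. \<forall>n\<ge>N. \<sigma> n \<in> X \<and> nrm_dist (field_algebra \<A> X) (\<sigma> n) x < e" using \<sigma> by blast
    qed
    then show "\<exists>x. limitin D.mtopology \<sigma> x sequentially" by blast
  qed
qed

end

lemma full_algebraD: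
  assumes "full_algebra \<A> X"
  shows "X \<subseteq> operator_fields \<A>" and "(\<lambda>t. zero (\<A> t)) \<in> X"
    and "\<And>x y. x \<in> X \<Longrightarrow> y \<in> X \<Longrightarrow> (\<lambda>t. add (\<A> t) (x t) (y t)) \<in> X"
    and "\<And>x y. x \<in> X \<Longrightarrow> y \<in> X \<Longrightarrow> (\<lambda>t. mult (\<A> t) (x t) (y t)) \<in> X"
    and "\<And>c x. x \<in> X \<Longrightarrow> (\<lambda>t. scale (\<A> t) c (x t)) \<in> X"
    and "\<And>x. x \<in> X \<Longrightarrow> (\<lambda>t. adj (\<A> t) (x t)) \<in> X"
    and "\<And>x. x \<in> X \<Longrightarrow> continuous_on UNIV (\<lambda>t. nrm (\<A> t) (x t))"
proof -
  interpret star_algebra "field_algebra \<A> X" using assms by (simp add: full_algebra_def)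
  show "(\<lambda>t. zero (\<A> t)) \<in> X"
    and "\<And>x y. x \<in> X \<Longrightarrow> y \<in> X \<Longrightarrow> (\<lambda>t. add (\<A> t) (x t) (y t)) \<in> X"
    and "\<And>x y. x \<in> X \<Longrightarrow> y \<in> X \<Longrightarrow> (\<lambda>t. mult (\<A> t) (x t) (y t)) \<in> X"
    and "\<And>c x. x \<in> X \<Longrightarrow> (\<lambda>t. scale (\<A> t) c (x t)) \<in> X"
    and "\<And>x. x \<in> X \<Longrightarrow> (\<lambda>t. adj (\<A> t) (x t)) \<in> X"
    using zero_closed add_closed mult_closed scale_closed adj_closed by (simp_all add: field_algebra_def)
qed (use assms in \<open>auto simp: full_algebra_def\<close>)

context
  fixes X :: "('t \<Rightarrow> 'b) set"
  assumes full: "full_algebra \<A> X"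
begin

lemma locally_approximable_mem: "x \<in> locally_approximable \<A> X \<Longrightarrow> x t \<in> carrier (\<A> t)"
  by (simp add: locally_approximable_def operator_fields_def)

lemma full_mem: "x \<in> X \<Longrightarrow> x t \<in> carrier (\<A> t)"
  using full_algebraD(1)[OF full] by (auto simp: operator_fields_def)

lemma locally_approximableE:
  assumes "x \<in> locally_approximable \<A> X" "0 < e"
  obtains y where "y \<in> X" "\<forall>\<^sub>F t in nhds s. nrm_dist (\<A> t) (x t) (y t) < e"
  using assms unfolding locally_approximable_def by blast

lemma locally_approximableI:
  assumes "\<And>t. x t \<in> carrier (\<A> t)"
    and "\<And>s e. 0 < e \<Longrightarrow> \<exists>y\<in>X. \<forall>\<^sub>F t in nhds s. nrm_dist (\<A> t) (x t) (y t) < e"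
  shows "x \<in> locally_approximable \<A> X"
  using assms by (simp add: locally_approximable_def operator_fields_def)

lemma subset_locally_approximable: "X \<subseteq> locally_approximable \<A> X"
  by (auto intro!: locally_approximableI full_mem bexI simp: full_mem)

lemma continuous_on_nrm_locally_approximable:
  assumes x: "x \<in> locally_approximable \<A> X"
  shows "continuous_on UNIV (\<lambda>t. nrm (\<A> t) (x t))"
proof -
  have "((\<lambda>t. nrm (\<A> t) (x t)) \<longlongrightarrow> nrm (\<A> s) (x s)) (nhds s)" for s
  proof (rule tendstoI)
    fix e :: real assume "0 < e"
    obtain y where y: "y \<in> X" "\<forall>\<^sub>F t in nhds s. nrm_dist (\<A> t) (x t) (y t) < e/3"
      using \<open>0 < e\<close> by (auto intro: locally_approximableE[OF x, of "e/3" s])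
    have "((\<lambda>t. nrm (\<A> t) (y t)) \<longlongrightarrow> nrm (\<A> s) (y s)) (nhds s)"
      using full_algebraD(7)[OF full y(1)] by (simp add: continuous_on_UNIV_iff_tendsto_nhds)
    then have "\<forall>\<^sub>F t in nhds s. dist (nrm (\<A> t) (y t)) (nrm (\<A> s) (y s)) < e/3"
      using \<open>0 < e\<close> by (intro tendstoD) auto
    then show "\<forall>\<^sub>F t in nhds s. dist (nrm (\<A> t) (x t)) (nrm (\<A> s) (x s)) < e"
      using y(2)
    proof eventually_elim
      case (elim t)
      have "\<bar>nrm (\<A> r) (x r) - nrm (\<A> r) (y r)\<bar> \<le> nrm_dist (\<A> r) (x r) (y r)" for r
        by (rule F.abs_nrm_diff_le[OF locally_approximable_mem[OF x] full_mem[OF y(1)]])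
      from this[of t] this[of s] show ?case
        using eventually_nhds_x_imp_x[OF y(2)] elim unfolding dist_real_def by linarith
    qed
  qed
  then show ?thesis
    by (simp add: continuous_on_UNIV_iff_tendsto_nhds)
qed

lemma locally_bounded:
  assumes "continuous_on UNIV (\<lambda>t. nrm (\<A> t) (x t))"
  obtains M where "0 < M" "\<forall>\<^sub>F t in nhds s. nrm (\<A> t) (x t) < M"
proof -
  have "((\<lambda>t. nrm (\<A> t) (x t)) \<longlongrightarrow> nrm (\<A> s) (x s)) (nhds s)"
    using assms by (simp add: continuous_on_UNIV_iff_tendsto_nhds)
  then have "\<forall>\<^sub>F t in nhds s. nrm (\<A> t) (x t) < \<bar>nrm (\<A> s) (x s)\<bar> + 1"
    by (intro order_tendstoD(2)) auto
  then show ?thesis by (intro that[of "\<bar>nrm (\<A> s) (x s)\<bar> + 1"]) auto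
qed

lemma add_locally_approximable:
  assumes x: "x \<in> locally_approximable \<A> X" and x': "x' \<in> locally_approximable \<A> X"
  shows "(\<lambda>t. add (\<A> t) (x t) (x' t)) \<in> locally_approximable \<A> X"
proof (rule locally_approximableI)
  fix s and e :: real assume "0 < e"
  obtain y where y: "y \<in> X" "\<forall>\<^sub>F t in nhds s. nrm_dist (\<A> t) (x t) (y t) < e/2"
    by (rule locally_approximableE[OF x half_gt_zero[OF \<open>0 < e\<close>]])
  obtain y' where y': "y' \<in> X" "\<forall>\<^sub>F t in nhds s. nrm_dist (\<A> t) (x' t) (y' t) < e/2"
    by (rule locally_approximableE[OF x' half_gt_zero[OF \<open>0 < e\<close>]])
  have "\<forall>\<^sub>F t in nhds s. nrm_dist (\<A> t) (add (\<A> t) (x t) (x' t)) (add (\<A> t) (y t) (y' t)) < e"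
    using y(2) y'(2)
  proof eventually_elim
    case (elim t)
    then show ?case
      using F.nrm_dist_add_le[of "x t" t "y t" "x' t" "y' t"] locally_approximable_mem[OF x]
        locally_approximable_mem[OF x'] full_mem[OF y(1)] full_mem[OF y'(1)] by simp
  qed
  then show "\<exists>y\<in>X. \<forall>\<^sub>F t in nhds s. nrm_dist (\<A> t) (add (\<A> t) (x t) (x' t)) (y t) < e"
    by (rule bexI[OF _ full_algebraD(3)[OF full y(1) y'(1)]])
qed (simp add: F.add_closed locally_approximable_mem x x')

lemma mult_locally_approximable:
  assumes x: "x \<in> locally_approximable \<A> X" and x': "x' \<in> locally_approximable \<A> X"
  shows "(\<lambda>t. mult (\<A> t) (x t) (x' t)) \<in> locally_approximable \<A> X"
proof (rule locally_approximableI)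
  fix s and e :: real assume "0 < e"
  \<comment> \<open>The choices are nested to match \<open>nrm_dist_mult_le\<close>: a bound M of x
    fixes the accuracy of \<open>y'\<close>, and a bound N of \<open>y'\<close> then fixes the
    accuracy of y.\<close>
  obtain M where M: "0 < M" "\<forall>\<^sub>F t in nhds s. nrm (\<A> t) (x t) < M"
    by (rule locally_bounded[OF continuous_on_nrm_locally_approximable[OF x]])
  obtain y' where y': "y' \<in> X" "\<forall>\<^sub>F t in nhds s. nrm_dist (\<A> t) (x' t) (y' t) < e / 2 / M"
    by (rule locally_approximableE[OF x', of "e / 2 / M" s]) (use M \<open>0 < e\<close> in auto)
  obtain N where N: "0 < N" "\<forall>\<^sub>F t in nhds s. nrm (\<A> t) (y' t) < N"
    by (rule locally_bounded[OF full_algebraD(7)[OF full y'(1)]])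
  obtain y where y: "y \<in> X" "\<forall>\<^sub>F t in nhds s. nrm_dist (\<A> t) (x t) (y t) < e / 2 / N"
    by (rule locally_approximableE[OF x, of "e / 2 / N" s]) (use N \<open>0 < e\<close> in auto)
  have "\<forall>\<^sub>F t in nhds s. nrm_dist (\<A> t) (mult (\<A> t) (x t) (x' t)) (mult (\<A> t) (y t) (y' t)) < e"
    using y(2) y'(2) M(2) N(2)
  proof eventually_elim
    case (elim t)
    note mem = locally_approximable_mem[OF x, of t] locally_approximable_mem[OF x', of t]
      full_mem[OF y(1), of t] full_mem[OF y'(1), of t]
    have "nrm (\<A> t) (x t) * nrm_dist (\<A> t) (x' t) (y' t) \<le> M * nrm_dist (\<A> t) (x' t) (y' t)"
      using elim by (intro mult_right_mono) auto
    also have "\<dots> < M * (e / 2 / M)" using elim M(1) by (intro mult_strict_left_mono)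
    finally have 1: "nrm (\<A> t) (x t) * nrm_dist (\<A> t) (x' t) (y' t) < e / 2" using M(1) by simp
    have "nrm_dist (\<A> t) (x t) (y t) * nrm (\<A> t) (y' t) \<le> nrm_dist (\<A> t) (x t) (y t) * N"
      using elim by (intro mult_left_mono) auto
    also have "\<dots> < e / 2 / N * N" using elim N(1) by (intro mult_strict_right_mono)
    finally have "nrm_dist (\<A> t) (x t) (y t) * nrm (\<A> t) (y' t) < e / 2" using N(1) by simp
    with 1 show ?case using F.nrm_dist_mult_le[of "x t" t "y t" "x' t" "y' t"] mem by simp
  qed
  then show "\<exists>y\<in>X. \<forall>\<^sub>F t in nhds s. nrm_dist (\<A> t) (mult (\<A> t) (x t) (x' t)) (y t) < e"
    by (rule bexI[OF _ full_algebraD(4)[OF full y(1) y'(1)]])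
qed (simp add: F.mult_closed locally_approximable_mem x x')

text \<open>Near s the function is almost the constant \<open>f s\<close>, and X is closed under
  constant multiples; so \<open>f s\<close> times an approximant of x approximates the
  product.\<close>

lemma scale_locally_approximable:
  assumes x: "x \<in> locally_approximable \<A> X" and f: "continuous_on UNIV f"
  shows "(\<lambda>t. scale (\<A> t) (f t) (x t)) \<in> locally_approximable \<A> X"
proof (rule locally_approximableI)
  fix s and e :: real assume "0 < e"
  \<comment> \<open>The added 1 keeps c positive when \<open>f s = 0\<close>.\<close>
  define c where "c = cmod (f s) + 1"
  have "0 < c" by (simp add: c_def add_nonneg_pos)
  obtain y where y: "y \<in> X" "\<forall>\<^sub>F t in nhds s. nrm_dist (\<A> t) (x t) (y t) < e / 2 / c"
    by (rule locally_approximableE[OF x, of "e / 2 / c" s]) (use \<open>0 < c\<close> \<open>0 < e\<close> in auto)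
  obtain N where N: "0 < N" "\<forall>\<^sub>F t in nhds s. nrm (\<A> t) (x t) < N"
    by (rule locally_bounded[OF continuous_on_nrm_locally_approximable[OF x]])
  have "(f \<longlongrightarrow> f s) (nhds s)"
    using f by (simp add: continuous_on_UNIV_iff_tendsto_nhds)
  then have "\<forall>\<^sub>F t in nhds s. dist (f t) (f s) < e / 2 / N"
    using \<open>0 < e\<close> N(1) by (intro tendstoD) auto
  with y(2) N(2)
  have "\<forall>\<^sub>F t in nhds s. nrm_dist (\<A> t) (scale (\<A> t) (f t) (x t)) (scale (\<A> t) (f s) (y t)) < e"
  proof eventually_elim
    case (elim t)
    note mem = locally_approximable_mem[OF x, of t] full_mem[OF y(1), of t]
    have "cmod (f t - f s) * nrm (\<A> t) (x t) \<le> cmod (f t - f s) * N"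
      using elim by (intro mult_left_mono) auto
    also have "\<dots> < e / 2 / N * N"
      using elim N(1) by (intro mult_strict_right_mono) (auto simp: dist_norm)
    finally have 1: "cmod (f t - f s) * nrm (\<A> t) (x t) < e / 2" using N(1) by simp
    have "cmod (f s) * nrm_dist (\<A> t) (x t) (y t) \<le> c * nrm_dist (\<A> t) (x t) (y t)"
      by (intro mult_right_mono) (auto simp: c_def)
    also have "\<dots> < c * (e / 2 / c)" using elim \<open>0 < c\<close> by (intro mult_strict_left_mono)
    finally have 2: "cmod (f s) * nrm_dist (\<A> t) (x t) (y t) < e / 2" using \<open>0 < c\<close> by simp
    show ?case
      using 1 2 mem M.triangle[of "scale (\<A> t) (f t) (x t)" t "scale (\<A> t) (f s) (x t)" "scale (\<A> t) (f s) (y t)"]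
      by (simp add: F.nrm_dist_scale F.nrm_dist_scale_left F.scale_closed)
  qed
  then show "\<exists>y\<in>X. \<forall>\<^sub>F t in nhds s. nrm_dist (\<A> t) (scale (\<A> t) (f t) (x t)) (y t) < e"
    by (rule bexI[OF _ full_algebraD(5)[OF full y(1)]])
qed (simp add: F.scale_closed locally_approximable_mem x)

lemma adj_locally_approximable:
  assumes x: "x \<in> locally_approximable \<A> X"
  shows "(\<lambda>t. adj (\<A> t) (x t)) \<in> locally_approximable \<A> X"
proof (rule locally_approximableI)
  fix s and e :: real assume "0 < e"
  obtain y where y: "y \<in> X" "\<forall>\<^sub>F t in nhds s. nrm_dist (\<A> t) (x t) (y t) < e"
    by (rule locally_approximableE[OF x \<open>0 < e\<close>])
  then have "\<forall>\<^sub>F t in nhds s. nrm_dist (\<A> t) (adj (\<A> t) (x t)) (adj (\<A> t) (y t)) < e"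
    by (simp add: F.nrm_dist_adj locally_approximable_mem[OF x] full_mem[OF y(1)])
  then show "\<exists>y\<in>X. \<forall>\<^sub>F t in nhds s. nrm_dist (\<A> t) (adj (\<A> t) (x t)) (y t) < e"
    by (rule bexI[OF _ full_algebraD(6)[OF full y(1)]])
qed (simp add: F.adj_closed locally_approximable_mem x)

text \<open>Norm functions of locally approximable fields are continuous, hence bounded on the
  compact space; this gives the supremum norm a meaning on the larger family. Density in the fibres
  is inherited from X, and completeness holds because local approximability survives uniform
  limits.\<close>

lemma full_algebra_locally_approximable:
  assumes T: "compact (UNIV :: 't set)"
  shows "full_algebra \<A> (locally_approximable \<A> X)" (is "full_algebra \<A> ?Y")
proof -
  have Y: "?Y \<subseteq> operator_fields \<A>" by (auto simp: locally_approximable_def)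
  have "bdd_above (range (\<lambda>t. nrm_dist (\<A> t) (x t) (y t)))" if "x \<in> ?Y" "y \<in> ?Y" for x y
  proof -
    define z where "z = (\<lambda>t. add (\<A> t) (x t) (scale (\<A> t) (-1) (y t)))"
    have "z \<in> ?Y"
      unfolding z_def using that
      by (intro add_locally_approximable scale_locally_approximable) auto
    then have "compact (range (\<lambda>t. nrm (\<A> t) (z t)))"
      by (intro compact_continuous_image continuous_on_nrm_locally_approximable T)
    moreover have "nrm_dist (\<A> t) (x t) (y t) = nrm (\<A> t) (z t)" for t
      using that by (simp add: nrm_dist_def z_def locally_approximable_mem)
    ultimately show ?thesis by (simp add: bounded_imp_bdd_above compact_imp_bounded)
  qed
  note mc = mcomplete_field_algebra[OF Y this]
  show ?thesis
    unfolding full_algebra_def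
  proof (intro conjI ballI allI impI Y)
    show "star_algebra (field_algebra \<A> ?Y)"
      using subset_locally_approximable full_algebraD(2)[OF full]
      by (intro star_algebra_field_algebra Y add_locally_approximable mult_locally_approximable
          scale_locally_approximable adj_locally_approximable) auto
    show "continuous_on UNIV (\<lambda>t. nrm (\<A> t) (x t))" if "x \<in> ?Y" for x
      by (rule continuous_on_nrm_locally_approximable[OF that])
    show "compact {t. \<epsilon> \<le> nrm (\<A> t) (x t)}" if "x \<in> ?Y" for x \<epsilon>
      using closed_Int_compact[OF closed_Collect_le[OF continuous_on_const
            continuous_on_nrm_locally_approximable[OF that]] T] by simp
    show "nrm_topology (\<A> t) closure_of (\<lambda>x. x t) ` ?Y = carrier (\<A> t)" for t
    proof
      show "nrm_topology (\<A> t) closure_of (\<lambda>x. x t) ` ?Y \<subseteq> carrier (\<A> t)"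
        using closure_of_subset_topspace[of "nrm_topology (\<A> t)"] by (simp add: nrm_topology_def)
      show "carrier (\<A> t) \<subseteq> nrm_topology (\<A> t) closure_of (\<lambda>x. x t) ` ?Y"
        using full closure_of_mono[OF image_mono[OF subset_locally_approximable], of "nrm_topology (\<A> t)" "\<lambda>x. x t"]
        by (simp add: full_algebra_def)
    qed
    show "Metric_space.mcomplete ?Y (nrm_dist (field_algebra \<A> ?Y))"
    proof (rule mc)
      fix \<sigma> x assume \<sigma>: "range \<sigma> \<subseteq> ?Y" and x: "x \<in> operator_fields \<A>"
        and lim: "\<forall>e>0. \<exists>n. \<forall>t. nrm_dist (\<A> t) (\<sigma> n t) (x t) \<le> e"
      have xF: "x t \<in> carrier (\<A> t)" for t using x by (simp add: operator_fields_def)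
      show "x \<in> ?Y"
      proof (rule locally_approximableI[OF xF])
        fix s and e :: real assume "0 < e"
        then obtain n where n: "\<And>t. nrm_dist (\<A> t) (\<sigma> n t) (x t) \<le> e / 2"
          using lim half_gt_zero by blast
        have \<sigma>n: "\<sigma> n \<in> ?Y" using \<sigma> by blast
        obtain y where y: "y \<in> X" "\<forall>\<^sub>F t in nhds s. nrm_dist (\<A> t) (\<sigma> n t) (y t) < e / 2"
          by (rule locally_approximableE[OF \<sigma>n half_gt_zero[OF \<open>0 < e\<close>]])
        from y(2) have "\<forall>\<^sub>F t in nhds s. nrm_dist (\<A> t) (x t) (y t) < e"
        proof eventually_elim
          case (elim t)
          then show ?case
            using n[of t] M.triangle[of "x t" t "\<sigma> n t" "y t"] M.commute[of t "x t" "\<sigma> n t"]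
              xF[of t] locally_approximable_mem[OF \<sigma>n] full_mem[OF y(1)] by simp
        qed
        then show "\<exists>y\<in>X. \<forall>\<^sub>F t in nhds s. nrm_dist (\<A> t) (x t) (y t) < e" using y(1) by blast
      qed
    qed
  qed
qed

end

text \<open>Locally uniform approximability by the given fields defines a full algebra, so a maximal
  algebra has to contain it; products with continuous functions are locally approximable.\<close>

lemma maximal_full_algebra_scale:
  assumes "maximal_full_algebra \<A> X" "compact (UNIV :: 't set)" "x \<in> X" "continuous_on UNIV f"
  shows "(\<lambda>t. scale (\<A> t) (f t) (x t)) \<in> X"
proof -
  have full: "full_algebra \<A> X" using assms(1) by (simp add: maximal_full_algebra_def)
  have "locally_approximable \<A> X = X"
    using full_algebra_locally_approximable[OF full assms(2)] subset_locally_approximable[OF full] assms(1)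
    unfolding maximal_full_algebra_def by blast
  then show ?thesis
    using scale_locally_approximable[OF full, of x f] assms(3,4) by simp
qed

end

section \<open>The dual space and its norm\<close>

context star_algebra
begin

lemma dual_spaceD:
  assumes "f \<in> dual_space A"
  shows "\<And>x y. x \<in> carrier A \<Longrightarrow> y \<in> carrier A \<Longrightarrow> f (x \<oplus> y) = f x + f y"
    and "\<And>c x. x \<in> carrier A \<Longrightarrow> f (c \<odot> x) = c * f x"
    and "\<And>x. x \<notin> carrier A \<Longrightarrow> f x = 0"
  using assms by (simp_all add: dual_space_def)

end

context cstar_algebra
begin

lemma nrm_zero: "nrm A \<zero> = 0"
  using nrm_eq_0 zero_closed by simp

lemma dual_space_zero: "f \<in> dual_space A \<Longrightarrow> f \<zero> = 0"
  using dual_spaceD(2)[of f \<zero> 0] scale_zero_left[OF zero_closed] zero_closed by simp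

lemma bdd_above_dual_norm:
  assumes "f \<in> dual_space A"
  shows "bdd_above ((\<lambda>x. cmod (f x)) ` {x \<in> carrier A. nrm A x \<le> 1})"
proof -
  obtain K where K: "\<forall>x\<in>carrier A. cmod (f x) \<le> K * nrm A x"
    using assms by (auto simp: dual_space_def)
  have "cmod (f x) \<le> \<bar>K\<bar>" if "x \<in> carrier A" "nrm A x \<le> 1" for x
  proof -
    have "cmod (f x) \<le> \<bar>K\<bar> * nrm A x"
      using K that nrm_nonneg[of x] by (meson abs_ge_self mult_right_mono order_trans)
    also have "\<dots> \<le> \<bar>K\<bar>" using that by (intro mult_left_le) auto
    finally show ?thesis .
  qed
  then show ?thesis by (intro bdd_aboveI[of _ "\<bar>K\<bar>"]) auto
qed

lemma unit_ball_nonempty: "{x \<in> carrier A. nrm A x \<le> 1} \<noteq> {}"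
proof -
  have "\<zero> \<in> {x \<in> carrier A. nrm A x \<le> 1}" using zero_closed nrm_zero by simp
  then show ?thesis by blast
qed

lemma dual_norm_upper:
  "f \<in> dual_space A \<Longrightarrow> x \<in> carrier A \<Longrightarrow> nrm A x \<le> 1 \<Longrightarrow> cmod (f x) \<le> dual_norm A f"
  unfolding dual_norm_def by (rule cSUP_upper) (auto simp: bdd_above_dual_norm)

lemma dual_norm_least:
  "(\<And>x. x \<in> carrier A \<Longrightarrow> nrm A x \<le> 1 \<Longrightarrow> cmod (f x) \<le> K) \<Longrightarrow> dual_norm A f \<le> K"
  unfolding dual_norm_def by (rule cSUP_least[OF unit_ball_nonempty]) simp

lemma dual_norm_nonneg: "f \<in> dual_space A \<Longrightarrow> 0 \<le> dual_norm A f"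
  using dual_norm_upper[of f \<zero>] zero_closed nrm_zero by (simp add: dual_space_zero)

text \<open>A unimodular multiple of a near maximizer makes the value real. Real parts, unlike
  moduli, can be summed over several sets and read off from a single value of a functional.\<close>

lemma dual_norm_attained:
  assumes "f \<in> dual_space A" "0 < e"
  obtains x where "x \<in> carrier A" "nrm A x \<le> 1" "dual_norm A f - e < Re (f x)"
proof -
  have "dual_norm A f - e < dual_norm A f" using assms by simp
  then obtain x where x: "x \<in> carrier A" "nrm A x \<le> 1" "dual_norm A f - e < cmod (f x)"
    unfolding dual_norm_def less_cSUP_iff[OF unit_ball_nonempty bdd_above_dual_norm[OF assms(1)]] by auto
  obtain u where u: "cmod u = 1" "u * f x = of_real (cmod (f x))" by (rule unimodular_rotate)
  then have "f (u \<odot> x) = of_real (cmod (f x))"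
    using dual_spaceD(2)[OF assms(1) x(1)] by simp
  then show ?thesis
    using x u by (intro that[of "u \<odot> x"]) (auto simp: scale_closed nrm_scale)
qed

lemma dual_norm_bound:
  assumes "f \<in> dual_space A" "x \<in> carrier A"
  shows "cmod (f x) \<le> dual_norm A f * nrm A x"
proof (cases "nrm A x = 0")
  case True
  then have "x = \<zero>" using nrm_eq_0 assms(2) by simp
  then show ?thesis using dual_space_zero[OF assms(1)] nrm_zero by simp
next
  case False
  then have pos: "0 < nrm A x" using nrm_nonneg[OF assms(2)] by simp
  have "cmod (f (of_real (inverse (nrm A x)) \<odot> x)) \<le> dual_norm A f"
    using pos assms(2) by (intro dual_norm_upper assms(1)) (simp_all add: scale_closed nrm_scale norm_inverse)
  then have "cmod (f x) / nrm A x \<le> dual_norm A f"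
    using pos dual_spaceD(2)[OF assms] by (simp add: norm_mult norm_inverse divide_inverse mult.commute)
  then show ?thesis using pos by (simp add: divide_le_eq)
qed

lemma dual_norm_const_zero: "dual_norm A (\<lambda>a. 0) = 0"
  unfolding dual_norm_def using unit_ball_nonempty by simp

lemma dual_space_add:
  assumes "f \<in> dual_space A" "g \<in> dual_space A" shows "(\<lambda>a. f a + g a) \<in> dual_space A"
proof -
  have "cmod (f x + g x) \<le> (dual_norm A f + dual_norm A g) * nrm A x" if "x \<in> carrier A" for x
    using dual_norm_bound[OF assms(1) that] dual_norm_bound[OF assms(2) that] norm_triangle_ineq[of "f x" "g x"]
    by (simp add: distrib_right)
  then show ?thesis
    using dual_spaceD[OF assms(1)] dual_spaceD[OF assms(2)] unfolding dual_space_def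
    by (auto simp: algebra_simps intro!: exI[of _ "dual_norm A f + dual_norm A g"])
qed

lemma dual_space_scale:
  assumes "f \<in> dual_space A" shows "(\<lambda>a. c * f a) \<in> dual_space A"
proof -
  have "cmod (c * f x) \<le> (cmod c * dual_norm A f) * nrm A x" if "x \<in> carrier A" for x
    using dual_norm_bound[OF assms that] by (simp add: norm_mult mult_left_mono mult.assoc)
  then show ?thesis
    using dual_spaceD[OF assms] unfolding dual_space_def
    by (auto simp: algebra_simps simp del: norm_mult intro!: exI[of _ "cmod c * dual_norm A f"])
qed

lemma dual_norm_add_le:
  assumes "f \<in> dual_space A" "g \<in> dual_space A"
  shows "dual_norm A (\<lambda>a. f a + g a) \<le> dual_norm A f + dual_norm A g"
  by (rule dual_norm_least) (meson add_mono dual_norm_upper assms norm_triangle_le)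

lemma dual_norm_scale_le:
  assumes "f \<in> dual_space A"
  shows "dual_norm A (\<lambda>a. c * f a) \<le> cmod c * dual_norm A f"
  by (rule dual_norm_least) (simp add: norm_mult mult_left_mono dual_norm_upper[OF assms])

end

section \<open>The action of continuous functions on the algebra\<close>

locale section_realization = cstar_algebra A + cstar_fibres \<A>
  for A :: "'a star_struct" (structure) and \<A> :: "'t::t2_space \<Rightarrow> 'b star_struct" +
  fixes \<Gamma> :: "('t \<Rightarrow> 'b) set" and \<phi> :: "'a \<Rightarrow> 't \<Rightarrow> 'b"
  assumes compact: "compact (UNIV :: 't set)"
    and iso: "star_isomorphism A (field_algebra \<A> \<Gamma>) \<phi>"
    and sections: "\<Gamma> \<subseteq> operator_fields \<A>"
    and scale_sections: "\<lbrakk>continuous_on UNIV f; x \<in> \<Gamma>\<rbrakk> \<Longrightarrow> (\<lambda>t. scale (\<A> t) (f t) (x t)) \<in> \<Gamma>"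
begin

lemma bij_section: "bij_betw \<phi> (carrier A) \<Gamma>"
  using iso by (simp add: star_isomorphism_def field_algebra_def)

lemma section_mem: "a \<in> carrier A \<Longrightarrow> \<phi> a t \<in> carrier (\<A> t)"
  using bij_section sections by (auto simp: bij_betw_def operator_fields_def)

lemma section_simps:
  "a \<in> carrier A \<Longrightarrow> b \<in> carrier A \<Longrightarrow> \<phi> (a \<oplus> b) t = add (\<A> t) (\<phi> a t) (\<phi> b t)"
  "a \<in> carrier A \<Longrightarrow> b \<in> carrier A \<Longrightarrow> \<phi> (a \<otimes> b) t = mult (\<A> t) (\<phi> a t) (\<phi> b t)"
  "a \<in> carrier A \<Longrightarrow> \<phi> (c \<odot> a) t = scale (\<A> t) c (\<phi> a t)"
  "a \<in> carrier A \<Longrightarrow> \<phi> (adj A a) t = adj (\<A> t) (\<phi> a t)"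
  using iso by (simp_all add: star_isomorphism_def field_algebra_def)

lemma section_zero: "\<phi> \<zero> t = zero (\<A> t)"
  using section_simps(3)[OF zero_closed, of 0 t] scale_zero_left[OF zero_closed]
    F.scale_zero_left[OF section_mem[OF zero_closed]] by simp

lemma section_eqI: "a \<in> carrier A \<Longrightarrow> b \<in> carrier A \<Longrightarrow> (\<And>t. \<phi> a t = \<phi> b t) \<Longrightarrow> a = b"
  using bij_section by (auto simp: bij_betw_def inj_on_def fun_eq_iff)

definition act :: "('t \<Rightarrow> complex) \<Rightarrow> 'a \<Rightarrow> 'a" where
  "act f a = inv_into (carrier A) \<phi> (\<lambda>t. scale (\<A> t) (f t) (\<phi> a t))"

context
  fixes f :: "'t \<Rightarrow> complex" and a :: 'a
  assumes f: "continuous_on UNIV f" and a: "a \<in> carrier A"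
begin

lemma scale_in_image: "(\<lambda>t. scale (\<A> t) (f t) (\<phi> a t)) \<in> \<phi> ` carrier A"
  using scale_sections[OF f, of "\<phi> a"] bij_section a by (auto simp: bij_betw_def)

lemma act_closed: "act f a \<in> carrier A"
  unfolding act_def by (rule inv_into_into[OF scale_in_image])

lemma section_act: "\<phi> (act f a) t = scale (\<A> t) (f t) (\<phi> a t)"
  unfolding act_def by (simp add: f_inv_into_f[OF scale_in_image])

end

lemmas act_simps = section_simps section_act section_mem act_closed add_closed scale_closed mult_closed adj_closed
  F.add_closed F.scale_closed F.mult_closed F.adj_closed F.scale_scale F.scale_add_left F.scale_add_right
  F.adj_scale F.adj_mult F.mult_scale_left F.mult_scale_right F.scale_one

lemma act_one: "a \<in> carrier A \<Longrightarrow> act (\<lambda>t. 1) a = a"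
  by (rule section_eqI) (simp_all add: act_simps)

lemma act_add_left:
  "\<lbrakk>continuous_on UNIV f; continuous_on UNIV g; a \<in> carrier A\<rbrakk> \<Longrightarrow> act (\<lambda>t. f t + g t) a = act f a \<oplus> act g a"
  by (rule section_eqI) (simp_all add: act_simps continuous_on_add)

lemma act_add_right:
  "\<lbrakk>continuous_on UNIV f; a \<in> carrier A; b \<in> carrier A\<rbrakk> \<Longrightarrow> act f (a \<oplus> b) = act f a \<oplus> act f b"
  by (rule section_eqI) (simp_all add: act_simps)

lemma act_scale_left:
  "\<lbrakk>continuous_on UNIV f; a \<in> carrier A\<rbrakk> \<Longrightarrow> act (\<lambda>t. c * f t) a = c \<odot> act f a"
  by (rule section_eqI) (simp_all add: act_simps continuous_on_mult_left)

lemma act_scale_right: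
  "\<lbrakk>continuous_on UNIV f; a \<in> carrier A\<rbrakk> \<Longrightarrow> act f (c \<odot> a) = c \<odot> act f a"
  by (rule section_eqI) (simp_all add: act_simps mult.commute)

lemma act_eq_zero:
  assumes "continuous_on UNIV f" "a \<in> carrier A" "\<And>t. f t = 0 \<or> \<phi> a t = zero (\<A> t)"
  shows "act f a = \<zero>"
proof (rule section_eqI)
  fix t
  show "\<phi> (act f a) t = \<phi> \<zero> t"
    using assms(3)[of t] assms(1,2)
    by (auto simp: section_act section_zero F.scale_zero_left F.scale_zero_right section_mem)
qed (simp_all add: act_closed assms zero_closed)

text \<open>Collecting both copies of f on one factor lets the C*-identity trade the norm of
  \<open>act f a\<close> for the action of the real function \<open>cnj (f t) * f t\<close>.\<close>

lemma adj_act_mult_act: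
  assumes "continuous_on UNIV f" "a \<in> carrier A"
  shows "adj A (act f a) \<otimes> act f a = adj A a \<otimes> act (\<lambda>t. cnj (f t) * f t) a"
  using assms by (intro section_eqI) (simp_all add: act_simps continuous_on_mult continuous_on_cnj mult.commute)

lemma nrm_act_unimodular:
  assumes "continuous_on UNIV u" "\<And>t. cmod (u t) = 1" "a \<in> carrier A"
  shows "nrm A (act u a) = nrm A a"
proof -
  have "cnj (u t) * u t = 1" for t
    using assms(2)[of t] complex_norm_square[of "u t"] by (simp add: mult.commute)
  then have "(nrm A (act u a))\<^sup>2 = (nrm A a)\<^sup>2"
    using assms(1,3) by (simp add: cstar_identity[symmetric] act_closed adj_act_mult_act act_one)
  then show ?thesis
    using nrm_nonneg assms by (simp add: act_closed)
qed

text \<open>A real function with values in \<open>[-1, 1]\<close> is the mean of two unimodular ones, so the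
  C*-identity bounds its action without knowing that \<open>\<phi>\<close> is isometric.\<close>

lemma nrm_act_real_le:
  fixes f :: "'t \<Rightarrow> real"
  assumes f: "continuous_on UNIV f" "\<And>t. \<bar>f t\<bar> \<le> 1" and a: "a \<in> carrier A"
  shows "nrm A (act (\<lambda>t. of_real (f t)) a) \<le> nrm A a"
proof -
  define u where "u = (\<lambda>t. Complex (f t) (sqrt (1 - (f t)\<^sup>2)))"
  have u: "continuous_on UNIV u" "continuous_on UNIV (\<lambda>t. cnj (u t))"
    unfolding u_def Complex_eq using f(1) by (intro continuous_intros; simp)+
  have norm_u: "cmod (u t) = 1" for t
    using f(2)[of t] by (simp add: u_def cmod_def abs_square_le_1)
  have "(\<lambda>t. complex_of_real (f t)) = (\<lambda>t. 1/2 * u t + 1/2 * cnj (u t))"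
    by (auto simp: u_def complex_eq_iff)
  then have "act (\<lambda>t. of_real (f t)) a = (1/2) \<odot> act u a \<oplus> (1/2) \<odot> act (\<lambda>t. cnj (u t)) a"
    using u a act_add_left[of "\<lambda>t. 1/2 * u t" "\<lambda>t. 1/2 * cnj (u t)" a]
    by (simp only: act_scale_left continuous_on_mult_left)
  also have "nrm A \<dots> \<le> nrm A a / 2 + nrm A a / 2"
    using u a norm_u by (intro order_trans[OF nrm_triangle])
      (simp_all add: scale_closed act_closed nrm_scale nrm_act_unimodular norm_divide)
  finally show ?thesis by simp
qed

text \<open>Squaring by the C*-identity replaces the complex f by the real function
  \<open>(cmod (f t))\<^sup>2\<close> with values in [0, 1], to which \<open>nrm_act_real_le\<close>
  applies.\<close>

lemma nrm_act_le:
  assumes f: "continuous_on UNIV f" "\<And>t. cmod (f t) \<le> 1" and a: "a \<in> carrier A"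
  shows "nrm A (act f a) \<le> nrm A a"
proof -
  have c: "continuous_on UNIV (\<lambda>t. (cmod (f t))\<^sup>2)" using f(1) by (intro continuous_intros)
  have cc: "continuous_on UNIV (\<lambda>t. complex_of_real ((cmod (f t))\<^sup>2))" using f(1) by (intro continuous_intros)
  have "(nrm A (act f a))\<^sup>2 = nrm A (adj A a \<otimes> act (\<lambda>t. of_real ((cmod (f t))\<^sup>2)) a)"
    unfolding complex_norm_square mult.commute[of "f _"]
    using f(1) a by (simp add: cstar_identity[symmetric] act_closed adj_act_mult_act)
  also have "\<dots> \<le> nrm A a * nrm A (act (\<lambda>t. of_real ((cmod (f t))\<^sup>2)) a)"
    using nrm_mult[OF adj_closed[OF a] act_closed[OF cc a]] nrm_adj[OF a] by simp
  also have "\<dots> \<le> nrm A a * nrm A a"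
    using f(2) a by (intro mult_left_mono nrm_act_real_le c) (simp_all add: power_le_one nrm_nonneg)
  finally have "(nrm A (act f a))\<^sup>2 \<le> (nrm A a)\<^sup>2" by (simp only: power2_eq_square)
  then show ?thesis by (rule power2_le_imp_le) (rule nrm_nonneg[OF a])
qed

lemma nrm_act_le_scaled:
  assumes f: "continuous_on UNIV f" "\<And>t. cmod (f t) \<le> e" "0 < e" and a: "a \<in> carrier A"
  shows "nrm A (act f a) \<le> e * nrm A a"
proof -
  have c: "continuous_on UNIV (\<lambda>t. f t / of_real e)" using f by (intro continuous_intros) auto
  have "act f a = of_real e \<odot> act (\<lambda>t. f t / of_real e) a"
    using act_scale_left[OF c a, of "of_real e"] f(3) by simp
  then have "nrm A (act f a) = e * nrm A (act (\<lambda>t. f t / of_real e) a)"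
    using act_closed[OF c a] f(3) by (simp add: nrm_scale)
  also have "\<dots> \<le> e * nrm A a"
    using f a c by (intro mult_left_mono nrm_act_le) (auto simp: norm_divide)
  finally show ?thesis .
qed

text \<open>The C*-identity squares both summands and keeps them disjoint; the constant 2 of the
  triangle inequality disappears on taking roots.\<close>

lemma nrm_add_disjoint_power:
  assumes "x \<in> carrier A" "y \<in> carrier A" "nrm A x \<le> M" "nrm A y \<le> M"
    and "\<And>t. \<phi> x t = zero (\<A> t) \<or> \<phi> y t = zero (\<A> t)"
  shows "nrm A (x \<oplus> y) ^ (2 ^ k) \<le> 2 * M ^ (2 ^ k)"
  using assms
proof (induction k arbitrary: x y M)
  case 0
  then show ?case using nrm_triangle[of x y] by simp
next
  case (Suc k)
  note mem = Suc.prems(1,2)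
  have mult_zero: "mult (\<A> t) (zero (\<A> t)) z = zero (\<A> t)" "mult (\<A> t) z (zero (\<A> t)) = zero (\<A> t)"
    if "z \<in> carrier (\<A> t)" for t z
    using F.mult_scale_left[OF F.zero_closed that, of 0] F.mult_scale_right[OF that F.zero_closed, of 0]
    by (simp_all add: F.scale_zero_left F.mult_closed F.zero_closed that)
  have adj_zero: "adj (\<A> t) (zero (\<A> t)) = zero (\<A> t)" for t
    using F.adj_scale[OF F.zero_closed, of t 0] by (simp add: F.scale_zero_left F.zero_closed F.adj_closed)
  \<comment> \<open>The cross terms \<open>adj A x \<otimes> y\<close> and
    \<open>adj A y \<otimes> x\<close> vanish in every fibre.\<close>
  have "\<phi> (adj A (x \<oplus> y) \<otimes> (x \<oplus> y)) t = \<phi> (adj A x \<otimes> x \<oplus> adj A y \<otimes> y) t" for t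
    using Suc.prems(5)[of t] mem
    by (auto simp: act_simps F.add_zero F.zero_add mult_zero adj_zero F.zero_closed)
  then have eq: "adj A (x \<oplus> y) \<otimes> (x \<oplus> y) = adj A x \<otimes> x \<oplus> adj A y \<otimes> y"
    using mem by (intro section_eqI) (simp_all add: add_closed mult_closed adj_closed)
  have "nrm A (adj A x \<otimes> x) \<le> M\<^sup>2" "nrm A (adj A y \<otimes> y) \<le> M\<^sup>2"
    using Suc.prems by (simp_all add: cstar_identity nrm_nonneg power_mono)
  moreover have "\<phi> (adj A x \<otimes> x) t = zero (\<A> t) \<or> \<phi> (adj A y \<otimes> y) t = zero (\<A> t)" for t
    using Suc.prems(5)[of t] mem by (auto simp: section_simps adj_closed adj_zero mult_zero F.zero_closed)
  ultimately have "nrm A (adj A x \<otimes> x \<oplus> adj A y \<otimes> y) ^ (2 ^ k) \<le> 2 * (M\<^sup>2) ^ (2 ^ k)"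
    using mem by (intro Suc.IH) (simp_all add: mult_closed adj_closed)
  then show ?case
    using eq cstar_identity[OF add_closed[OF mem]] by (simp add: power_mult[symmetric])
qed

text \<open>If the norm exceeded 1, its powers would be unbounded, against the fixed bound 2;
  exponents of the form \<open>2 ^ n\<close> suffice because they exceed n.\<close>

lemma nrm_add_disjoint:
  assumes "x \<in> carrier A" "y \<in> carrier A" "nrm A x \<le> 1" "nrm A y \<le> 1"
    and "\<And>t. \<phi> x t = zero (\<A> t) \<or> \<phi> y t = zero (\<A> t)"
  shows "nrm A (x \<oplus> y) \<le> 1"
proof (rule ccontr)
  assume "\<not> nrm A (x \<oplus> y) \<le> 1"
  then have gt: "1 < nrm A (x \<oplus> y)" by simp
  then obtain n where "2 < nrm A (x \<oplus> y) ^ n" using real_arch_pow by blast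
  also have "\<dots> \<le> nrm A (x \<oplus> y) ^ (2 ^ n)"
    using gt less_exp[of n] by (intro power_increasing) auto
  also have "\<dots> \<le> 2" using nrm_add_disjoint_power[OF assms, of n] by simp
  finally show False by simp
qed

text \<open>The last conjunct is the induction invariant: the partial sum vanishes wherever all its
  functions do, so the next summand is disjoint from it and \<open>nrm_add_disjoint\<close> keeps
  the sum in the unit ball.\<close>

lemma disjoint_sum_exists:
  assumes \<psi>: "\<psi> \<in> dual_space A" and "finite P"
    and f: "\<And>S. S \<in> P \<Longrightarrow> continuous_on UNIV (f S)" "\<And>S t. S \<in> P \<Longrightarrow> cmod (f S t) \<le> 1"
    and a: "\<And>S. S \<in> P \<Longrightarrow> a S \<in> carrier A" "\<And>S. S \<in> P \<Longrightarrow> nrm A (a S) \<le> 1"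
    and disj: "\<And>S S' t. S \<in> P \<Longrightarrow> S' \<in> P \<Longrightarrow> S \<noteq> S' \<Longrightarrow> f S t = 0 \<or> f S' t = 0"
  shows "\<exists>x\<in>carrier A. nrm A x \<le> 1 \<and> \<psi> x = (\<Sum>S\<in>P. \<psi> (act (f S) (a S))) \<and>
    (\<forall>t. (\<forall>S\<in>P. f S t = 0) \<longrightarrow> \<phi> x t = zero (\<A> t))"
  using assms(2-)
proof (induction P rule: finite_induct)
  case empty
  then show ?case
    using zero_closed nrm_zero dual_space_zero[OF \<psi>] by (intro bexI[of _ \<zero>]) (auto simp: section_zero)
next
  case (insert S P)
  have "\<exists>x\<in>carrier A. nrm A x \<le> 1 \<and> \<psi> x = (\<Sum>S\<in>P. \<psi> (act (f S) (a S))) \<and>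
      (\<forall>t. (\<forall>S\<in>P. f S t = 0) \<longrightarrow> \<phi> x t = zero (\<A> t))"
    by (rule insert.IH; rule insert.prems; simp)
  then obtain x where x: "x \<in> carrier A" "nrm A x \<le> 1" "\<psi> x = (\<Sum>S\<in>P. \<psi> (act (f S) (a S)))"
    "\<And>t. \<forall>S\<in>P. f S t = 0 \<Longrightarrow> \<phi> x t = zero (\<A> t)"
    by blast
  define y where "y = act (f S) (a S)"
  have S: "continuous_on UNIV (f S)" "a S \<in> carrier A" "nrm A (a S) \<le> 1" "\<And>t. cmod (f S t) \<le> 1"
    using insert.prems by auto
  have y: "y \<in> carrier A" "nrm A y \<le> 1" "\<And>t. f S t = 0 \<Longrightarrow> \<phi> y t = zero (\<A> t)"
    unfolding y_def using S nrm_act_le[OF S(1,4,2)]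
    by (auto simp: act_closed section_act F.scale_zero_left section_mem)
  have "\<phi> x t = zero (\<A> t) \<or> \<phi> y t = zero (\<A> t)" for t
    using x(4)[of t] y(3)[of t] insert.prems(5)[of S] insert.hyps(2) by (metis insertCI)
  then have "nrm A (x \<oplus> y) \<le> 1" by (rule nrm_add_disjoint[OF x(1) y(1) x(2) y(2)])
  moreover have "\<phi> (x \<oplus> y) t = zero (\<A> t)" if "\<forall>S\<in>insert S P. f S t = 0" for t
    using that x(1,4) y(1,3) by (simp add: section_simps F.add_zero F.zero_closed)
  moreover have "\<psi> (x \<oplus> y) = (\<Sum>S\<in>insert S P. \<psi> (act (f S) (a S)))"
    using insert.hyps x(3) dual_spaceD(1)[OF \<psi> x(1) y(1)] by (simp add: y_def)
  ultimately show ?case using add_closed[OF x(1) y(1)] by blast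
qed

end

section \<open>Regular measures with total mass zero\<close>

lemma additive_aofm_empty: "additive_aofm A \<Sigma> \<mu> \<Longrightarrow> a \<in> carrier A \<Longrightarrow> \<mu> {} a = 0"
  unfolding additive_aofm_def disjoint_family_on_def by (drule spec[of _ 0]) auto

lemma additive_aofm_Un:
  assumes "additive_aofm A \<Sigma> \<mu>" "S \<in> \<Sigma>" "S' \<in> \<Sigma>" "S \<inter> S' = {}" "a \<in> carrier A"
  shows "\<mu> (S \<union> S') a = \<mu> S a + \<mu> S' a"
proof -
  define R where "R = (\<lambda>i::nat. if i = 0 then S else S')"
  have "(\<forall>i<2. R i \<in> \<Sigma>) \<and> disjoint_family_on R {..<2}"
    using assms(2-4) by (auto simp: R_def disjoint_family_on_def)
  then have "\<mu> (\<Union>i<2. R i) a = (\<Sum>i<2. \<mu> (R i) a)"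
    using assms(1,5) unfolding additive_aofm_def by blast
  moreover have "(\<Union>i<2. R i) = S \<union> S'" by (auto simp: R_def less_2_cases_iff split: if_splits)
  ultimately show ?thesis by (simp add: R_def numeral_2_eq_2)
qed

lemma additive_aofm_telescope:
  assumes add: "additive_aofm A \<Sigma> \<mu>" and a: "a \<in> carrier A"
    and D: "\<And>j. D j \<in> \<Sigma>" "\<And>j. D j - D (Suc j) \<in> \<Sigma>" "\<And>j. D (Suc j) \<subseteq> D j"
  shows "\<mu> (D 0) a = (\<Sum>j<n. \<mu> (D j - D (Suc j)) a) + \<mu> (D n) a"
proof (induction n)
  case (Suc n)
  have "D n = (D n - D (Suc n)) \<union> D (Suc n)" using D(3) by blast
  then have "\<mu> (D n) a = \<mu> (D n - D (Suc n)) a + \<mu> (D (Suc n)) a"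
    using additive_aofm_Un[OF add D(2)[of n] D(1)[of "Suc n"] _ a] by auto
  then show ?case using Suc by simp
qed simp

text \<open>Summation by parts: a sum over slices weighted by their level becomes a plain sum over
  superlevel sets.\<close>

lemma sum_level_differences:
  fixes d :: "nat \<Rightarrow> complex"
  shows "(\<Sum>j<Suc n. of_nat j * (d j - d (Suc j))) = (\<Sum>j<n. d (Suc j)) - of_nat n * d (Suc n)"
  by (induction n) (simp_all add: algebra_simps)

text \<open>Start with bumps that vanish on the inner sets of all the others, and take the positive
  part of each one minus the sum of the rest. Positivity at a point forces a bump to dominate every
  other one there, which two different bumps cannot do. On the inner sets nothing is
  subtracted.\<close>

lemma disjoint_bumps:
  fixes F G :: "'t::t2_space set \<Rightarrow> 't set"
  assumes T: "compact (UNIV :: 't set)" and P: "finite P"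
    and F: "\<And>S. S \<in> P \<Longrightarrow> closed (F S)" and G: "\<And>S. S \<in> P \<Longrightarrow> open (G S)"
    and FG: "\<And>S. S \<in> P \<Longrightarrow> F S \<subseteq> G S"
    and disj: "\<And>S S'. S \<in> P \<Longrightarrow> S' \<in> P \<Longrightarrow> S \<noteq> S' \<Longrightarrow> F S \<inter> F S' = {}"
  obtains f where "\<And>S. S \<in> P \<Longrightarrow> bump (F S) (G S) (f S)"
    "\<And>S S' t. S \<in> P \<Longrightarrow> S' \<in> P \<Longrightarrow> S \<noteq> S' \<Longrightarrow> f S t = 0 \<or> f S' t = 0"
proof -
  have "\<exists>g. bump (F S) (G S \<inter> - \<Union>(F ` (P - {S}))) g" if S: "S \<in> P" for S
  proof -
    have "closed (\<Union>(F ` (P - {S})))" using P F by (intro closed_UN) auto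
    then have "open (G S \<inter> - \<Union>(F ` (P - {S})))" by (intro open_Int G S open_Compl)
    moreover have "F S \<subseteq> G S \<inter> - \<Union>(F ` (P - {S}))" using S FG disj by blast
    ultimately obtain g where "bump (F S) (G S \<inter> - \<Union>(F ` (P - {S}))) g"
      by (rule bump_exists[OF T F[OF S]])
    then show ?thesis by blast
  qed
  then obtain g where g: "\<And>S. S \<in> P \<Longrightarrow> bump (F S) (G S \<inter> - \<Union>(F ` (P - {S}))) (g S)" by metis
  have g0: "0 \<le> g S t" "g S t \<le> 1" if "S \<in> P" for S t using g[OF that] by (auto simp: bump_def)
  define f where "f = (\<lambda>S t. max 0 (g S t - (\<Sum>S'\<in>P - {S}. g S' t)))"
  have le: "g S' t \<le> (\<Sum>R\<in>P - {S}. g R t)" if "S' \<in> P" "S \<noteq> S'" for S S' t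
    using that P g0 by (intro member_le_sum) auto
  show ?thesis
  proof (rule that)
    fix S assume S: "S \<in> P"
    have "continuous_on UNIV (f S)"
      unfolding f_def using g S by (intro continuous_intros) (auto simp: bump_def)
    moreover have "f S t \<le> 1" for t
      using g0(2)[OF S, of t] sum_nonneg[of "P - {S}" "\<lambda>S'. g S' t"] g0(1) by (simp add: f_def)
    moreover have "f S t = 1" if "t \<in> F S" for t
    proof -
      have "g S' t = 0" if "S' \<in> P - {S}" for S'
        using g[of S'] that \<open>t \<in> F S\<close> S by (auto simp: bump_def)
      then show ?thesis using g[OF S] that by (simp add: f_def bump_def)
    qed
    moreover have "f S t = 0" if "t \<notin> G S" for t
      using g[OF S] that sum_nonneg[of "P - {S}" "\<lambda>S'. g S' t"] g0(1) by (simp add: f_def bump_def)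
    ultimately show "bump (F S) (G S) (f S)" by (auto simp: bump_def f_def)
  next
    fix S S' t assume "S \<in> P" "S' \<in> P" "S \<noteq> S'"
    then show "f S t = 0 \<or> f S' t = 0"
      using le[of S' S t] le[of S S' t] by (auto simp: f_def max_def)
  qed
qed

section \<open>Locality of regular measures and uniqueness\<close>

context section_realization
begin

lemma rba_aofmD:
  assumes "\<mu> \<in> rba_aofm A \<A> \<phi> closed_set_algebra"
  shows "\<And>S. S \<in> closed_set_algebra \<Longrightarrow> \<mu> S \<in> dual_space A"
    and "\<And>S a. S \<in> closed_set_algebra \<Longrightarrow> a \<in> carrier A \<Longrightarrow> supp \<A> (\<phi> a) \<inter> S = {} \<Longrightarrow> \<mu> S a = 0"
    and "\<And>S. S \<notin> closed_set_algebra \<Longrightarrow> \<mu> S = (\<lambda>a. 0)"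
    and "additive_aofm A closed_set_algebra \<mu>" "bounded_aofm A closed_set_algebra \<mu>"
    and "weakly_regular_aofm A closed_set_algebra \<mu>"
  using assms by (auto simp: rba_aofm_def aofm_def)

text \<open>Boundedness speaks of partitions of the whole space into nonempty sets. A disjoint
  family becomes one by dropping empty members, which have norm 0, and adding the uncovered
  remainder R; equal members with different indices are empty.\<close>

lemma rba_disjoint_family_bound:
  assumes \<mu>: "\<mu> \<in> rba_aofm A \<A> \<phi> closed_set_algebra"
  obtains B where "0 \<le> B"
    "\<And>S n. (\<And>i. S i \<in> closed_set_algebra) \<Longrightarrow> disjoint_family_on S {..<n::nat} \<Longrightarrow>
      (\<Sum>i<n. dual_norm A (\<mu> (S i))) \<le> B"
proof -
  note \<mu> = rba_aofmD[OF \<mu>]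
  obtain B where B: "\<And>P. finite P \<Longrightarrow> P \<subseteq> closed_set_algebra \<Longrightarrow> partition_on UNIV P \<Longrightarrow>
      (\<Sum>S\<in>P. dual_norm A (\<mu> S)) \<le> B"
    using \<mu>(5) unfolding bounded_aofm_def bdd_above_def by blast
  define d where "d = (\<lambda>S. dual_norm A (\<mu> S))"
  have "\<mu> {} = (\<lambda>a. 0)"
    using additive_aofm_empty[OF \<mu>(4)] dual_spaceD(3)[OF \<mu>(1)[OF empty_in_closed_set_algebra]] by blast
  then have d0: "d {} = 0" by (simp add: d_def dual_norm_const_zero)
  have dpos: "0 \<le> d S" if "S \<in> closed_set_algebra" for S
    using dual_norm_nonneg[OF \<mu>(1)[OF that]] by (simp add: d_def)
  have bound: "(\<Sum>i<n. d (S i)) \<le> B"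
    if S: "\<And>i. S i \<in> closed_set_algebra" "disjoint_family_on S {..<n}" for S and n :: nat
  proof -
    define P0 where "P0 = S ` {..<n} - {{}}"
    define R where "R = - (\<Union>i<n. S i)"
    have R: "R \<in> closed_set_algebra"
    proof -
      have "(\<Union>i<n. S i) \<in> closed_set_algebra"
        by (induction n) (auto simp: lessThan_Suc S closed_set_algebra_Un empty_in_closed_set_algebra)
      then show ?thesis unfolding R_def by (rule closed_set_algebra_Compl)
    qed
    define P where "P = P0 \<union> ({R} - {{}})"
    have P: "finite P" "P \<subseteq> closed_set_algebra" using S R by (auto simp: P_def P0_def)
    have "partition_on UNIV P"
    proof (rule partition_onI)
      have "(\<Union>i<n. S i) \<union> R \<subseteq> \<Union>P" by (auto simp: P_def P0_def)
      moreover have "(\<Union>i<n. S i) \<union> R = UNIV" by (auto simp: R_def)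
      ultimately show "\<Union>P = UNIV" by blast
      fix p q assume pq: "p \<in> P" "q \<in> P" "p \<noteq> q"
      have SS: "S i \<inter> S j = {}" if "i < n" "j < n" "S i \<noteq> S j" for i j
        using that S(2) unfolding disjoint_family_on_def by (metis lessThan_iff)
      have SR: "S i \<inter> R = {}" "R \<inter> S i = {}" if "i < n" for i using that by (auto simp: R_def)
      have "(\<exists>i<n. p = S i) \<or> p = R" "(\<exists>i<n. q = S i) \<or> q = R"
        using pq by (auto simp: P_def P0_def)
      then show "disjnt p q"
        using pq(3) SS SR unfolding disjnt_def by metis
    qed (auto simp: P_def P0_def)
    then have "sum d P \<le> B" unfolding d_def using P by (intro B)
    moreover have "sum d P0 \<le> sum d P"
      using P dpos by (intro sum_mono2) (auto simp: P_def)
    moreover have "sum d P0 = sum d (S ` {..<n})"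
      unfolding P0_def by (intro sum.mono_neutral_left) (auto simp: d0)
    moreover have "sum d (S ` {..<n}) = (\<Sum>i<n. d (S i))"
    proof (subst sum.reindex_nontrivial)
      fix i j assume "i \<in> {..<n}" "j \<in> {..<n}" "i \<noteq> j" "S i = S j"
      then have "S i = {}" using S(2) unfolding disjoint_family_on_def by blast
      then show "d (S i) = 0" by (simp add: d0)
    qed auto
    ultimately show ?thesis by simp
  qed
  have "0 \<le> B" using bound[of "\<lambda>i. {}" 0] by (simp add: empty_in_closed_set_algebra disjoint_family_on_def)
  then show ?thesis using that[of B] bound unfolding d_def by blast
qed

text \<open>A measure is local: on \<open>S\<close> it only sees the values of \<open>f\<close> near \<open>S\<close>, so \<open>f\<close> may be
  truncated at height \<open>e\<close>.\<close>

lemma rba_act_small: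
  fixes f :: "'t \<Rightarrow> real"
  assumes \<mu>: "\<mu> \<in> rba_aofm A \<A> \<phi> closed_set_algebra" and S: "S \<in> closed_set_algebra"
    and f: "continuous_on UNIV f" "\<And>t. t \<in> S \<Longrightarrow> \<bar>f t\<bar> < e" and e: "0 < e" and a: "a \<in> carrier A"
  shows "cmod (\<mu> S (act (\<lambda>t. of_real (f t)) a)) \<le> dual_norm A (\<mu> S) * (e * nrm A a)"
proof -
  note \<mu> = rba_aofmD[OF \<mu>]
  define h where "h = (\<lambda>t. max (- e) (min e (f t)))"
  have h: "continuous_on UNIV h" unfolding h_def using f(1) by (intro continuous_intros)
  define k where "k = (\<lambda>t. f t - h t)"
  have k: "continuous_on UNIV k" unfolding k_def using f(1) h by (intro continuous_intros)
  have c: "continuous_on UNIV (\<lambda>t. complex_of_real (h t))" "continuous_on UNIV (\<lambda>t. complex_of_real (k t))"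
    using h k by (auto intro: continuous_intros)
  have "(\<lambda>t. complex_of_real (f t)) = (\<lambda>t. of_real (h t) + of_real (k t))" by (simp add: k_def)
  then have split: "act (\<lambda>t. of_real (f t)) a = act (\<lambda>t. of_real (h t)) a \<oplus> act (\<lambda>t. of_real (k t)) a"
    using act_add_left[OF c a] by simp
  \<comment> \<open>The strict bound on S matters: the support lies in a closed set where
    \<open>\<bar>f t\<bar>\<close> is at least e, and this set misses S.\<close>
  have "supp \<A> (\<phi> (act (\<lambda>t. of_real (k t)) a)) \<subseteq> {t. e \<le> \<bar>f t\<bar>}"
    unfolding supp_def
  proof (rule closure_minimal)
    show "closed {t. e \<le> \<bar>f t\<bar>}" using f(1) by (intro closed_Collect_le continuous_intros)
    have "k t = 0" if "\<bar>f t\<bar> < e" for t using that e by (auto simp: k_def h_def)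
    moreover have "k t \<noteq> 0" if "\<phi> (act (\<lambda>t. of_real (k t)) a) t \<noteq> zero (\<A> t)" for t
      using that c(2) a by (auto simp: section_act F.scale_zero_left section_mem)
    ultimately show "{t. \<phi> (act (\<lambda>t. of_real (k t)) a) t \<noteq> zero (\<A> t)} \<subseteq> {t. e \<le> \<bar>f t\<bar>}"
      using not_le by blast
  qed
  then have "supp \<A> (\<phi> (act (\<lambda>t. of_real (k t)) a)) \<inter> S = {}" using f(2) by fastforce
  then have "\<mu> S (act (\<lambda>t. of_real (k t)) a) = 0" using \<mu>(2)[OF S act_closed[OF c(2) a]] by simp
  then have "\<mu> S (act (\<lambda>t. of_real (f t)) a) = \<mu> S (act (\<lambda>t. of_real (h t)) a)"
    unfolding split using dual_spaceD(1)[OF \<mu>(1)[OF S] act_closed[OF c(1) a] act_closed[OF c(2) a]] by simp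
  also have "cmod \<dots> \<le> dual_norm A (\<mu> S) * nrm A (act (\<lambda>t. of_real (h t)) a)"
    by (rule dual_norm_bound[OF \<mu>(1)[OF S] act_closed[OF c(1) a]])
  also have "\<dots> \<le> dual_norm A (\<mu> S) * (e * nrm A a)"
    using e c a by (intro mult_left_mono nrm_act_le_scaled dual_norm_nonneg \<mu>(1) S) (auto simp: h_def)
  finally show ?thesis .
qed

text \<open>Vanishing on S does not make the support disjoint from S. But f lies below every height
  on S, so the truncation estimate applies with arbitrarily small e.\<close>

lemma rba_act_zero:
  fixes f :: "'t \<Rightarrow> real"
  assumes \<mu>: "\<mu> \<in> rba_aofm A \<A> \<phi> closed_set_algebra" and S: "S \<in> closed_set_algebra"
    and f: "continuous_on UNIV f" "\<And>t. t \<in> S \<Longrightarrow> f t = 0" and a: "a \<in> carrier A"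
  shows "\<mu> S (act (\<lambda>t. of_real (f t)) a) = 0"
proof -
  define c where "c = dual_norm A (\<mu> S) * nrm A a"
  have c: "0 \<le> c" unfolding c_def using dual_norm_nonneg rba_aofmD(1)[OF \<mu> S] nrm_nonneg[OF a] by simp
  have "cmod (\<mu> S (act (\<lambda>t. of_real (f t)) a)) \<le> 0 + \<eta>" if "0 < \<eta>" for \<eta>
  proof -
    have "cmod (\<mu> S (act (\<lambda>t. of_real (f t)) a)) \<le> dual_norm A (\<mu> S) * (\<eta> / (c + 1) * nrm A a)"
      using that c f(2) by (intro rba_act_small[OF \<mu> S f(1) _ _ a]) auto
    also have "\<dots> = \<eta> * (c / (c + 1))" by (simp add: c_def)
    also have "\<dots> \<le> \<eta>" using that c by (intro mult_left_le) (auto simp: divide_le_eq)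
    finally show ?thesis by simp
  qed
  then have "cmod (\<mu> S (act (\<lambda>t. of_real (f t)) a)) \<le> 0" by (rule field_le_epsilon)
  then show ?thesis by simp
qed

text \<open>Slice \<open>C\<close> along the levels of \<open>f\<close>: replacing \<open>f\<close> by a constant on each slice costs little by
  locality, and the resulting step function is an average of indicators of superlevel sets.\<close>

lemma rba_act_le:
  fixes f :: "'t \<Rightarrow> real"
  assumes \<mu>: "\<mu> \<in> rba_aofm A \<A> \<phi> closed_set_algebra" and C: "C \<in> closed_set_algebra"
    and f: "continuous_on UNIV f" "\<And>t. 0 \<le> f t" "\<And>t. f t \<le> 1" and a: "a \<in> carrier A"
    and small: "\<And>C'. C' \<in> closed_set_algebra \<Longrightarrow> C' \<subseteq> C \<Longrightarrow> cmod (\<mu> C' a) \<le> e"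
  shows "cmod (\<mu> C (act (\<lambda>t. of_real (f t)) a)) \<le> e"
proof (rule field_le_epsilon)
  fix \<eta> :: real assume "0 < \<eta>"
  have add: "additive_aofm A closed_set_algebra \<mu>" by (rule rba_aofmD(4)[OF \<mu>])
  obtain B where B: "0 \<le> B" "\<And>S n. (\<And>i. S i \<in> closed_set_algebra) \<Longrightarrow> disjoint_family_on S {..<n::nat} \<Longrightarrow>
      (\<Sum>i<n. dual_norm A (\<mu> (S i))) \<le> B"
    using rba_disjoint_family_bound[OF \<mu>] by metis
  \<comment> \<open>A slice will cost \<open>2 / n * nrm A a\<close> times the dual norm of the
    measure on it. B bounds the sum of these dual norms whatever the number of slices, so the total
    falls below \<eta>.\<close>
  obtain n :: nat where n: "2 * B * nrm A a / \<eta> < real n" using reals_Archimedean2 by blast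
  have npos: "0 < n"
  proof (rule ccontr)
    assume "\<not> 0 < n"
    then have "2 * B * nrm A a / \<eta> < 0" using n by simp
    then show False using B(1) nrm_nonneg[OF a] \<open>0 < \<eta>\<close> by (simp add: divide_less_0_iff mult_less_0_iff)
  qed
  define D where "D = (\<lambda>j::nat. C \<inter> {t. real j / n \<le> f t})"
  define S where "S = (\<lambda>j. D j - D (Suc j))"
  have D: "D j \<in> closed_set_algebra" for j
    unfolding D_def using f(1)
    by (intro closed_set_algebra_Int C closed_in_closed_set_algebra closed_Collect_le continuous_intros)
  have S: "S j \<in> closed_set_algebra" for j unfolding S_def by (rule closed_set_algebra_Diff[OF D D])
  have anti: "D j \<subseteq> D i" if "i \<le> j" for i j
  proof -
    have "real i / n \<le> real j / n" using that by (simp add: divide_right_mono)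
    then show ?thesis by (auto simp: D_def)
  qed
  have D0: "D 0 = C" using f(2) by (auto simp: D_def)
  \<comment> \<open>Level n is still attained where f equals 1; only the next one is out of reach.
    Hence the slices are indexed by \<open>{..<Suc n}\<close>.\<close>
  have Dn: "D (Suc n) = {}"
  proof -
    have "1 < real (Suc n) / n" using npos by (simp add: less_divide_eq)
    then show ?thesis using f(3) by (auto simp: D_def) (meson less_le_trans not_less order_trans)
  qed
  have disj: "disjoint_family_on S {..<m}" for m
  proof -
    have "S i \<inter> S j = {}" if "i < j" for i j
      using anti[of "Suc i" j] that by (auto simp: S_def)
    then show ?thesis unfolding disjoint_family_on_def by (metis Int_commute nat_neq_iff)
  qed
  have zero: "\<mu> {} b = 0" if "b \<in> carrier A" for b by (rule additive_aofm_empty[OF add that])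
  define b where "b = act (\<lambda>t. of_real (f t)) a"
  have fc: "continuous_on UNIV (\<lambda>t. complex_of_real (f t))" using f(1) by (intro continuous_intros)
  have b: "b \<in> carrier A" unfolding b_def by (rule act_closed[OF fc a])
  have sum_b: "\<mu> C b = (\<Sum>j<Suc n. \<mu> (S j) b)"
    using additive_aofm_telescope[where D = D and n = "Suc n", OF add b D] S anti zero[OF b] by (simp add: S_def D0 Dn)
  have d: "\<mu> (S j) a = \<mu> (D j) a - \<mu> (D (Suc j)) a" for j
  proof -
    have eq: "S j \<union> D (Suc j) = D j" using anti[of j "Suc j"] by (auto simp: S_def)
    have "S j \<inter> D (Suc j) = {}" by (auto simp: S_def)
    from additive_aofm_Un[OF add S D this a] show ?thesis unfolding eq by simp
  qed
  have slice: "cmod (\<mu> (S j) b - of_real (real j / n) * \<mu> (S j) a) \<le> dual_norm A (\<mu> (S j)) * (2 / n * nrm A a)" for j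
  proof -
    have c: "continuous_on UNIV (\<lambda>t. f t - real j / n)" using f(1) by (intro continuous_intros)
    have cc: "continuous_on UNIV (\<lambda>t. complex_of_real (f t - real j / n))" using c by (rule continuous_on_of_real)
    have "\<bar>f t - real j / n\<bar> < 2 / n" if "t \<in> S j" for t
    proof -
      have "real j / n \<le> f t" "f t < real (Suc j) / n" using that by (auto simp: S_def D_def)
      moreover have "real (Suc j) / n = real j / n + 1 / n" by (simp add: add_divide_distrib)
      moreover have "1 / real n < 2 / n" using npos by (simp add: divide_strict_right_mono)
      ultimately show ?thesis by linarith
    qed
    then have "cmod (\<mu> (S j) (act (\<lambda>t. of_real (f t - real j / n)) a)) \<le> dual_norm A (\<mu> (S j)) * (2 / n * nrm A a)"
      using npos by (intro rba_act_small[OF \<mu> S c _ _ a]) auto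
    moreover have "b = act (\<lambda>t. of_real (f t - real j / n)) a \<oplus> of_real (real j / n) \<odot> a"
    proof -
      have "(\<lambda>t. complex_of_real (f t)) = (\<lambda>t. of_real (f t - real j / n) + of_real (real j / n) * 1)" by simp
      then have "b = act (\<lambda>t. of_real (f t - real j / n) + of_real (real j / n) * 1) a" unfolding b_def by (rule arg_cong)
      also have "\<dots> = act (\<lambda>t. of_real (f t - real j / n)) a \<oplus> act (\<lambda>t. of_real (real j / n) * 1) a"
        by (rule act_add_left[OF cc continuous_on_const a])
      also have "act (\<lambda>t. of_real (real j / n) * 1) a = of_real (real j / n) \<odot> a"
        unfolding act_scale_left[OF continuous_on_const a] act_one[OF a] by simp
      finally show ?thesis .
    qed
    then have "\<mu> (S j) b = \<mu> (S j) (act (\<lambda>t. of_real (f t - real j / n)) a) + of_real (real j / n) * \<mu> (S j) a"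
      using dual_spaceD(1,2)[OF rba_aofmD(1)[OF \<mu> S[of j]]] act_closed[OF cc a] scale_closed[OF a] a by simp
    ultimately show ?thesis by simp
  qed
  have "cmod (\<mu> C b - (\<Sum>j<Suc n. of_real (real j / n) * \<mu> (S j) a)) \<le>
      (\<Sum>j<Suc n. dual_norm A (\<mu> (S j)) * (2 / n * nrm A a))"
    unfolding sum_b sum_subtractf[symmetric] by (rule sum_norm_le) (rule slice)
  also have "\<dots> = (\<Sum>j<Suc n. dual_norm A (\<mu> (S j))) * (2 / n * nrm A a)"
    by (simp only: sum_distrib_right)
  also have "\<dots> \<le> B * (2 / n * nrm A a)"
    using nrm_nonneg[OF a] by (intro mult_right_mono B(2) S disj) simp
  also have "\<dots> \<le> \<eta>" using n npos \<open>0 < \<eta>\<close> by (simp add: field_simps)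
  finally have 1: "cmod (\<mu> C b - (\<Sum>j<Suc n. of_real (real j / n) * \<mu> (S j) a)) \<le> \<eta>" .
  \<comment> \<open>The slice at level 0 has weight 0 and \<open>D (Suc n)\<close> is empty, so
    exactly n superlevel sets remain and the factor 1 / n turns their sum into an average.\<close>
  have "(\<Sum>j<Suc n. of_real (real j / n) * \<mu> (S j) a) =
      of_real (1 / n) * (\<Sum>j<Suc n. of_nat j * (\<mu> (D j) a - \<mu> (D (Suc j)) a))"
    unfolding sum_distrib_left by (intro sum.cong refl) (simp add: d)
  also have "\<dots> = of_real (1 / n) * (\<Sum>j<n. \<mu> (D (Suc j)) a)"
    unfolding sum_level_differences[of "\<lambda>j. \<mu> (D j) a"] by (simp add: Dn zero[OF a])
  finally have "cmod (\<Sum>j<Suc n. of_real (real j / n) * \<mu> (S j) a) = (1 / n) * cmod (\<Sum>j<n. \<mu> (D (Suc j)) a)"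
    by (simp only: norm_mult norm_of_real) simp
  also have "\<dots> \<le> (1 / n) * (\<Sum>j<n. e)"
    by (intro mult_left_mono sum_norm_le small D) (auto simp: D_def)
  also have "\<dots> = e" using npos by simp
  finally have 2: "cmod (\<Sum>j<Suc n. of_real (real j / n) * \<mu> (S j) a) \<le> e" .
  show "cmod (\<mu> C (act (\<lambda>t. of_real (f t)) a)) \<le> e + \<eta>"
    using 1 2 norm_triangle_sub[of "\<mu> C b" "\<Sum>j<Suc n. of_real (real j / n) * \<mu> (S j) a"]
    unfolding b_def[symmetric] by linarith
qed

text \<open>Evaluate the vanishing total mass at \<open>b = f a\<close>, where f is 1 on F and 0 off
  G. The part off G vanishes, the part on F is \<open>\<mu> F a\<close>, and so
  \<open>\<mu> F a\<close> is cancelled by the part on \<open>G - F\<close>. Regularity makes the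
  values at a small there; \<open>rba_act_le\<close> carries this over to b. The rest of E lies in
  \<open>G - F\<close> as well.\<close>

lemma rba_eq_zero:
  assumes \<mu>: "\<mu> \<in> rba_aofm A \<A> \<phi> closed_set_algebra" and 0: "\<And>a. a \<in> carrier A \<Longrightarrow> \<mu> UNIV a = 0"
    and E: "E \<in> closed_set_algebra" and a: "a \<in> carrier A"
  shows "\<mu> E a = 0"
proof -
  note \<mu>D = rba_aofmD[OF \<mu>]
  have "cmod (\<mu> E a) \<le> 0 + \<eta>" if "0 < \<eta>" for \<eta>
  proof -
    define e where "e = \<eta> / 2"
    have "0 < e" using that by (simp add: e_def)
    obtain F G where FG: "F \<in> closed_set_algebra" "G \<in> closed_set_algebra" "closure F \<subseteq> E" "E \<subseteq> interior G"
      "\<And>C. C \<in> closed_set_algebra \<Longrightarrow> C \<subseteq> G - F \<Longrightarrow> cmod (\<mu> C a) < e"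
      using \<mu>D(6) E a \<open>0 < e\<close> unfolding weakly_regular_aofm_def by metis
    have sub: "F \<subseteq> E" "E \<subseteq> G" "F \<subseteq> G" using FG closure_subset[of F] interior_subset[of G] by auto
    obtain f where f: "bump (closure F) (interior G) f"
      by (rule bump_exists[OF compact closed_closure open_interior]) (use FG in auto)
    then have fc: "continuous_on UNIV f" and f01: "\<And>t. 0 \<le> f t" "\<And>t. f t \<le> 1"
      and fF: "\<And>t. t \<in> F \<Longrightarrow> f t = 1" and fG: "\<And>t. t \<notin> G \<Longrightarrow> f t = 0"
      using closure_subset[of F] interior_subset[of G] by (auto simp: bump_def)
    define b where "b = act (\<lambda>t. of_real (f t)) a"
    have fcc: "continuous_on UNIV (\<lambda>t. complex_of_real (f t))" using fc by (intro continuous_intros)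
    have b: "b \<in> carrier A" unfolding b_def by (rule act_closed[OF fcc a])
    note Diff = closed_set_algebra_Diff[OF FG(2,1)]
    have "UNIV = (F \<union> (G - F)) \<union> - G" using sub by blast
    then have "\<mu> UNIV b = \<mu> ((F \<union> (G - F)) \<union> - G) b" by simp
    also have "\<dots> = \<mu> F b + \<mu> (G - F) b + \<mu> (- G) b"
      using sub FG(1,2) Diff b
      by (subst additive_aofm_Un[OF \<mu>D(4)] | blast intro: closed_set_algebra_Un closed_set_algebra_Compl)+
    finally have sum: "\<mu> F b + \<mu> (G - F) b + \<mu> (- G) b = 0" using 0[OF b] by simp
    have "\<mu> (- G) b = 0"
      unfolding b_def using fG by (intro rba_act_zero[OF \<mu> closed_set_algebra_Compl[OF FG(2)] fc _ a]) auto
    moreover have "\<mu> F b = \<mu> F a"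
    proof -
      have gc: "continuous_on UNIV (\<lambda>t. f t - 1)" using fc by (intro continuous_intros)
      have gcc: "continuous_on UNIV (\<lambda>t. complex_of_real (f t - 1))" using gc by (rule continuous_on_of_real)
      have "(\<lambda>t. complex_of_real (f t)) = (\<lambda>t. of_real (f t - 1) + 1)" by simp
      then have "b = act (\<lambda>t. of_real (f t - 1) + 1) a" unfolding b_def by (rule arg_cong)
      also have "\<dots> = act (\<lambda>t. of_real (f t - 1)) a \<oplus> a"
        unfolding act_add_left[OF gcc continuous_on_const a] act_one[OF a] ..
      finally have "\<mu> F b = \<mu> F (act (\<lambda>t. of_real (f t - 1)) a) + \<mu> F a"
        using dual_spaceD(1)[OF \<mu>D(1)[OF FG(1)] act_closed[OF gcc a] a] by simp
      moreover have "\<mu> F (act (\<lambda>t. of_real (f t - 1)) a) = 0"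
        using fF by (intro rba_act_zero[OF \<mu> FG(1) gc _ a]) auto
      ultimately show ?thesis by simp
    qed
    moreover have "cmod (\<mu> (G - F) b) \<le> e"
      unfolding b_def by (rule rba_act_le[OF \<mu> Diff fc f01 a]) (use FG(5) in \<open>auto intro: less_imp_le\<close>)
    moreover have "\<mu> F a = - \<mu> (G - F) b" using calculation(1,2) sum by (simp add: eq_neg_iff_add_eq_0)
    ultimately have "cmod (\<mu> F a) \<le> e" by simp
    moreover have "cmod (\<mu> (E - F) a) \<le> e"
      using FG(5)[OF closed_set_algebra_Diff[OF E FG(1)]] sub by fastforce
    moreover have "\<mu> E a = \<mu> F a + \<mu> (E - F) a"
    proof -
      have "F \<union> (E - F) = E" using sub by blast
      then show ?thesis
        using additive_aofm_Un[OF \<mu>D(4) FG(1) closed_set_algebra_Diff[OF E FG(1)] _ a] by auto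
    qed
    ultimately show ?thesis using norm_triangle_ineq[of "\<mu> F a" "\<mu> (E - F) a"] by (simp add: e_def)
  qed
  then have "cmod (\<mu> E a) \<le> 0" by (rule field_le_epsilon)
  then show ?thesis by simp
qed

end

section \<open>The measure of a functional\<close>

context section_realization
begin

lemma bounded_functional_act:
  assumes \<psi>: "\<psi> \<in> dual_space A" and a: "a \<in> carrier A"
  shows "bounded_functional (\<lambda>f. \<psi> (act f a)) (dual_norm A \<psi> * nrm A a)"
proof
  fix f g :: "'t \<Rightarrow> complex" assume f: "continuous_on UNIV f"
  show "\<psi> (act (\<lambda>t. c * f t) a) = c * \<psi> (act f a)" for c
    using dual_spaceD(2)[OF \<psi> act_closed[OF f a]] by (simp add: act_scale_left f a)
  show "\<psi> (act (\<lambda>t. f t + g t) a) = \<psi> (act f a) + \<psi> (act g a)" if "continuous_on UNIV g"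
    using dual_spaceD(1)[OF \<psi> act_closed[OF f a] act_closed[OF that a]] by (simp add: act_add_left f that a)
  show "cmod (\<psi> (act f a)) \<le> dual_norm A \<psi> * nrm A a" if "\<And>t. cmod (f t) \<le> 1"
  proof -
    have "cmod (\<psi> (act f a)) \<le> dual_norm A \<psi> * nrm A (act f a)"
      by (rule dual_norm_bound[OF \<psi> act_closed[OF f a]])
    also have "\<dots> \<le> dual_norm A \<psi> * nrm A a"
      by (intro mult_left_mono nrm_act_le f that a dual_norm_nonneg \<psi>)
    finally show ?thesis .
  qed
qed (rule compact)

definition functional_measure :: "('a \<Rightarrow> complex) \<Rightarrow> ('t, 'a) setfun" where
  "functional_measure \<psi> S a = (if S \<in> closed_set_algebra \<and> a \<in> carrier A
     then riesz_content (\<lambda>f. \<psi> (act f a)) S else 0)"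

context
  fixes \<psi> :: "'a \<Rightarrow> complex"
  assumes \<psi>: "\<psi> \<in> dual_space A"
begin

lemma regular_act:
  "S \<in> closed_set_algebra \<Longrightarrow> a \<in> carrier A \<Longrightarrow> regular_set (\<lambda>f. \<psi> (act f a)) S"
  by (rule bounded_functional.regular_closed_set_algebra[OF bounded_functional_act[OF \<psi>]])

lemma functional_measure_dual:
  assumes S: "S \<in> closed_set_algebra"
  shows "functional_measure \<psi> S \<in> dual_space A"
  unfolding dual_space_def mem_Collect_eq
proof (intro conjI ballI allI impI)
  fix a b assume a: "a \<in> carrier A" and b: "b \<in> carrier A"
  have "riesz_content (\<lambda>f. \<psi> (act f (a \<oplus> b))) S =
      1 * riesz_content (\<lambda>f. \<psi> (act f a)) S + 1 * riesz_content (\<lambda>f. \<psi> (act f b)) S"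
  proof (rule content_linear[OF bounded_functional_act[OF \<psi> a] regular_act[OF S a]
        bounded_functional_act[OF \<psi> b] regular_act[OF S b]
        bounded_functional_act[OF \<psi> add_closed[OF a b]] regular_act[OF S add_closed[OF a b]]])
    fix f :: "'t \<Rightarrow> complex" assume f: "continuous_on UNIV f"
    then show "\<psi> (act f (a \<oplus> b)) = 1 * \<psi> (act f a) + 1 * \<psi> (act f b)"
      using dual_spaceD(1)[OF \<psi> act_closed[OF f a] act_closed[OF f b]] a b by (simp add: act_add_right)
  qed
  then show "functional_measure \<psi> S (a \<oplus> b) = functional_measure \<psi> S a + functional_measure \<psi> S b"
    using S a b by (simp add: functional_measure_def add_closed)
next
  fix c a assume a: "a \<in> carrier A"
  \<comment> \<open>The second summand is a dummy with coefficient 0, so that homogeneity becomes an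
    instance of \<open>content_linear\<close>.\<close>
  have "riesz_content (\<lambda>f. \<psi> (act f (c \<odot> a))) S =
      c * riesz_content (\<lambda>f. \<psi> (act f a)) S + 0 * riesz_content (\<lambda>f. \<psi> (act f a)) S"
  proof (rule content_linear[OF bounded_functional_act[OF \<psi> a] regular_act[OF S a]
        bounded_functional_act[OF \<psi> a] regular_act[OF S a]
        bounded_functional_act[OF \<psi> scale_closed[OF a]] regular_act[OF S scale_closed[OF a]]])
    fix f :: "'t \<Rightarrow> complex" assume f: "continuous_on UNIV f"
    then show "\<psi> (act f (c \<odot> a)) = c * \<psi> (act f a) + 0 * \<psi> (act f a)"
      using dual_spaceD(2)[OF \<psi> act_closed[OF f a]] a by (simp add: act_scale_right)
  qed
  then show "functional_measure \<psi> S (c \<odot> a) = c * functional_measure \<psi> S a"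
    using S a by (simp add: functional_measure_def scale_closed)
next
  show "\<exists>K. \<forall>a\<in>carrier A. cmod (functional_measure \<psi> S a) \<le> K * nrm A a"
    using bounded_functional.content_bound[OF bounded_functional_act[OF \<psi>] regular_act[OF S]] S
    by (intro exI[of _ "dual_norm A \<psi>"]) (simp add: functional_measure_def)
qed (simp add: functional_measure_def)

text \<open>A function vanishing on the support of the section kills a, so the functional has
  variation 0 on the open complement, which contains S.\<close>

lemma functional_measure_supp:
  assumes S: "S \<in> closed_set_algebra" and a: "a \<in> carrier A" and disj: "supp \<A> (\<phi> a) \<inter> S = {}"
  shows "functional_measure \<psi> S a = 0"
proof -
  have zero: "\<phi> a t = zero (\<A> t)" if "t \<notin> supp \<A> (\<phi> a)" for t
    using that closure_subset[of "{t. \<phi> a t \<noteq> zero (\<A> t)}"] by (auto simp: supp_def)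
  have "small_on (\<lambda>f. \<psi> (act f a)) (- supp \<A> (\<phi> a)) 0"
    unfolding small_on_def
  proof (intro allI impI, elim conjE)
    fix g :: "'t \<Rightarrow> complex"
    assume "continuous_on UNIV g" "\<forall>t. t \<notin> - supp \<A> (\<phi> a) \<longrightarrow> g t = 0"
    then have "act g a = \<zero>" using zero a by (intro act_eq_zero) auto
    then show "cmod (\<psi> (act g a)) \<le> 0" using dual_space_zero[OF \<psi>] by simp
  qed
  moreover have "open (- supp \<A> (\<phi> a))" unfolding supp_def by (rule open_Compl) (rule closed_closure)
  ultimately have "cmod (riesz_content (\<lambda>f. \<psi> (act f a)) S) \<le> 0"
    using bounded_functional.content_small[OF bounded_functional_act[OF \<psi> a] regular_act[OF S a]] disj
    by blast
  then show ?thesis by (simp add: functional_measure_def)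
qed

lemma functional_measure_additive: "additive_aofm A closed_set_algebra (functional_measure \<psi>)"
  unfolding additive_aofm_def
proof (intro allI impI ballI, elim conjE)
  fix n :: nat and S :: "nat \<Rightarrow> 't set" and a
  assume S: "\<forall>i<n. S i \<in> closed_set_algebra" "disjoint_family_on S {..<n}" and a: "a \<in> carrier A"
  note bf = bounded_functional_act[OF \<psi> a]
  have "(\<Union>i<n. S i) \<in> closed_set_algebra \<and>
      riesz_content (\<lambda>f. \<psi> (act f a)) (\<Union>i<n. S i) = (\<Sum>i<n. riesz_content (\<lambda>f. \<psi> (act f a)) (S i))"
    using S
  proof (induction n)
    case 0
    then show ?case
      using bounded_functional.content_empty[OF bf] by (simp add: empty_in_closed_set_algebra)
  next
    case (Suc n)
    then have IH: "(\<Union>i<n. S i) \<in> closed_set_algebra"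
        "riesz_content (\<lambda>f. \<psi> (act f a)) (\<Union>i<n. S i) = (\<Sum>i<n. riesz_content (\<lambda>f. \<psi> (act f a)) (S i))"
      by (auto simp: disjoint_family_on_def)
    have Sn: "S n \<in> closed_set_algebra" using Suc.prems(1) by simp
    have "S i \<inter> S n = {}" if "i < n" for i
      using that Suc.prems(2) by (simp add: disjoint_family_on_def)
    then have "(\<Union>i<n. S i) \<inter> S n = {}" by auto
    from bounded_functional.content_disjoint_Un[OF bf regular_act[OF IH(1) a] regular_act[OF Sn a] this]
    show ?case
      using closed_set_algebra_Un[OF IH(1) Sn] IH(2) by (simp add: lessThan_Suc Un_commute add.commute)
  qed
  then show "functional_measure \<psi> (\<Union>i<n. S i) a = (\<Sum>i<n. functional_measure \<psi> (S i) a)"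
    using S(1) a by (simp add: functional_measure_def)
qed

lemma functional_measure_weakly_regular:
  "weakly_regular_aofm A closed_set_algebra (functional_measure \<psi>)"
  unfolding weakly_regular_aofm_def
proof (intro ballI allI impI)
  fix E :: "'t set" and a and e :: real
  assume E: "E \<in> closed_set_algebra" and a: "a \<in> carrier A" and e: "0 < e"
  \<comment> \<open>The content is bounded by a weak inequality; halving e makes it strict.\<close>
  obtain F G where FG: "closed F" "open G" "F \<subseteq> E" "E \<subseteq> G"
    "\<And>C. regular_set (\<lambda>f. \<psi> (act f a)) C \<Longrightarrow> C \<subseteq> G - F \<Longrightarrow> cmod (riesz_content (\<lambda>f. \<psi> (act f a)) C) \<le> e / 2"
    by (rule bounded_functional.content_regular[OF bounded_functional_act[OF \<psi> a] regular_act[OF E a] half_gt_zero[OF e]])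
      (rule that)
  have "cmod (functional_measure \<psi> C a) < e" if "C \<in> closed_set_algebra" "C \<subseteq> G - F" for C
    using FG(5)[OF regular_act[OF that(1) a] that(2)] that(1) a e by (simp add: functional_measure_def)
  then show "\<exists>F\<in>closed_set_algebra. \<exists>G\<in>closed_set_algebra. closure F \<subseteq> E \<and> E \<subseteq> interior G \<and>
      (\<forall>C\<in>closed_set_algebra. C \<subseteq> G - F \<longrightarrow> cmod (functional_measure \<psi> C a) < e)"
    using FG(1-4)
    by (intro bexI[OF _ closed_in_closed_set_algebra[OF FG(1)]] bexI[OF _ open_in_closed_set_algebra[OF FG(2)]])
      (simp add: closure_closed interior_open)
qed

text \<open>Testing \<open>\<psi>\<close> on a sum of elements \<open>f\<^sub>S a\<^sub>S\<close> with disjointly supported \<open>f\<^sub>S\<close>, a single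
  element of the unit ball, bounds all \<open>\<parallel>\<mu>(S)\<parallel>\<close> together.\<close>

lemma functional_measure_sum_le:
  assumes P: "finite P" "P \<subseteq> closed_set_algebra" "disjoint P"
  shows "(\<Sum>S\<in>P. dual_norm A (functional_measure \<psi> S)) \<le> dual_norm A \<psi>"
proof (rule field_le_epsilon)
  fix \<eta> :: real assume "0 < \<eta>"
  \<comment> \<open>Each set costs d for nearly attaining the dual norm and d for replacing the
    content by a bump, in total \<open>2 * d * card P\<close>. The added 1 in c covers empty
    P.\<close>
  define c d where "c = real (card P) + 1" and "d = \<eta> / 2 / c"
  have d: "0 < c" "0 < d" using \<open>0 < \<eta>\<close> by (simp_all add: c_def d_def add_nonneg_pos)
  \<comment> \<open>Packing element and sets into one triple lets a single choice over P keep them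
    matched: F and G belong to the element a selected for the same S.\<close>
  define Q where "Q = (\<lambda>S x. case x of (a, F, G) \<Rightarrow> a \<in> carrier A \<and> nrm A a \<le> 1 \<and>
    dual_norm A (functional_measure \<psi> S) - d < Re (functional_measure \<psi> S a) \<and>
    closed F \<and> open G \<and> F \<subseteq> S \<and> S \<subseteq> G \<and>
    (\<forall>f. bump F G f \<longrightarrow> cmod (\<psi> (act (\<lambda>t. of_real (f t)) a) - functional_measure \<psi> S a) \<le> d))"
  have "\<exists>x. Q S x" if "S \<in> P" for S
  proof -
    have S: "S \<in> closed_set_algebra" using that P by blast
    obtain a where a: "a \<in> carrier A" "nrm A a \<le> 1"
        "dual_norm A (functional_measure \<psi> S) - d < Re (functional_measure \<psi> S a)"
      by (rule dual_norm_attained[OF functional_measure_dual[OF S] d(2)])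
    obtain F G where FG: "closed F" "open G" "F \<subseteq> S" "S \<subseteq> G"
      "\<And>F' G' f. \<lbrakk>closed F'; open G'; F \<subseteq> F'; F' \<subseteq> S; S \<subseteq> G'; G' \<subseteq> G; bump F' G' f\<rbrakk>
        \<Longrightarrow> cmod (\<psi> (act (\<lambda>t. of_real (f t)) a) - riesz_content (\<lambda>f. \<psi> (act f a)) S) \<le> d"
      by (rule bounded_functional.small_pair[OF bounded_functional_act[OF \<psi> a(1)] regular_act[OF S a(1)] d(2)])
        (rule that)
    have "Q S (a, F, G)"
      unfolding Q_def using a FG(1-4) FG(5)[OF FG(1,2) order_refl FG(3,4) order_refl] S
      by (simp add: functional_measure_def)
    then show ?thesis by (rule exI)
  qed
  then obtain x where "\<And>S. S \<in> P \<Longrightarrow> Q S (x S)" by metis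
  moreover define a F G where "a = (\<lambda>S. fst (x S))" and "F = (\<lambda>S. fst (snd (x S)))" and "G = (\<lambda>S. snd (snd (x S)))"
  ultimately have a: "\<And>S. S \<in> P \<Longrightarrow> a S \<in> carrier A" "\<And>S. S \<in> P \<Longrightarrow> nrm A (a S) \<le> 1"
      "\<And>S. S \<in> P \<Longrightarrow> dual_norm A (functional_measure \<psi> S) - d < Re (functional_measure \<psi> S (a S))"
    and FG: "\<And>S. S \<in> P \<Longrightarrow> closed (F S)" "\<And>S. S \<in> P \<Longrightarrow> open (G S)"
      "\<And>S. S \<in> P \<Longrightarrow> F S \<subseteq> S" "\<And>S. S \<in> P \<Longrightarrow> S \<subseteq> G S"
    and approx: "\<And>S f. S \<in> P \<Longrightarrow> bump (F S) (G S) f \<Longrightarrow>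
      cmod (\<psi> (act (\<lambda>t. of_real (f t)) (a S)) - functional_measure \<psi> S (a S)) \<le> d"
    unfolding Q_def by (simp_all add: case_prod_beta)
  have FG_sub: "F S \<subseteq> G S" if "S \<in> P" for S using FG(3,4)[OF that] by (rule subset_trans)
  \<comment> \<open>Only the inner sets inherit disjointness from P; the open sets may overlap, so
    disjoint functions have to come from \<open>disjoint_bumps\<close>.\<close>
  have F_disj: "F S \<inter> F S' = {}" if "S \<in> P" "S' \<in> P" "S \<noteq> S'" for S S'
    using FG(3)[OF that(1)] FG(3)[OF that(2)] disjointD[OF P(3) that] by blast
  obtain f where f: "\<And>S. S \<in> P \<Longrightarrow> bump (F S) (G S) (f S)"
    "\<And>S S' t. S \<in> P \<Longrightarrow> S' \<in> P \<Longrightarrow> S \<noteq> S' \<Longrightarrow> f S t = 0 \<or> f S' t = 0"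
    by (rule disjoint_bumps[where F = F and G = G, OF compact P(1) FG(1) FG(2) FG_sub F_disj]; (assumption | rule that))
  define h where "h = (\<lambda>S t. complex_of_real (f S t))"
  have "\<exists>x\<in>carrier A. nrm A x \<le> 1 \<and> \<psi> x = (\<Sum>S\<in>P. \<psi> (act (h S) (a S))) \<and>
      (\<forall>t. (\<forall>S\<in>P. h S t = 0) \<longrightarrow> \<phi> x t = zero (\<A> t))"
    by (rule disjoint_sum_exists[OF \<psi> P(1)])
      (use f a in \<open>auto simp: h_def bump_def intro!: continuous_on_of_real\<close>)
  then obtain x where x: "x \<in> carrier A" "nrm A x \<le> 1" "\<psi> x = (\<Sum>S\<in>P. \<psi> (act (h S) (a S)))" by blast
  have "dual_norm A (functional_measure \<psi> S) \<le> Re (\<psi> (act (h S) (a S))) + 2 * d" if "S \<in> P" for S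
  proof -
    have "cmod (\<psi> (act (h S) (a S)) - functional_measure \<psi> S (a S)) \<le> d"
      unfolding h_def by (rule approx[OF that f(1)[OF that]])
    then have "\<bar>Re (\<psi> (act (h S) (a S))) - Re (functional_measure \<psi> S (a S))\<bar> \<le> d"
      by (metis abs_Re_le_cmod minus_complex.sel(1) order_trans)
    then show ?thesis using a(3)[OF that] by linarith
  qed
  then have "(\<Sum>S\<in>P. dual_norm A (functional_measure \<psi> S)) \<le> (\<Sum>S\<in>P. Re (\<psi> (act (h S) (a S))) + 2 * d)"
    by (rule sum_mono)
  also have "\<dots> = Re (\<psi> x) + 2 * d * card P"
    unfolding x(3) by (simp add: sum.distrib)
  also have "\<dots> \<le> dual_norm A \<psi> + \<eta>"
  proof (rule add_mono)
    show "Re (\<psi> x) \<le> dual_norm A \<psi>"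
      using dual_norm_upper[OF \<psi> x(1,2)] complex_Re_le_cmod[of "\<psi> x"] by linarith
    have "2 * d * card P = \<eta> * (real (card P) / c)" by (simp add: d_def)
    also have "\<dots> \<le> \<eta>" using \<open>0 < \<eta>\<close> d(1) by (intro mult_left_le) (auto simp: divide_le_eq c_def)
    finally show "2 * d * card P \<le> \<eta>" .
  qed
  finally show "(\<Sum>S\<in>P. dual_norm A (functional_measure \<psi> S)) \<le> dual_norm A \<psi> + \<eta>" .
qed

lemma functional_measure_rba: "functional_measure \<psi> \<in> rba_aofm A \<A> \<phi> closed_set_algebra"
proof -
  have "aofm A \<A> \<phi> closed_set_algebra (functional_measure \<psi>)"
    using functional_measure_dual functional_measure_supp
    by (auto simp: aofm_def functional_measure_def[abs_def])
  moreover have "bounded_aofm A closed_set_algebra (functional_measure \<psi>)"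
    unfolding bounded_aofm_def
    by (rule bdd_aboveI[of _ "dual_norm A \<psi>"]) (auto simp: partition_on_def intro!: functional_measure_sum_le)
  ultimately show ?thesis
    using functional_measure_additive functional_measure_weakly_regular by (simp add: rba_aofm_def)
qed

lemma total_mass_functional_measure: "total_mass (functional_measure \<psi>) = \<psi>"
proof
  fix a
  show "total_mass (functional_measure \<psi>) a = \<psi> a"
  proof (cases "a \<in> carrier A")
    case True
    then show ?thesis
      using bounded_functional.content_UNIV[OF bounded_functional_act[OF \<psi> True]]
      by (simp add: total_mass_def functional_measure_def UNIV_in_closed_set_algebra act_one)
  next
    case False
    then show ?thesis
      using dual_spaceD(3)[OF \<psi>] by (simp add: total_mass_def functional_measure_def)
  qed
qed

end

section \<open>Linear structure and bijectivity of the total mass\<close>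

lemma zero_rba: "(\<lambda>S a. 0) \<in> rba_aofm A \<A> \<phi> closed_set_algebra"
proof -
  have "(\<lambda>a. 0) \<in> dual_space A" by (auto simp: dual_space_def intro: exI[of _ 0])
  moreover have "weakly_regular_aofm A closed_set_algebra (\<lambda>(S :: 't set) a. 0)"
    unfolding weakly_regular_aofm_def
    by (intro ballI allI impI bexI[OF _ empty_in_closed_set_algebra] bexI[OF _ UNIV_in_closed_set_algebra]) simp
  ultimately show ?thesis
    by (auto simp: rba_aofm_def aofm_def additive_aofm_def bounded_aofm_def dual_norm_const_zero)
qed

context
  fixes \<mu> assumes \<mu>: "\<mu> \<in> rba_aofm A \<A> \<phi> closed_set_algebra"
begin

lemma setfun_add_rba:
  assumes \<nu>: "\<nu> \<in> rba_aofm A \<A> \<phi> closed_set_algebra"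
  shows "setfun_add \<mu> \<nu> \<in> rba_aofm A \<A> \<phi> closed_set_algebra"
proof -
  note \<mu>D = rba_aofmD[OF \<mu>] and \<nu>D = rba_aofmD[OF \<nu>]
  have "aofm A \<A> \<phi> closed_set_algebra (setfun_add \<mu> \<nu>)"
    using \<mu>D(1-3) \<nu>D(1-3) by (auto simp: aofm_def setfun_add_def dual_space_add)
  moreover have "additive_aofm A closed_set_algebra (setfun_add \<mu> \<nu>)"
    using \<mu>D(4) \<nu>D(4) by (simp add: additive_aofm_def setfun_add_def sum.distrib)
  moreover have "bounded_aofm A closed_set_algebra (setfun_add \<mu> \<nu>)"
  proof -
    obtain B where B: "\<And>P. finite P \<Longrightarrow> P \<subseteq> closed_set_algebra \<Longrightarrow> partition_on UNIV P \<Longrightarrow>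
        (\<Sum>S\<in>P. dual_norm A (\<mu> S)) \<le> B"
      using \<mu>D(5) unfolding bounded_aofm_def bdd_above_def by blast
    obtain B' where B': "\<And>P. finite P \<Longrightarrow> P \<subseteq> closed_set_algebra \<Longrightarrow> partition_on UNIV P \<Longrightarrow>
        (\<Sum>S\<in>P. dual_norm A (\<nu> S)) \<le> B'"
      using \<nu>D(5) unfolding bounded_aofm_def bdd_above_def by blast
    have "(\<Sum>S\<in>P. dual_norm A (setfun_add \<mu> \<nu> S)) \<le> B + B'"
      if "finite P" "P \<subseteq> closed_set_algebra" "partition_on UNIV P" for P
    proof -
      have "(\<Sum>S\<in>P. dual_norm A (setfun_add \<mu> \<nu> S)) \<le> (\<Sum>S\<in>P. dual_norm A (\<mu> S) + dual_norm A (\<nu> S))"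
        unfolding setfun_add_def using that(2) by (intro sum_mono dual_norm_add_le \<mu>D(1) \<nu>D(1)) auto
      also have "\<dots> \<le> B + B'" unfolding sum.distrib using that by (intro add_mono B B')
      finally show ?thesis .
    qed
    then show ?thesis unfolding bounded_aofm_def by (intro bdd_aboveI[of _ "B + B'"]) auto
  qed
  moreover have "weakly_regular_aofm A closed_set_algebra (setfun_add \<mu> \<nu>)"
    unfolding weakly_regular_aofm_def
  proof (intro ballI allI impI)
    fix E :: "'t set" and a and e :: real
    assume E: "E \<in> closed_set_algebra" and a: "a \<in> carrier A" and e: "0 < e"
    obtain F G where 1: "F \<in> closed_set_algebra" "G \<in> closed_set_algebra" "closure F \<subseteq> E" "E \<subseteq> interior G"
      "\<And>C. C \<in> closed_set_algebra \<Longrightarrow> C \<subseteq> G - F \<Longrightarrow> cmod (\<mu> C a) < e / 2"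
      using \<mu>D(6) E a half_gt_zero[OF e] unfolding weakly_regular_aofm_def by metis
    obtain F' G' where 2: "F' \<in> closed_set_algebra" "G' \<in> closed_set_algebra" "closure F' \<subseteq> E" "E \<subseteq> interior G'"
      "\<And>C. C \<in> closed_set_algebra \<Longrightarrow> C \<subseteq> G' - F' \<Longrightarrow> cmod (\<nu> C a) < e / 2"
      using \<nu>D(6) E a half_gt_zero[OF e] unfolding weakly_regular_aofm_def by metis
    have "cmod (setfun_add \<mu> \<nu> C a) < e" if "C \<in> closed_set_algebra" "C \<subseteq> G \<inter> G' - (F \<union> F')" for C
    proof -
      have "cmod (\<mu> C a) < e / 2" "cmod (\<nu> C a) < e / 2"
        using that by (blast intro: 1(5) 2(5))+
      then show ?thesis using norm_triangle_ineq[of "\<mu> C a" "\<nu> C a"] by (simp add: setfun_add_def)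
    qed
    then show "\<exists>F\<in>closed_set_algebra. \<exists>G\<in>closed_set_algebra. closure F \<subseteq> E \<and> E \<subseteq> interior G \<and>
        (\<forall>C\<in>closed_set_algebra. C \<subseteq> G - F \<longrightarrow> cmod (setfun_add \<mu> \<nu> C a) < e)"
      using 1(3,4) 2(3,4)
      by (intro bexI[OF _ closed_set_algebra_Un[OF 1(1) 2(1)]] bexI[OF _ closed_set_algebra_Int[OF 1(2) 2(2)]])
        (simp add: closure_Un)
  qed
  ultimately show ?thesis by (simp add: rba_aofm_def)
qed

lemma setfun_scale_rba: "setfun_scale c \<mu> \<in> rba_aofm A \<A> \<phi> closed_set_algebra"
proof -
  note \<mu>D = rba_aofmD[OF \<mu>]
  have "aofm A \<A> \<phi> closed_set_algebra (setfun_scale c \<mu>)"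
    using \<mu>D(1-3) by (auto simp: aofm_def setfun_scale_def dual_space_scale)
  moreover have "additive_aofm A closed_set_algebra (setfun_scale c \<mu>)"
    using \<mu>D(4) by (simp add: additive_aofm_def setfun_scale_def sum_distrib_left)
  moreover have "bounded_aofm A closed_set_algebra (setfun_scale c \<mu>)"
  proof -
    obtain B where B: "\<And>P. finite P \<Longrightarrow> P \<subseteq> closed_set_algebra \<Longrightarrow> partition_on UNIV P \<Longrightarrow>
        (\<Sum>S\<in>P. dual_norm A (\<mu> S)) \<le> B"
      using \<mu>D(5) unfolding bounded_aofm_def bdd_above_def by blast
    have "(\<Sum>S\<in>P. dual_norm A (setfun_scale c \<mu> S)) \<le> cmod c * B"
      if "finite P" "P \<subseteq> closed_set_algebra" "partition_on UNIV P" for P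
    proof -
      have "(\<Sum>S\<in>P. dual_norm A (setfun_scale c \<mu> S)) \<le> (\<Sum>S\<in>P. cmod c * dual_norm A (\<mu> S))"
        unfolding setfun_scale_def using that(2) by (intro sum_mono dual_norm_scale_le \<mu>D(1)) auto
      also have "\<dots> \<le> cmod c * B" unfolding sum_distrib_left[symmetric] using that by (intro mult_left_mono B) auto
      finally show ?thesis .
    qed
    then show ?thesis unfolding bounded_aofm_def by (intro bdd_aboveI[of _ "cmod c * B"]) auto
  qed
  moreover have "weakly_regular_aofm A closed_set_algebra (setfun_scale c \<mu>)"
    unfolding weakly_regular_aofm_def
  proof (intro ballI allI impI)
    fix E :: "'t set" and a and e :: real
    assume E: "E \<in> closed_set_algebra" and a: "a \<in> carrier A" and e: "0 < e"
    \<comment> \<open>The added 1 admits \<open>c = 0\<close> and makes the final estimate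
      strict.\<close>
    have pos: "0 < cmod c + 1" by (simp add: add_nonneg_pos)
    then have "0 < e / (cmod c + 1)" using e by simp
    then obtain F G where 1: "F \<in> closed_set_algebra" "G \<in> closed_set_algebra" "closure F \<subseteq> E" "E \<subseteq> interior G"
      "\<And>C. C \<in> closed_set_algebra \<Longrightarrow> C \<subseteq> G - F \<Longrightarrow> cmod (\<mu> C a) < e / (cmod c + 1)"
      using \<mu>D(6) E a unfolding weakly_regular_aofm_def by metis
    have "cmod (setfun_scale c \<mu> C a) < e" if "C \<in> closed_set_algebra" "C \<subseteq> G - F" for C
    proof -
      have "cmod (setfun_scale c \<mu> C a) \<le> (cmod c + 1) * cmod (\<mu> C a)"
        by (simp add: setfun_scale_def norm_mult mult_right_mono)
      also have "\<dots> < (cmod c + 1) * (e / (cmod c + 1))" using 1(5)[OF that] pos by (rule mult_strict_left_mono)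
      also have "\<dots> = e" using pos by simp
      finally show ?thesis .
    qed
    then show "\<exists>F\<in>closed_set_algebra. \<exists>G\<in>closed_set_algebra. closure F \<subseteq> E \<and> E \<subseteq> interior G \<and>
        (\<forall>C\<in>closed_set_algebra. C \<subseteq> G - F \<longrightarrow> cmod (setfun_scale c \<mu> C a) < e)"
      using 1(3,4) by (intro bexI[OF _ 1(1)] bexI[OF _ 1(2)]) simp
  qed
  ultimately show ?thesis by (simp add: rba_aofm_def)
qed

end

lemma total_mass_inj: "inj_on total_mass (rba_aofm A \<A> \<phi> closed_set_algebra)"
proof (rule inj_onI)
  fix \<mu> \<nu> assume \<mu>: "\<mu> \<in> rba_aofm A \<A> \<phi> closed_set_algebra" and \<nu>: "\<nu> \<in> rba_aofm A \<A> \<phi> closed_set_algebra"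
    and eq: "total_mass \<mu> = total_mass \<nu>"
  define \<delta> where "\<delta> = setfun_add \<mu> (setfun_scale (-1) \<nu>)"
  have \<delta>: "\<delta> \<in> rba_aofm A \<A> \<phi> closed_set_algebra"
    unfolding \<delta>_def by (rule setfun_add_rba[OF \<mu> setfun_scale_rba[OF \<nu>]])
  have \<delta>_eq: "\<delta> S a = \<mu> S a - \<nu> S a" for S a by (simp add: \<delta>_def setfun_add_def setfun_scale_def)
  have "\<delta> UNIV a = 0" for a
    using fun_cong[OF eq, of a] by (simp add: \<delta>_eq total_mass_def)
  then have zero: "\<delta> S a = 0" if "S \<in> closed_set_algebra" "a \<in> carrier A" for S a
    using rba_eq_zero[OF \<delta>] that by blast
  show "\<mu> = \<nu>"
  \<comment> \<open>Equality as functions also concerns arguments off the algebra of sets and off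
    the carrier; there both sides are 0 by convention.\<close>
  proof (intro ext)
    fix S a
    show "\<mu> S a = \<nu> S a"
    proof (cases "S \<in> closed_set_algebra")
      case True
      then show ?thesis
        using zero[OF True, of a] dual_spaceD(3)[OF rba_aofmD(1)[OF \<mu> True]]
          dual_spaceD(3)[OF rba_aofmD(1)[OF \<nu> True]]
        by (cases "a \<in> carrier A") (auto simp: \<delta>_eq)
    next
      case False
      then show ?thesis using rba_aofmD(3)[OF \<mu>] rba_aofmD(3)[OF \<nu>] by simp
    qed
  qed
qed

lemma total_mass_bij: "bij_betw total_mass (rba_aofm A \<A> \<phi> closed_set_algebra) (dual_space A)"
  unfolding bij_betw_def
proof (intro conjI total_mass_inj subset_antisym subsetI)
  fix \<psi> assume "\<psi> \<in> total_mass ` rba_aofm A \<A> \<phi> closed_set_algebra"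
  then show "\<psi> \<in> dual_space A"
    using rba_aofmD(1)[OF _ UNIV_in_closed_set_algebra] by (auto simp: total_mass_def)
next
  fix \<psi> assume "\<psi> \<in> dual_space A"
  then show "\<psi> \<in> total_mass ` rba_aofm A \<A> \<phi> closed_set_algebra"
    using total_mass_functional_measure functional_measure_rba by (metis imageI)
qed

end

theorem theorem3p6:
  fixes A :: "'a star_struct"
    and \<A> :: "'t::t2_space \<Rightarrow> 'b star_struct"
    and \<Gamma> :: "('t \<Rightarrow> 'b) set"
    and \<phi> :: "'a \<Rightarrow> 't \<Rightarrow> 'b"
  assumes "cstar_algebra A" and "unital A" and "separable_space (nrm_topology A)"
    and "compact (UNIV :: 't set)"
    and "\<And>t. cstar_algebra (\<A> t)"
    and "maximal_full_algebra \<A> \<Gamma>"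
    and "star_isomorphism A (field_algebra \<A> \<Gamma>) \<phi>"
  shows "let RBA = rba_aofm A \<A> \<phi> closed_set_algebra in
      (\<lambda>S a. 0) \<in> RBA \<and>
      (\<forall>\<mu>\<in>RBA. \<forall>\<nu>\<in>RBA. setfun_add \<mu> \<nu> \<in> RBA \<and>
         total_mass (setfun_add \<mu> \<nu>) = (\<lambda>a. total_mass \<mu> a + total_mass \<nu> a)) \<and>
      (\<forall>c. \<forall>\<mu>\<in>RBA. setfun_scale c \<mu> \<in> RBA \<and>
         total_mass (setfun_scale c \<mu>) = (\<lambda>a. c * total_mass \<mu> a)) \<and>
      bij_betw total_mass RBA (dual_space A)"
proof -
  interpret fibres: cstar_fibres \<A> by (rule cstar_fibres.intro) (rule assms(5))
  interpret A: cstar_algebra A by (rule assms(1))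
  interpret section_realization A \<A> \<Gamma> \<phi>
  proof
    show "\<Gamma> \<subseteq> operator_fields \<A>"
      using assms(6) by (simp add: maximal_full_algebra_def full_algebra_def)
    show "(\<lambda>t. scale (\<A> t) (f t) (x t)) \<in> \<Gamma>" if "continuous_on UNIV f" "x \<in> \<Gamma>" for f x
      using fibres.maximal_full_algebra_scale[OF assms(6,4)] that by blast
  qed (rule assms)+
  show ?thesis
    unfolding Let_def
    using zero_rba setfun_add_rba setfun_scale_rba total_mass_bij
    by (auto simp: total_mass_def setfun_add_def setfun_scale_def)
qed

end
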